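(* In the setting described in the context, let $(T_n)\subset(0,\infty)$ with $T_n\to\infty$, and for each $n$ let $\varphi^{T_n}\in\Phi_{ad}$ be a global minimizer of $J_{T_n}$ over $\Phi_{ad}$. Let $\varphi^\infty\in\Phi_{ad}$ be such that, along a subsequence (not relabeled), $\varphi^{T_n}\rightharpoonup\varphi^\infty$ weakly in $H^1(\Omega)$, $\varphi^{T_n}\to\varphi^\infty$ in $L^p(\Omega)$ for all $2\le p<\infty$ and a.e. in $\Omega$, and $\varphi^{T_n}\to\varphi^\infty$ weakly-$*$ in $L^\infty(\Omega)$. Then $\varphi^\infty$ is a global minimizer of $J_s$ over $\Phi_{ad}$.
   Context: Domain and spaces. $\Omega\subset\mathbb{R}^2$ is a bounded Lipschitz domain, $\omega\subset\Omega$ is measurable with characteristic function $\chi_\omega$. $\boldsymbol{V}=\{\psi\in H^1_0(\Omega)^2:\operatorname{div}\psi=0\}$ with norm $\|\psi\|_{\boldsymbol V}=\|\nabla\psi\|_{L^2}$; $\boldsymbol{H}=\{\psi\in L^2(\Omega)^2:\operatorname{div}\psi=0,\ \psi\cdot\mathbf n=0\text{ on }\partial\Omega\}$ with the $L^2$ norm. For $T>0$, $I_T=(0,T)$, $\Omega_T=\Omega\times(0,T)$ and $W^2_T(\boldsymbol V)=\{v\in L^2(I_T;\boldsymbol V):\partial_t v\in L^2(I_T;\boldsymbol V^* )\}$. Constants $c_P,c_L>0$ satisfy $\|\mathbf v\|_{L^2}\le c_P\|\nabla \mathbf v\|_{L^2}$ and $\|\mathbf v\|_{L^4}\le\sqrt{c_L}\|\mathbf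 v\|_{L^2}^{1/2}\|\nabla \mathbf v\|_{L^2}^{1/2}$ for all $\mathbf v\in H^1_0(\Omega)^2$. Designs. $\Phi_{ad}=\{\varphi\in H^1(\Omega):|\varphi|\le1\text{ a.e. in }\Omega\}$. The parameters $\varepsilon,\gamma,\mu>0$ are fixed. Coefficients. $\alpha_\varepsilon,\beta_\varepsilon:\mathbb{R}\to\mathbb{R}$ are nonnegative and Lipschitz continuous with $\alpha_\varepsilon(1)=\beta_\varepsilon(1)=0$, $\alpha_\varepsilon(-1)=\overline\alpha_\varepsilon>0$, $\beta_\varepsilon(-1)=\overline\beta_\varepsilon>0$ (members of families with $\overline\alpha_\varepsilon,\overline\beta_\varepsilon\to+\infty$ as $\varepsilon\to0$; here $\varepsilon$ is fixed). Moreover, as superposition operators from $\Phi_{ad}$ to $L^2(\Omega)$ they are Fréchet differentiable (with increments $\delta\varphi\in H^1(\Omega)\cap L^\infty(\Omega)$ such that $\varphi+\delta\varphi\in\Phi_{ad}$, measured in the norm of $H^1\cap L^\infty$, and the remainder measured in $L^2$), with derivatives $\alpha_\varepsilon'(\varphi)\delta\varphi=\mathcal A_\varepsilon(\varphi)\delta\varphi$, $\beta_\varepsilon'(\varphi)\delta\varphi=\mathcal B_\varepsilon(\varphi)\delta\varphi$, where for some $p\ge4$ the maps $\mathcal A_\varepsilon,\mathcal B_\varepsilon:\Phi_{ad}\to L^p(\Omega)$ satisfy $\max\{\|\mathcal A_\varepsilon(\varphi)\|_{L^p},\|\mathcal B_\varepsilon(\varphi)\|_{L^p}\}\le c_{\mathcal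 A}$ for all $\varphi\in\Phi_{ad}$. Forms. $a_\varphi(\mathbf u,\mathbf v)=\mu\int_\Omega\nabla \mathbf u:\nabla \mathbf v\,dx+\int_\Omega\alpha_\varepsilon(\varphi)\mathbf u\cdot \mathbf v\,dx$ and $b(\mathbf u,\mathbf v,\mathbf w)=\int_\Omega[(\mathbf u\cdot\nabla)\mathbf v]\cdot \mathbf w\,dx$. Data. $\mathbf u_0\in\boldsymbol H$, $\mathbf u_d\in L^2(\omega)^2$ (time independent), $\mathbf f_s\in L^2(\Omega)^2$, $\mathbf f:(0,\infty)\to L^2(\Omega)^2$ with $\mathbf f\in L^2(I_T;L^2(\Omega)^2)$ for every $T>0$. It is assumed that $2c_P^2c_L\|\mathbf f_s\|_{L^2}<\mu^2$, and that there is $K>0$ such that $\int_0^Te^{\varsigma t}\|\mathbf f(t)-\mathbf f_s\|_{L^2}^2\,dt\le K$ for all $T>0$, where $\varsigma=\dfrac{\mu^4-2c_L^2c_P^4\|\mathbf f_s\|_{L^2}^2}{c_P^2\mu^3}>0$. States. For $\varphi\in\Phi_{ad}$, $\mathcal S_T(\varphi)=\mathbf u\in W^2_T(\boldsymbol V)$ is the unique function with $\mathbf u(0)=\mathbf u_0$ in $\boldsymbol H$ and $\langle\partial_t\mathbf u(t),\psi\rangle_{\boldsymbol V}+a_\varphi(\mathbf u(t),\psi)+b(\mathbf u(t),\mathbf u(t),\psi)=(\mathbf f(t),\psi)_\Omega$ for all $\psi\in\boldsymbol V$ and a.e. $t\in(0,T)$; $\mathcal S_s(\varphi)=\mathbf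 v\in\boldsymbol V$ is the unique solution of $a_\varphi(\mathbf v,\psi)+b(\mathbf v,\mathbf v,\psi)=(\mathbf f_s,\psi)_\Omega$ for all $\psi\in\boldsymbol V$. Energy. $\mathbb E_\varepsilon(\varphi)=\frac1{2c_0}\int_\Omega\frac\varepsilon2|\nabla\varphi|^2+\frac1\varepsilon\Psi(\varphi)\,dx$, where $\Psi(s)=\frac{1-s^2}2$ for $|s|\le1$, $\Psi(s)=+\infty$ for $|s|>1$, and $c_0=\frac12\int_{-1}^1\sqrt{2\Psi(s)}\,ds>0$. Objectives on $\Phi_{ad}$. $$J_T(\varphi)=\frac1T\Big[\int_{\Omega_T}\tfrac{\varphi+1}2|\mathcal S_T(\varphi)-\mathbf u_d|^2\chi_\omega\,dx\,dt+\int_{\Omega_T}\beta_\varepsilon(\varphi)|\mathcal S_T(\varphi)|^2dx\,dt\Big]+\gamma\mathbb E_\varepsilon(\varphi),$$ $$J_s(\varphi)=\int_\Omega\tfrac{\varphi+1}2|\mathcal S_s(\varphi)-\mathbf u_d|^2\chi_\omega\,dx+\int_\Omega\beta_\varepsilon(\varphi)|\mathcal S_s(\varphi)|^2dx+\gamma\mathbb E_\varepsilon(\varphi).$$ *)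

theory Defs
  imports "HOL-Analysis.Analysis" "HOL-Probability.Essential_Supremum"
begin

text \<open>
  Elements of Lebesgue, Sobolev and Bochner spaces are represented by functions; the sets below are
  closed under changing a function on a null set, and equality of elements is equality almost
  everywhere.  A time-dependent field is a function \<open>real \<Rightarrow> real^2 \<Rightarrow> real^2\<close>, time first.
\<close>

type_synonym design = "real^2 \<Rightarrow> real"
type_synonym vfield = "real^2 \<Rightarrow> real^2"


text \<open>Bounded Lipschitz domain: near each boundary point and up to a rigid motion, the set is the
  strict epigraph of a Lipschitz function of one variable.\<close>

definition bounded_lipschitz_domain :: "(real^2) set \<Rightarrow> bool" where
  "bounded_lipschitz_domain \<Omega> \<longleftrightarrow>
     open \<Omega> \<and> connected \<Omega> \<and> \<Omega> \<noteq> {} \<and> bounded \<Omega> \<and>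
     (\<forall>x\<in>frontier \<Omega>. \<exists>r>0. \<exists>e1 e2 L. \<exists>g :: real \<Rightarrow> real.
        norm e1 = 1 \<and> norm e2 = 1 \<and> e1 \<bullet> e2 = 0 \<and> L-lipschitz_on UNIV g \<and>
        (\<forall>y\<in>ball x r. y \<in> \<Omega> \<longleftrightarrow> g ((y - x) \<bullet> e1) < (y - x) \<bullet> e2))"


subsection \<open>Lebesgue spaces\<close>

definition Lp :: "(real^2) set \<Rightarrow> real \<Rightarrow> (real^2 \<Rightarrow> 'b::euclidean_space) set" where
  "Lp \<Omega> p = {f \<in> borel_measurable (lebesgue_on \<Omega>). integrable (lebesgue_on \<Omega>) (\<lambda>x. norm (f x) powr p)}"

definition Lp_norm :: "(real^2) set \<Rightarrow> real \<Rightarrow> (real^2 \<Rightarrow> 'b::euclidean_space) \<Rightarrow> real" where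
  "Lp_norm \<Omega> p f = (LINT x|lebesgue_on \<Omega>. norm (f x) powr p) powr (1 / p)"

definition Linf :: "(real^2) set \<Rightarrow> design set" where
  "Linf \<Omega> = {f \<in> borel_measurable (lebesgue_on \<Omega>). \<exists>C. AE x in lebesgue_on \<Omega>. \<bar>f x\<bar> \<le> C}"

definition Linf_norm :: "(real^2) set \<Rightarrow> design \<Rightarrow> real" where
  "Linf_norm \<Omega> f = real_of_ereal (esssup (lebesgue_on \<Omega>) (\<lambda>x. ereal \<bar>f x\<bar>))"


subsection \<open>Sobolev spaces\<close>

primrec Ck :: "nat \<Rightarrow> ('a::euclidean_space \<Rightarrow> real) \<Rightarrow> bool" where
  "Ck 0 f \<longleftrightarrow> continuous_on UNIV f"
| "Ck (Suc k) f \<longleftrightarrow>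
     f differentiable_on UNIV \<and> (\<forall>b\<in>Basis. Ck k (\<lambda>x. frechet_derivative f (at x) b))"

definition test_functions :: "'a::euclidean_space set \<Rightarrow> ('a \<Rightarrow> real) set" where
  "test_functions S =
     {\<eta>. (\<forall>k. Ck k \<eta>) \<and> compact (closure {x. \<eta> x \<noteq> 0}) \<and> closure {x. \<eta> x \<noteq> 0} \<subseteq> S}"

definition grad :: "(real^2 \<Rightarrow> real) \<Rightarrow> vfield" where
  "grad \<eta> x = (\<chi> i. frechet_derivative \<eta> (at x) (axis i 1))"

definition is_weak_grad :: "(real^2) set \<Rightarrow> design \<Rightarrow> vfield \<Rightarrow> bool" where
  "is_weak_grad \<Omega> f g \<longleftrightarrow> (\<forall>\<eta>\<in>test_functions \<Omega>.
     (LINT x|lebesgue_on \<Omega>. f x *\<^sub>R grad \<eta> x) = - (LINT x|lebesgue_on \<Omega>. \<eta> x *\<^sub>R g x))"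

definition H1 :: "(real^2) set \<Rightarrow> design set" where
  "H1 \<Omega> = {f \<in> Lp \<Omega> 2. \<exists>g \<in> Lp \<Omega> 2. is_weak_grad \<Omega> f g}"

text \<open>A representative of the weak gradient, which is unique up to null sets.\<close>

definition wgrad :: "(real^2) set \<Rightarrow> design \<Rightarrow> vfield" where
  "wgrad \<Omega> f = (SOME g. g \<in> Lp \<Omega> 2 \<and> is_weak_grad \<Omega> f g)"

definition H1_norm :: "(real^2) set \<Rightarrow> design \<Rightarrow> real" where
  "H1_norm \<Omega> f = sqrt ((Lp_norm \<Omega> 2 f)\<^sup>2 + (Lp_norm \<Omega> 2 (wgrad \<Omega> f))\<^sup>2)"

definition H10 :: "(real^2) set \<Rightarrow> design set" where
  "H10 \<Omega> = {f \<in> H1 \<Omega>. \<exists>\<eta>. (\<forall>n. \<eta> n \<in> test_functions \<Omega>) \<and>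
              (\<lambda>n. H1_norm \<Omega> (\<lambda>x. \<eta> n x - f x)) \<longlonglongrightarrow> 0}"

definition H10_vec :: "(real^2) set \<Rightarrow> vfield set" where
  "H10_vec \<Omega> = {v. \<forall>i. (\<lambda>x. v x $ i) \<in> H10 \<Omega>}"

text \<open>Weak Jacobian: row \<open>i\<close> is the weak gradient of the \<open>i\<close>-th component, so that
  \<open>wjac \<Omega> v x *v u\<close> is \<open>(u \<cdot> \<nabla>) v\<close> and \<open>trace (wjac \<Omega> v x)\<close> is \<open>div v\<close>.  The norm and inner
  product of \<open>real^2^2\<close> are the Frobenius ones.\<close>

definition wjac :: "(real^2) set \<Rightarrow> vfield \<Rightarrow> real^2 \<Rightarrow> real^2^2" where
  "wjac \<Omega> v x = (\<chi> i. wgrad \<Omega> (\<lambda>y. v y $ i) x)"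

definition V :: "(real^2) set \<Rightarrow> vfield set" where
  "V \<Omega> = {\<psi> \<in> H10_vec \<Omega>. AE x in lebesgue_on \<Omega>. trace (wjac \<Omega> \<psi> x) = 0}"

definition V_norm :: "(real^2) set \<Rightarrow> vfield \<Rightarrow> real" where
  "V_norm \<Omega> \<psi> = Lp_norm \<Omega> 2 (wjac \<Omega> \<psi>)"

definition is_weak_div :: "(real^2) set \<Rightarrow> vfield \<Rightarrow> design \<Rightarrow> bool" where
  "is_weak_div \<Omega> \<psi> d \<longleftrightarrow> (\<forall>\<eta>\<in>test_functions \<Omega>.
     (LINT x|lebesgue_on \<Omega>. \<psi> x \<bullet> grad \<eta> x) = - (LINT x|lebesgue_on \<Omega>. d x * \<eta> x))"

text \<open>The normal trace of an \<open>L\<^sup>2\<close> field with divergence \<open>d \<in> L\<^sup>2\<close> is the functional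
  \<open>\<xi> \<mapsto> \<integral> \<psi> \<cdot> \<nabla>\<xi> + d \<xi>\<close> on \<open>H\<^sup>1(\<Omega>)\<close>.\<close>

definition normal_trace :: "(real^2) set \<Rightarrow> vfield \<Rightarrow> design \<Rightarrow> design \<Rightarrow> real" where
  "normal_trace \<Omega> \<psi> d \<xi> = (LINT x|lebesgue_on \<Omega>. \<psi> x \<bullet> wgrad \<Omega> \<xi> x + d x * \<xi> x)"

definition H :: "(real^2) set \<Rightarrow> vfield set" where
  "H \<Omega> = {\<psi> \<in> Lp \<Omega> 2. is_weak_div \<Omega> \<psi> (\<lambda>x. 0) \<and> (\<forall>\<xi>\<in>H1 \<Omega>. normal_trace \<Omega> \<psi> (\<lambda>x. 0) \<xi> = 0)}"


subsection \<open>Dual spaces and Bochner spaces\<close>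

text \<open>\<open>X\<close> is a space of functions with (semi)norm \<open>N\<close>.  Functionals are only relevant on \<open>X\<close>.\<close>

definition dual_space ::
    "('a \<Rightarrow> 'b::real_vector) set \<Rightarrow> (('a \<Rightarrow> 'b) \<Rightarrow> real) \<Rightarrow> (('a \<Rightarrow> 'b) \<Rightarrow> real) set" where
  "dual_space X N = {F.
     (\<forall>f\<in>X. \<forall>g\<in>X. \<forall>a b. F (\<lambda>x. a *\<^sub>R f x + b *\<^sub>R g x) = a * F f + b * F g) \<and>
     (\<exists>C. \<forall>f\<in>X. \<bar>F f\<bar> \<le> C * N f)}"

definition dual_norm ::
    "('a \<Rightarrow> 'b::real_vector) set \<Rightarrow> (('a \<Rightarrow> 'b) \<Rightarrow> real) \<Rightarrow> (('a \<Rightarrow> 'b) \<Rightarrow> real) \<Rightarrow> real" where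
  "dual_norm X N F = (SUP f\<in>{f \<in> X. N f \<le> 1}. \<bar>F f\<bar>)"

text \<open>\<open>L\<^sup>2(0,T; X)\<close>: strongly measurable (an a.e. limit of simple functions) with square integrable
  norm.\<close>

definition bochner_L2 ::
    "real \<Rightarrow> ('a \<Rightarrow> 'b::minus) set \<Rightarrow> (('a \<Rightarrow> 'b) \<Rightarrow> real) \<Rightarrow> (real \<Rightarrow> 'a \<Rightarrow> 'b) set" where
  "bochner_L2 T X N = {u.
     (AE t in lebesgue_on {0<..<T}. u t \<in> X) \<and>
     (\<exists>s. (\<forall>n. simple_function (lebesgue_on {0<..<T}) (s n) \<and> (\<forall>t\<in>{0<..<T}. s n t \<in> X)) \<and>
          (AE t in lebesgue_on {0<..<T}. (\<lambda>n::nat. N (\<lambda>x. s n t x - u t x)) \<longlonglongrightarrow> 0)) \<and>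
     integrable (lebesgue_on {0<..<T}) (\<lambda>t. (N (u t))\<^sup>2)}"

abbreviation V_dual :: "(real^2) set \<Rightarrow> (vfield \<Rightarrow> real) set" where
  "V_dual \<Omega> \<equiv> dual_space (V \<Omega>) (V_norm \<Omega>)"

abbreviation V_dual_norm :: "(real^2) set \<Rightarrow> (vfield \<Rightarrow> real) \<Rightarrow> real" where
  "V_dual_norm \<Omega> \<equiv> dual_norm (V \<Omega>) (V_norm \<Omega>)"

text \<open>Weak time derivative with respect to the embedding of \<open>V\<close> into its dual through the
  \<open>L\<^sup>2\<close> inner product.\<close>

definition is_time_deriv ::
    "(real^2) set \<Rightarrow> real \<Rightarrow> (real \<Rightarrow> vfield) \<Rightarrow> (real \<Rightarrow> vfield \<Rightarrow> real) \<Rightarrow> bool" where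
  "is_time_deriv \<Omega> T u g \<longleftrightarrow>
     g \<in> bochner_L2 T (V_dual \<Omega>) (V_dual_norm \<Omega>) \<and>
     (\<forall>\<eta>\<in>test_functions {0<..<T}. \<forall>\<psi>\<in>V \<Omega>.
        (LINT t|lebesgue_on {0<..<T}. deriv \<eta> t * (LINT x|lebesgue_on \<Omega>. u t x \<bullet> \<psi> x)) =
        - (LINT t|lebesgue_on {0<..<T}. \<eta> t * g t \<psi>))"

definition W2 :: "(real^2) set \<Rightarrow> real \<Rightarrow> (real \<Rightarrow> vfield) set" where
  "W2 \<Omega> T = {u \<in> bochner_L2 T (V \<Omega>) (V_norm \<Omega>). \<exists>g. is_time_deriv \<Omega> T u g}"

text \<open>\<open>u(0) = u0\<close> in \<open>H\<close>, through the representative of \<open>u\<close> in \<open>C([0,T]; H)\<close>.\<close>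

definition has_initial_value :: "(real^2) set \<Rightarrow> real \<Rightarrow> (real \<Rightarrow> vfield) \<Rightarrow> vfield \<Rightarrow> bool" where
  "has_initial_value \<Omega> T u u0 \<longleftrightarrow> (\<exists>w :: real \<Rightarrow> vfield.
     (\<forall>t\<in>{0..T}. w t \<in> H \<Omega>) \<and>
     (\<forall>t\<in>{0..T}. ((\<lambda>s. Lp_norm \<Omega> 2 (\<lambda>x. w s x - w t x)) \<longlongrightarrow> 0) (at t within {0..T})) \<and>
     (AE t in lebesgue_on {0<..<T}. AE x in lebesgue_on \<Omega>. w t x = u t x) \<and>
     (AE x in lebesgue_on \<Omega>. w 0 x = u0 x))"


subsection \<open>Designs and coefficients\<close>

definition \<Phi>ad :: "(real^2) set \<Rightarrow> design set" where
  "\<Phi>ad \<Omega> = {\<phi> \<in> H1 \<Omega>. AE x in lebesgue_on \<Omega>. \<bar>\<phi> x\<bar> \<le> 1}"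

text \<open>Frechet differentiability of the superposition operator \<open>\<phi> \<mapsto> \<alpha> \<circ> \<phi>\<close> from \<open>\<Phi>ad\<close> to \<open>L\<^sup>2\<close>, the
  derivative at \<open>\<phi>\<close> being pointwise multiplication by \<open>A \<phi> \<in> L\<^sup>p\<close>; \<open>A\<close> is an operator on
  a.e.-equivalence classes.\<close>

definition superposition_frechet ::
    "(real^2) set \<Rightarrow> real \<Rightarrow> (real \<Rightarrow> real) \<Rightarrow> (design \<Rightarrow> design) \<Rightarrow> bool" where
  "superposition_frechet \<Omega> p \<alpha> A \<longleftrightarrow>
     (\<forall>\<phi>\<in>\<Phi>ad \<Omega>. A \<phi> \<in> Lp \<Omega> p) \<and>
     (\<forall>\<phi>\<in>\<Phi>ad \<Omega>. \<forall>\<phi>'\<in>\<Phi>ad \<Omega>. (AE x in lebesgue_on \<Omega>. \<phi> x = \<phi>' x) \<longrightarrow>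
        (AE x in lebesgue_on \<Omega>. A \<phi> x = A \<phi>' x)) \<and>
     (\<forall>\<phi>\<in>\<Phi>ad \<Omega>. \<forall>e>0. \<exists>d>0. \<forall>\<delta>\<in>H1 \<Omega> \<inter> Linf \<Omega>.
        (\<lambda>x. \<phi> x + \<delta> x) \<in> \<Phi>ad \<Omega> \<and> H1_norm \<Omega> \<delta> + Linf_norm \<Omega> \<delta> < d \<longrightarrow>
        Lp_norm \<Omega> 2 (\<lambda>x. \<alpha> (\<phi> x + \<delta> x) - \<alpha> (\<phi> x) - A \<phi> x * \<delta> x)
          \<le> e * (H1_norm \<Omega> \<delta> + Linf_norm \<Omega> \<delta>))"


subsection \<open>Forms and states\<close>

definition a_form ::
    "(real^2) set \<Rightarrow> real \<Rightarrow> (real \<Rightarrow> real) \<Rightarrow> design \<Rightarrow> vfield \<Rightarrow> vfield \<Rightarrow> real" where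
  "a_form \<Omega> \<mu> \<alpha> \<phi> u v =
     \<mu> * (LINT x|lebesgue_on \<Omega>. wjac \<Omega> u x \<bullet> wjac \<Omega> v x)
     + (LINT x|lebesgue_on \<Omega>. \<alpha> (\<phi> x) * (u x \<bullet> v x))"

definition b_form :: "(real^2) set \<Rightarrow> vfield \<Rightarrow> vfield \<Rightarrow> vfield \<Rightarrow> real" where
  "b_form \<Omega> u v w = (LINT x|lebesgue_on \<Omega>. (wjac \<Omega> v x *v u x) \<bullet> w x)"

definition evolution_solution ::
    "(real^2) set \<Rightarrow> real \<Rightarrow> (real \<Rightarrow> real) \<Rightarrow> vfield \<Rightarrow> (real \<Rightarrow> vfield) \<Rightarrow> real \<Rightarrow> design
      \<Rightarrow> (real \<Rightarrow> vfield) \<Rightarrow> bool" where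
  "evolution_solution \<Omega> \<mu> \<alpha> u0 f T \<phi> u \<longleftrightarrow>
     u \<in> W2 \<Omega> T \<and> has_initial_value \<Omega> T u u0 \<and>
     (\<exists>g. is_time_deriv \<Omega> T u g \<and>
       (AE t in lebesgue_on {0<..<T}. \<forall>\<psi>\<in>V \<Omega>.
          g t \<psi> + a_form \<Omega> \<mu> \<alpha> \<phi> (u t) \<psi> + b_form \<Omega> (u t) (u t) \<psi>
            = (LINT x|lebesgue_on \<Omega>. f t x \<bullet> \<psi> x)))"

definition stationary_solution ::
    "(real^2) set \<Rightarrow> real \<Rightarrow> (real \<Rightarrow> real) \<Rightarrow> vfield \<Rightarrow> design \<Rightarrow> vfield \<Rightarrow> bool" where
  "stationary_solution \<Omega> \<mu> \<alpha> fs \<phi> v \<longleftrightarrow>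
     v \<in> V \<Omega> \<and>
     (\<forall>\<psi>\<in>V \<Omega>. a_form \<Omega> \<mu> \<alpha> \<phi> v \<psi> + b_form \<Omega> v v \<psi> = (LINT x|lebesgue_on \<Omega>. fs x \<bullet> \<psi> x))"

definition unique_evolution_state ::
    "(real^2) set \<Rightarrow> real \<Rightarrow> (real \<Rightarrow> real) \<Rightarrow> vfield \<Rightarrow> (real \<Rightarrow> vfield) \<Rightarrow> real \<Rightarrow> design
      \<Rightarrow> (real \<Rightarrow> vfield) \<Rightarrow> bool" where
  "unique_evolution_state \<Omega> \<mu> \<alpha> u0 f T \<phi> u \<longleftrightarrow>
     evolution_solution \<Omega> \<mu> \<alpha> u0 f T \<phi> u \<and>
     (\<forall>u'. evolution_solution \<Omega> \<mu> \<alpha> u0 f T \<phi> u' \<longrightarrow>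
        (AE t in lebesgue_on {0<..<T}. AE x in lebesgue_on \<Omega>. u' t x = u t x))"

definition unique_stationary_state ::
    "(real^2) set \<Rightarrow> real \<Rightarrow> (real \<Rightarrow> real) \<Rightarrow> vfield \<Rightarrow> design \<Rightarrow> vfield \<Rightarrow> bool" where
  "unique_stationary_state \<Omega> \<mu> \<alpha> fs \<phi> v \<longleftrightarrow>
     stationary_solution \<Omega> \<mu> \<alpha> fs \<phi> v \<and>
     (\<forall>v'. stationary_solution \<Omega> \<mu> \<alpha> fs \<phi> v' \<longrightarrow> (AE x in lebesgue_on \<Omega>. v' x = v x))"


subsection \<open>Energy and objectives\<close>

definition \<Psi> :: "real \<Rightarrow> ennreal" where
  "\<Psi> s = (if \<bar>s\<bar> \<le> 1 then ennreal ((1 - s\<^sup>2) / 2) else \<infinity>)"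

definition c0 :: real where
  "c0 = 1 / 2 * (LINT s|lebesgue_on {-1..1}. sqrt (2 * enn2real (\<Psi> s)))"

definition energy :: "(real^2) set \<Rightarrow> real \<Rightarrow> design \<Rightarrow> ennreal" where
  "energy \<Omega> \<epsilon> \<phi> = ennreal (1 / (2 * c0)) *
     (\<integral>\<^sup>+ x. ennreal (\<epsilon> / 2 * (norm (wgrad \<Omega> \<phi> x))\<^sup>2) + ennreal (1 / \<epsilon>) * \<Psi> (\<phi> x) \<partial>lebesgue_on \<Omega>)"

text \<open>The objectives take the solution operators \<open>S\<close> as an argument.  Integrals over the space-time
  cylinder are iterated, since an element of \<open>L\<^sup>2(0,T; L\<^sup>2(\<Omega>))\<close> need not be represented by a jointly
  measurable function.\<close>

definition J_T ::
    "(real^2) set \<Rightarrow> (real^2) set \<Rightarrow> real \<Rightarrow> real \<Rightarrow> (real \<Rightarrow> real) \<Rightarrow> vfield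
      \<Rightarrow> (real \<Rightarrow> design \<Rightarrow> real \<Rightarrow> vfield) \<Rightarrow> real \<Rightarrow> design \<Rightarrow> ereal" where
  "J_T \<Omega> \<omega> \<epsilon> \<gamma> \<beta> ud S T \<phi> =
     ereal (1 / T *
       ((LINT t|lebesgue_on {0<..<T}. LINT x|lebesgue_on \<Omega>.
           (\<phi> x + 1) / 2 * (norm (S T \<phi> t x - ud x))\<^sup>2 * indicator \<omega> x)
        + (LINT t|lebesgue_on {0<..<T}. LINT x|lebesgue_on \<Omega>. \<beta> (\<phi> x) * (norm (S T \<phi> t x))\<^sup>2)))
     + ereal \<gamma> * enn2ereal (energy \<Omega> \<epsilon> \<phi>)"

definition J_s ::
    "(real^2) set \<Rightarrow> (real^2) set \<Rightarrow> real \<Rightarrow> real \<Rightarrow> (real \<Rightarrow> real) \<Rightarrow> vfield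
      \<Rightarrow> (design \<Rightarrow> vfield) \<Rightarrow> design \<Rightarrow> ereal" where
  "J_s \<Omega> \<omega> \<epsilon> \<gamma> \<beta> ud S \<phi> =
     ereal
       ((LINT x|lebesgue_on \<Omega>. (\<phi> x + 1) / 2 * (norm (S \<phi> x - ud x))\<^sup>2 * indicator \<omega> x)
        + (LINT x|lebesgue_on \<Omega>. \<beta> (\<phi> x) * (norm (S \<phi> x))\<^sup>2))
     + ereal \<gamma> * enn2ereal (energy \<Omega> \<epsilon> \<phi>)"


subsection \<open>Modes of convergence\<close>

definition weak_conv_H1 :: "(real^2) set \<Rightarrow> (nat \<Rightarrow> design) \<Rightarrow> design \<Rightarrow> bool" where
  "weak_conv_H1 \<Omega> \<phi> \<phi>0 \<longleftrightarrow>
     (\<forall>F\<in>dual_space (H1 \<Omega>) (H1_norm \<Omega>). (\<lambda>n. F (\<phi> n)) \<longlonglongrightarrow> F \<phi>0)"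

definition weak_star_conv_Linf :: "(real^2) set \<Rightarrow> (nat \<Rightarrow> design) \<Rightarrow> design \<Rightarrow> bool" where
  "weak_star_conv_Linf \<Omega> \<phi> \<phi>0 \<longleftrightarrow>
     (\<forall>g\<in>Lp \<Omega> 1. (\<lambda>n. LINT x|lebesgue_on \<Omega>. \<phi> n x * g x)
        \<longlonglongrightarrow> (LINT x|lebesgue_on \<Omega>. \<phi>0 x * g x))"

end

theory Submission
  imports Defs
begin

text \<open>
  For a fixed design the evolution converges to the stationary state: testing the equation for the
  difference \<open>z\<close> with \<open>z\<close> and absorbing \<open>b(z, v, z)\<close> by the smallness of \<open>f\<^sub>s\<close> bounds
  \<open>\<integral> \<parallel>\<nabla>z\<parallel>\<^sup>2 dt\<close> uniformly in the design and in the horizon \<open>T\<close>.  Hence \<open>J\<^sub>T - J\<^sub>s\<close> is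
  \<open>O(1 / sqrt T)\<close> uniformly on \<open>\<Phi>ad\<close>.  The stationary state depends continuously on the design, the
  energy is weakly lower semicontinuous, and so minimality passes to the limit.

  Since the solutions come with a continuous representative, the Lions-Magenes lemma is only needed
  as the inequality \<open>\<integral> \<langle>\<partial>\<^sub>t z, z\<rangle> dt \<ge> - \<parallel>z(0)\<parallel>\<^sup>2 / 2\<close>.
\<close>

subsection \<open>Smooth bumps and the fundamental lemma\<close>

text \<open>Budget of the viscosity: smallness of \<open>fs\<close> lets convection consume at most
  \<open>\<mu> / 2\<close>, Young's inequality on the force another \<open>\<mu> / 4\<close>, and
  the last quarter gives the bound. As \<open>exp (\<sigma> * t) \<ge> 1\<close>, \<open>K\<close>
  bounds the unweighted force term on every horizon. In |u - d|^2 - |v - d|^2 the part quadratic in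
  z = u - v contributes order 1/T; the mixed part is linear in z and only yields 1/sqrt T. The
  delicate point is pairing a derivative in the dual of V with a z that is merely square integrable
  in time. At a fixed time t, z(t) is one fixed element, so the increment formula for scalar
  products is applicable to it. The backward average of g against a varying z(t) is then handled by
  replacing z by a simple function: only finitely many scalar functions have to be averaged. The
  square inequality |a|^2 - |b|^2 <= 2 (a - b, a) fixes the backward direction. Spaces are sets of
  representatives and \<open>wgrad\<close> is an arbitrary choice, so already the a.e. linearity of
  gradients rests on the fundamental lemma, for which test functions are built from
  exp(-1/x).\<close>

lemma Ck_SucI:
  assumes "\<And>x. (f has_derivative f' x) (at x)" "\<And>b. b \<in> Basis \<Longrightarrow> Ck k (\<lambda>x. f' x b)"
  shows "Ck (Suc k) f"
proof -
  have "frechet_derivative f (at x) = f' x" for x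
    using frechet_derivative_at[OF assms(1)] by simp
  then show ?thesis
    using assms by (auto simp: differentiable_on_def differentiable_def)
qed

lemma Ck_SucD:
  assumes "Ck (Suc k) f"
  shows "(f has_derivative frechet_derivative f (at x)) (at x)"
    "b \<in> Basis \<Longrightarrow> Ck k (\<lambda>x. frechet_derivative f (at x) b)"
  using assms by (auto simp: differentiable_on_def frechet_derivative_works)

text \<open>The product rule multiplies a derivative of one factor, of class \<open>Ck k\<close>, by
  the other factor itself, which must therefore be available at order \<open>k\<close> as
  well.\<close>

lemma Ck_lower: "Ck (Suc k) f \<Longrightarrow> Ck k f"
proof (induction k arbitrary: f)
  case 0
  then show ?case by (auto intro: differentiable_imp_continuous_on)
next
  case (Suc k)
  then show ?case by simp
qed

lemma Ck_const: "Ck k (\<lambda>x. c)"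
proof (induction k arbitrary: c)
  case (Suc k)
  then show ?case by (intro Ck_SucI[where f' = "\<lambda>x h. 0"]) auto
qed simp

lemma Ck_add: "Ck k f \<Longrightarrow> Ck k g \<Longrightarrow> Ck k (\<lambda>x. f x + g x)"
proof (induction k arbitrary: f g)
  case (Suc k)
  show ?case
    by (rule Ck_SucI[OF has_derivative_add[OF Ck_SucD(1)[OF Suc.prems(1)] Ck_SucD(1)[OF Suc.prems(2)]]])
      (intro Suc.IH Ck_SucD(2)[OF Suc.prems(1)] Ck_SucD(2)[OF Suc.prems(2)])
qed (simp add: continuous_on_add)

lemma Ck_mult: "Ck k f \<Longrightarrow> Ck k g \<Longrightarrow> Ck k (\<lambda>x. f x * g x)"
proof (induction k arbitrary: f g)
  case (Suc k)
  note p = Suc.prems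
  show ?case
    by (rule Ck_SucI[OF has_derivative_mult[OF Ck_SucD(1)[OF p(1)] Ck_SucD(1)[OF p(2)]]])
      (intro Ck_add Suc.IH Ck_SucD(2)[OF p(1)] Ck_SucD(2)[OF p(2)] Ck_lower[OF p(1)] Ck_lower[OF p(2)])
qed (simp add: continuous_on_mult)

lemma Ck_prod: "(\<And>i. i \<in> I \<Longrightarrow> Ck k (f i)) \<Longrightarrow> Ck k (\<lambda>x. \<Prod>i\<in>I. f i x)"
  by (induction I rule: infinite_finite_induct) (auto intro: Ck_const Ck_mult)

lemma Ck_diff: "Ck k f \<Longrightarrow> Ck k g \<Longrightarrow> Ck k (\<lambda>x. f x - g x)"
  using Ck_add[OF _ Ck_mult[OF Ck_const[of k "-1"]], of f g] by simp

text \<open>The derivative of \<open>f (a \<bullet> x + c)\<close> in direction h is the constant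
  \<open>a \<bullet> h\<close> times f' at the same affine argument, so the induction stays within
  affine compositions.\<close>

lemma Ck_affine:
  fixes f :: "real \<Rightarrow> real"
  shows "Ck k f \<Longrightarrow> Ck k (\<lambda>x. f (a \<bullet> x + c))"
proof (induction k arbitrary: f)
  case 0
  then have "continuous_on UNIV f" by simp
  then show ?case
    by (auto intro!: continuous_on_compose2[of UNIV f] continuous_intros)
next
  case (Suc k)
  have "((\<lambda>x. f (a \<bullet> x + c)) has_derivative
      (\<lambda>h. frechet_derivative f (at (a \<bullet> x + c)) (a \<bullet> h))) (at x)" for x
    by (rule has_derivative_compose[OF _ Ck_SucD(1)[OF Suc.prems]])
      (auto intro!: derivative_eq_intros)
  moreover have "frechet_derivative f (at y) (a \<bullet> h) = (a \<bullet> h) * frechet_derivative f (at y) 1" for y h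
    using linear_cmul[OF has_derivative_linear[OF Ck_SucD(1)[OF Suc.prems]], of y "a \<bullet> h" 1] by simp
  ultimately show ?case
    by (intro Ck_SucI[where f' = "\<lambda>x h. (a \<bullet> h) * frechet_derivative f (at (a \<bullet> x + c)) 1"])
      (auto intro!: Ck_mult Ck_const Suc.IH Ck_SucD(2)[OF Suc.prems])
qed

text \<open>The powers of 1/x are included so that the family is closed under differentiation up to
  linear combinations; \<open>flat_exp 0\<close> is the classical flat function exp(-1/x).\<close>

definition flat_exp :: "nat \<Rightarrow> real \<Rightarrow> real" where
  "flat_exp n x = (if x > 0 then (1 / x) ^ n * exp (- 1 / x) else 0)"

lemma flat_exp_at_0: "((\<lambda>x. flat_exp n x) \<longlongrightarrow> 0) (at 0)"
proof -
  \<comment> \<open>With y = 1/x this is the decay of y^n / exp y at infinity.\<close>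
  have "((\<lambda>x::real. inverse x ^ n / exp (inverse x)) \<longlongrightarrow> 0) (at_right 0)"
    by (rule filterlim_compose[OF tendsto_power_div_exp_0 filterlim_inverse_at_top_right])
  then have "(flat_exp n \<longlongrightarrow> 0) (at_right 0)"
    by (rule Lim_transform_eventually)
      (auto simp: flat_exp_def eventually_at_filter exp_minus field_simps)
  moreover have "(flat_exp n \<longlongrightarrow> 0) (at_left 0)"
    by (rule Lim_transform_eventually[OF tendsto_const]) (auto simp: flat_exp_def eventually_at_filter)
  ultimately show ?thesis by (simp add: filterlim_split_at)
qed

lemma flat_exp_deriv:
  "(flat_exp n has_real_derivative (flat_exp (n + 2) x - n * flat_exp (n + 1) x)) (at x)"
proof (cases x "0::real" rule: linorder_cases)
  case greater
  have inv: "((\<lambda>x. 1 / x) has_real_derivative - (1 / x)\<^sup>2) (at x)"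
    "((\<lambda>x. - 1 / x) has_real_derivative (1 / x)\<^sup>2) (at x)"
    using greater by (auto intro!: derivative_eq_intros simp: field_simps power2_eq_square)
  have "((\<lambda>x. (1 / x) ^ n * exp (- 1 / x)) has_real_derivative
      (flat_exp (n + 2) x - n * flat_exp (n + 1) x)) (at x)"
    using greater
    by (intro DERIV_cong[OF DERIV_mult[OF DERIV_power[OF inv(1)] DERIV_fun_exp[OF inv(2)]]], cases n)
      (auto simp: flat_exp_def algebra_simps power_add power2_eq_square)
  then show ?thesis
    by (rule DERIV_cong_ev[OF refl _ refl, THEN iffD1, rotated])
      (use greater in \<open>auto simp: flat_exp_def eventually_nhds intro!: exI[of _ "{0<..}"]\<close>)
next
  case less
  have "((\<lambda>x. 0) has_real_derivative (flat_exp (n + 2) x - n * flat_exp (n + 1) x)) (at x)"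
    using less by (auto simp: flat_exp_def)
  then show ?thesis
    by (rule DERIV_cong_ev[OF refl _ refl, THEN iffD1, rotated])
      (use less in \<open>auto simp: flat_exp_def eventually_nhds intro!: exI[of _ "{..<0}"]\<close>)
next
  case equal
  \<comment> \<open>The difference quotient at 0 is the next member of the family, whose limit at 0
    is known; at h = 0 both sides are 0 because division by zero gives 0.\<close>
  have "(\<lambda>h. (flat_exp n h - flat_exp n 0) / h) = flat_exp (Suc n)"
    by (auto simp: flat_exp_def field_simps)
  then have "(flat_exp n has_real_derivative 0) (at 0)"
    using flat_exp_at_0[of "Suc n"] by (simp add: has_field_derivative_iff)
  then show ?thesis using equal by (simp add: flat_exp_def)
qed

lemma Ck_flat_exp: "Ck k (flat_exp n)"
proof (induction k arbitrary: n)
  case 0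
  show ?case using flat_exp_deriv DERIV_isCont by (auto simp: continuous_on_eq_continuous_at) blast
next
  case (Suc k)
  have "(flat_exp n has_derivative (\<lambda>h. (flat_exp (n + 2) x - n * flat_exp (n + 1) x) * h)) (at x)" for x
    using flat_exp_deriv by (simp add: has_field_derivative_def)
  then show ?case
    by (rule Ck_SucI) (intro Ck_mult Ck_diff Ck_const Suc.IH)
qed

lemma flat_exp_0_bounds: "0 \<le> flat_exp 0 x" "flat_exp 0 x \<le> 1"
  by (auto simp: flat_exp_def)

lemma flat_exp_0_pos_iff: "flat_exp 0 x \<noteq> 0 \<longleftrightarrow> x > 0"
  by (auto simp: flat_exp_def)

lemma flat_exp_0_tendsto: 
  "(\<lambda>n. flat_exp 0 (real n * x)) \<longlonglongrightarrow> indicator {0<..} x"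
proof (cases "x > 0")
  case True
  have "(\<lambda>n. exp (- inverse (real n) / x)) \<longlonglongrightarrow> exp (- 0 / x)"
    by (intro tendsto_intros lim_inverse_n) (use True in auto)
  then have "(\<lambda>n. flat_exp 0 (real n * x)) \<longlonglongrightarrow> 1"
    by (subst (asm) tendsto_cong[where g = "\<lambda>n. flat_exp 0 (real n * x)"])
      (use True in \<open>auto simp: flat_exp_def field_simps eventually_sequentially intro!: exI[of _ 1]\<close>)
  then show ?thesis using True by simp
next
  case False
  then show ?thesis by (auto simp: flat_exp_def zero_less_mult_iff)
qed

text \<open>Since \<open>exp (-1/(n x))\<close> tends to \<open>1\<close> for \<open>x > 0\<close>, these smooth functions tend to the indicator
  of the open box.\<close>

definition box_bump :: "nat \<Rightarrow> 'a \<Rightarrow> 'a \<Rightarrow> 'a::euclidean_space \<Rightarrow> real" where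
  "box_bump n a b x =
     (\<Prod>i\<in>Basis. flat_exp 0 (real n * ((x - a) \<bullet> i)) * flat_exp 0 (real n * ((b - x) \<bullet> i)))"

lemma Ck_box_bump: "Ck k (box_bump n a b)"
proof -
  have "Ck k (\<lambda>x. \<Prod>i\<in>Basis. flat_exp 0 ((real n *\<^sub>R i) \<bullet> x + (- real n * (a \<bullet> i))) *
       flat_exp 0 ((- real n *\<^sub>R i) \<bullet> x + real n * (b \<bullet> i)))"
    by (intro Ck_prod Ck_mult Ck_affine Ck_flat_exp)
  moreover have "(\<lambda>x. \<Prod>i\<in>Basis. flat_exp 0 ((real n *\<^sub>R i) \<bullet> x + (- real n * (a \<bullet> i))) *
       flat_exp 0 ((- real n *\<^sub>R i) \<bullet> x + real n * (b \<bullet> i))) = box_bump n a b"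
    by (rule ext) (auto simp: box_bump_def inner_diff_left algebra_simps inner_commute intro!: prod.cong)
  ultimately show ?thesis by simp
qed

lemma box_bump_bounds: "0 \<le> box_bump n a b x" "box_bump n a b x \<le> 1"
  unfolding box_bump_def
  by (auto intro!: prod_nonneg prod_le_1 mult_le_one flat_exp_0_bounds mult_nonneg_nonneg)

lemma box_bump_support: "{x. box_bump n a b x \<noteq> 0} \<subseteq> box a b"
  by (auto simp: box_bump_def flat_exp_0_pos_iff mem_box zero_less_mult_iff inner_diff_left)

lemma box_bump_tendsto: "(\<lambda>n. box_bump n a b x) \<longlonglongrightarrow> indicator (box a b) x"
proof -
  have "(\<lambda>n. box_bump n a b x) \<longlonglongrightarrow>
      (\<Prod>i\<in>Basis. indicator {0<..} ((x - a) \<bullet> i) * indicator {0<..} ((b - x) \<bullet> i))"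
    unfolding box_bump_def by (intro tendsto_intros flat_exp_0_tendsto)
  also have "(\<Prod>i\<in>Basis. indicator {0<..} ((x - a) \<bullet> i) * indicator {0<..} ((b - x) \<bullet> i)) = 
      (indicator (box a b) x :: real)"
  proof (cases "x \<in> box a b")
    case True
    then show ?thesis by (auto simp: mem_box inner_diff_left intro!: prod.neutral)
  next
    case False
    then obtain i where "i \<in> Basis" "\<not> (a \<bullet> i < x \<bullet> i \<and> x \<bullet> i < b \<bullet> i)" by (auto simp: mem_box)
    then have "\<exists>i\<in>Basis. indicator {0<..} ((x - a) \<bullet> i) * indicator {0<..} ((b - x) \<bullet> i) = (0::real)"
      by (intro bexI[of _ i]) (auto simp: inner_diff_left indicator_def)
    then show ?thesis using False by simp
  qed
  finally show ?thesis .
qed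

text \<open>Any compact subset of \<open>S\<close> outside which the function vanishes will do, so
  the closed support never has to be computed.\<close>

lemma test_functionsI:
  fixes \<eta> :: "'a::euclidean_space \<Rightarrow> real"
  assumes "\<And>k. Ck k \<eta>" "compact K" "K \<subseteq> S" "{x. \<eta> x \<noteq> 0} \<subseteq> K"
  shows "\<eta> \<in> test_functions S"
proof -
  have "closure {x. \<eta> x \<noteq> 0} \<subseteq> K"
    using assms by (intro closure_minimal compact_imp_closed)
  moreover have "compact (closure {x. \<eta> x \<noteq> 0})"
    using closed_Int_compact[OF closed_closure assms(2)] calculation by (metis Int_absorb2)
  ultimately show ?thesis using assms by (auto simp: test_functions_def)
qed

lemma test_function_mult_smooth:
  assumes "\<eta> \<in> test_functions S" "\<And>k. Ck k f"
  shows "(\<lambda>x. \<eta> x * f x) \<in> test_functions S"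
  by (rule test_functionsI[where K = "closure {x. \<eta> x \<noteq> 0}"])
    (use assms closure_subset[of "{x. \<eta> x \<noteq> 0}"] in \<open>auto simp: test_functions_def intro: Ck_mult\<close>)

lemma box_bump_test: "cbox a b \<subseteq> S \<Longrightarrow> box_bump n a b \<in> test_functions S"
  by (rule test_functionsI[where K = "cbox a b"])
    (use box_bump_support[of n a b] box_subset_cbox[of a b] in \<open>auto intro: Ck_box_bump\<close>)

lemma test_function_continuous: "\<eta> \<in> test_functions S \<Longrightarrow> continuous_on UNIV \<eta>"
  by (simp add: test_functions_def) (metis Ck.simps(1))

lemma test_function_bounded:
  assumes "\<eta> \<in> test_functions S"
  obtains B where "\<And>x. \<bar>\<eta> x\<bar> \<le> B" 
proof -
  have "compact (\<eta> ` closure {x. \<eta> x \<noteq> 0})"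
    using assms test_function_continuous[OF assms]
    by (intro compact_continuous_image) (auto simp: test_functions_def intro: continuous_on_subset)
  then obtain B where B: "\<And>y. y \<in> \<eta> ` closure {x. \<eta> x \<noteq> 0} \<Longrightarrow> norm y \<le> B"
    by (meson bounded_iff compact_imp_bounded)
  have "\<bar>\<eta> x\<bar> \<le> max B 0" for x
    using B[of "\<eta> x"] closure_subset by (cases "\<eta> x = 0") fastforce+
  then show ?thesis using that by blast
qed

text \<open>Vanishing is carried from test functions to indicators of finite unions of boxes, then
  of open sets, G-delta sets and finally measurable sets. Each passage is dominated convergence with
  majorant |g|, since all multipliers have values in [-1, 1].\<close>

lemma AE_zero_if_test_integrals_zero:
  fixes g :: "'a::euclidean_space \<Rightarrow> real"
  assumes \<Omega>: "open \<Omega>" "bounded \<Omega>" and g: "integrable (lebesgue_on \<Omega>) g"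
    and zero: "\<And>\<eta>. \<eta> \<in> test_functions \<Omega> \<Longrightarrow> (LINT x|lebesgue_on \<Omega>. \<eta> x * g x) = 0"
  shows "AE x in lebesgue_on \<Omega>. g x = 0"
proof -
  let ?M = "lebesgue_on \<Omega>"
  have \<Omega>m: "\<Omega> \<in> sets lebesgue" using \<Omega>(1) by auto
  have [measurable]: "g \<in> borel_measurable ?M" using g by auto
  have ind: "indicat_real W \<in> borel_measurable ?M" if "W \<in> sets lebesgue" for W
    by (intro measurable_restrict_space1 borel_measurable_indicator that)
  have open_zero: "(LINT x|?M. indicator U x * g x) = 0" if U: "open U" "U \<subseteq> \<Omega>" for U
  proof -
    \<comment> \<open>Requiring the closed box to lie in \<open>U\<close> makes its bumps compactly
      supported in \<open>U\<close>; Lindelof then leaves countably many boxes.\<close>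
    define F where "F = {box a b | a b. cbox a b \<subseteq> U}"
    have "open S" if "S \<in> F" for S using that open_box unfolding F_def by blast
    then obtain F' where F': "F' \<subseteq> F" "countable F'" "\<Union>F' = \<Union>F"
      by (rule Lindelof)
    have "x \<in> \<Union>F" if xU: "x \<in> U" for x
    proof -
      obtain e where e: "e > 0" "cball x e \<subseteq> U"
        using open_contains_cball[THEN iffD1, OF U(1), rule_format, OF xU] by blast
      obtain a b where ab: "x \<in> box a b" "box a b \<subseteq> ball x e"
        using rational_boxes[OF e(1)] by blast
      then have "box a b \<noteq> {}" by blast
      then have "cbox a b \<subseteq> cball x e"
        using closure_minimal[OF subset_trans[OF ab(2) ball_subset_cball] closed_cball] closure_box[of a b]
        by metis
      then have "box a b \<in> F" using e(2) unfolding F_def by blast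
      then show ?thesis using ab(1) by blast
    qed
    moreover have "\<Union>F \<subseteq> U" using box_subset_cbox unfolding F_def by blast
    ultimately have "\<Union>F = U" by blast
    then have UF: "\<Union>F' = U" using F'(3) by simp
    show ?thesis
    proof (cases "F' = {}")
      case True
      then show ?thesis using UF by auto
    next
      case False
      define c where "c = from_nat_into F'"
      have c: "range c = F'" unfolding c_def by (rule range_from_nat_into[OF False F'(2)])
      have "c j \<in> F" for j
        using rangeI[of c j] c F'(1) by (metis subsetD)
      then have "\<exists>a b. c j = box a b \<and> cbox a b \<subseteq> U" for j
        unfolding F_def by blast
      then obtain a b where ab: "\<And>j. c j = box (a j) (b j)" "\<And>j. cbox (a j) (b j) \<subseteq> U"
        by metis
      \<comment> \<open>A smooth union of the first m boxes: by de Morgan it tends to the indicator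
        of their union as n grows. The limit in m is taken afterwards.\<close>
      define h where "h m n x = 1 - (\<Prod>j<m. 1 - box_bump n (a j) (b j) x)" for m n :: nat and x
      have h_test: "h m n \<in> test_functions \<Omega>" for m n
      proof (rule test_functionsI[where K = "\<Union>j<m. cbox (a j) (b j)"])
        show "Ck k (h m n)" for k
          unfolding h_def by (intro Ck_diff Ck_prod Ck_const Ck_box_bump)
        show "(\<Union>j<m. cbox (a j) (b j)) \<subseteq> \<Omega>" using ab(2) U(2) by blast
        have "box_bump n (a j) (b j) x = 0" if "x \<notin> cbox (a j) (b j)" for x j
          using box_bump_support[of n "a j" "b j"] that box_subset_cbox[of "a j" "b j"] by blast
        then have "h m n x = 0" if "x \<notin> (\<Union>j<m. cbox (a j) (b j))" for x
          using that unfolding h_def by simp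
        then show "{x. h m n x \<noteq> 0} \<subseteq> (\<Union>j<m. cbox (a j) (b j))" by blast
      qed auto
      have h_bounds: "\<bar>h m n x\<bar> \<le> 1" for m n x
      proof -
        have "0 \<le> (\<Prod>j<m. 1 - box_bump n (a j) (b j) x)" "(\<Prod>j<m. 1 - box_bump n (a j) (b j) x) \<le> 1"
          using box_bump_bounds by (auto intro!: prod_nonneg prod_le_1)
        then show ?thesis by (auto simp: h_def)
      qed
      define H where "H m x = (1 - (\<Prod>j<m. 1 - indicator (c j) x) :: real)" for m :: nat and x
      have "(\<lambda>n. h m n x) \<longlonglongrightarrow> H m x" for m x
        unfolding h_def H_def ab(1) by (intro tendsto_intros box_bump_tendsto)
      moreover have h_cont: "continuous_on UNIV (h m n)" for m n
        by (rule test_function_continuous[OF h_test])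
      have [measurable]: "h m n \<in> borel_measurable ?M" for m n
        by (rule continuous_imp_measurable_on_sets_lebesgue[OF continuous_on_subset[OF h_cont]]) (use \<Omega>m in auto)
      have [measurable]: "H m \<in> borel_measurable ?M" for m
        by (rule borel_measurable_LIMSEQ_real[OF calculation]) auto
      have conv: "(\<lambda>n. LINT x|?M. h m n x * g x) \<longlonglongrightarrow> (LINT x|?M. H m x * g x)" for m
        by (rule integral_dominated_convergence[where w = "\<lambda>x. norm (g x)"])
          (use g calculation h_bounds in \<open>auto intro!: tendsto_intros simp: abs_mult mult_left_le_one_le\<close>)
      then have H0: "(LINT x|?M. H m x * g x) = 0" for m
        using zero[OF h_test] by (simp add: LIMSEQ_const_iff)
      have H_eq: "H m x = indicator (\<Union>j<m. c j) x" for m x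
      proof (cases "x \<in> (\<Union>j<m. c j)")
        case True
        then have "(\<Prod>j<m. 1 - indicator (c j) x) = (0::real)"
          by (auto simp: indicator_def)
        then show ?thesis using True by (simp add: H_def)
      next
        case False
        then have "(\<Prod>j<m. 1 - indicator (c j) x) = (1::real)"
          by (intro prod.neutral) auto
        then show ?thesis using False by (simp add: H_def)
      qed
      have [measurable]: "indicat_real U \<in> borel_measurable ?M"
        "indicat_real (\<Union>j<m. c j) \<in> borel_measurable ?M" for m
        using U(1) by (auto intro!: ind simp: ab(1))
      have "(\<lambda>m. H m x) \<longlonglongrightarrow> indicator U x" for x
        unfolding H_eq using LIMSEQ_indicator_UN[of c x] UF c by simp
      then have "(\<lambda>m. LINT x|?M. H m x * g x) \<longlonglongrightarrow> (LINT x|?M. indicator U x * g x)"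
        by (intro integral_dominated_convergence[where w = "\<lambda>x. norm (g x)"])
          (use g in \<open>auto intro!: tendsto_intros simp: abs_mult mult_left_le_one_le H_eq\<close>)
      then show ?thesis by (simp add: H0 LIMSEQ_const_iff)
    qed
  qed
  have "(LINT x|?M. indicator A x * g x) = 0" if A: "A \<in> sets ?M" for A
  proof -
    have "A \<in> sets lebesgue" "A \<subseteq> \<Omega>"
      using A \<Omega> by (auto simp: sets_restrict_space_iff)
    \<comment> \<open>Up to a null set \<open>A\<close> is a G-delta set, hence inside
      \<open>\<Omega>\<close> a decreasing limit of open subsets of \<open>\<Omega>\<close>.\<close>
    from lebesgue_set_almost_gdelta[OF this(1)] obtain C N where
      CN: "gdelta C" "N \<in> null_sets lebesgue" "A \<union> N = C" by blast
    then obtain F where F: "\<And>n::nat. open (F n)" "C = \<Inter>(range F)"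
      by (metis gdelta.cases)
    define G where "G n = \<Omega> \<inter> (\<Inter>i\<le>n. F i)" for n
    have G: "open (G n)" "G n \<subseteq> \<Omega>" for n
      using F(1) \<Omega> by (auto simp: G_def intro!: open_Int open_INT)
    have "decseq G" by (force simp: G_def decseq_def)
    moreover have "(\<Inter>n. G n) = C \<inter> \<Omega>" by (auto simp: G_def F(2))
    ultimately have lim: "(\<lambda>n. indicator (G n) x) \<longlonglongrightarrow> (indicator (C \<inter> \<Omega>) x :: real)" for x
      using LIMSEQ_indicator_decseq[of G x] by simp
    have [measurable]: "indicat_real (G n) \<in> borel_measurable ?M" for n
      using G by (auto intro!: ind)
    have [measurable]: "indicat_real (C \<inter> \<Omega>) \<in> borel_measurable ?M"
      by (rule borel_measurable_LIMSEQ_real[OF lim]) simp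
    have [measurable]: "indicat_real A \<in> borel_measurable ?M"
      by (rule ind) fact
    have "(\<lambda>n. LINT x|?M. indicator (G n) x * g x) \<longlonglongrightarrow> (LINT x|?M. indicator (C \<inter> \<Omega>) x * g x)"
      by (rule integral_dominated_convergence[where w = "\<lambda>x. norm (g x)"])
        (use g in \<open>auto intro!: tendsto_intros lim simp: abs_mult mult_left_le_one_le\<close>)
    then have "(LINT x|?M. indicator (C \<inter> \<Omega>) x * g x) = 0"
      using open_zero[OF G] by (simp add: LIMSEQ_const_iff)
    moreover have "AE x in ?M. x \<notin> N"
      using AE_not_in[OF CN(2)] \<Omega> by (subst AE_restrict_space_iff) auto
    then have "AE x in ?M. indicator A x * g x = indicator (C \<inter> \<Omega>) x * g x"
      using AE_space
    proof eventually_elim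
      case (elim x)
      then show ?case using CN(3) by (auto simp: indicator_def)
    qed
    then have "(LINT x|?M. indicator A x * g x) = (LINT x|?M. indicator (C \<inter> \<Omega>) x * g x)"
      by (intro integral_cong_AE) measurable
    ultimately show ?thesis by simp
  qed
  moreover have "sigma_finite_measure ?M"
    by (intro finite_measure.axioms(1) finite_measure_lebesgue_on lmeasurable_open \<Omega>)
  ultimately show ?thesis
    by (intro sigma_finite_measure.density_zero[OF _ g]) (simp_all add: set_lebesgue_integral_def)
qed

subsection \<open>Square integrable functions\<close>

lemma integrable_mult_square:
  fixes f g :: "'a \<Rightarrow> real"
  assumes [measurable]: "f \<in> borel_measurable M" "g \<in> borel_measurable M"
    and "integrable M (\<lambda>x. (f x)\<^sup>2)" "integrable M (\<lambda>x. (g x)\<^sup>2)"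
  shows "integrable M (\<lambda>x. f x * g x)"
proof (rule Bochner_Integration.integrable_bound)
  show "integrable M (\<lambda>x. (f x)\<^sup>2 + (g x)\<^sup>2)" using assms by simp
  have "\<bar>a * b\<bar> \<le> a\<^sup>2 + b\<^sup>2" for a b :: real
  proof -
    have "2 * (\<bar>a\<bar> * \<bar>b\<bar>) \<le> a\<^sup>2 + b\<^sup>2" "0 \<le> \<bar>a\<bar> * \<bar>b\<bar>"
      using sum_squares_bound[of "\<bar>a\<bar>" "\<bar>b\<bar>"] by simp_all
    then show ?thesis unfolding abs_mult by linarith
  qed
  then show "AE x in M. norm (f x * g x) \<le> norm ((f x)\<^sup>2 + (g x)\<^sup>2)" by simp
qed simp

lemma integral_Cauchy_Schwarz:
  fixes f g :: "'a \<Rightarrow> real"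
  assumes [measurable]: "f \<in> borel_measurable M" "g \<in> borel_measurable M"
    and int: "integrable M (\<lambda>x. (f x)\<^sup>2)" "integrable M (\<lambda>x. (g x)\<^sup>2)"
  shows "\<bar>LINT x|M. f x * g x\<bar> \<le> sqrt (LINT x|M. (f x)\<^sup>2) * sqrt (LINT x|M. (g x)\<^sup>2)"
proof -
  define a b c where "a = (LINT x|M. (f x)\<^sup>2)" "b = (LINT x|M. (g x)\<^sup>2)" "c = (LINT x|M. f x * g x)"
  have q: "0 \<le> a - 2 * s * c + s\<^sup>2 * b" for s
  proof -
    have "0 \<le> (LINT x|M. (f x - s * g x)\<^sup>2)" by simp
    also have "(\<lambda>x. (f x - s * g x)\<^sup>2) = (\<lambda>x. (f x)\<^sup>2 - (2 * s) * (f x * g x) + s\<^sup>2 * (g x)\<^sup>2)"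
      by (auto simp: power2_eq_square algebra_simps)
    also have "(LINT x|M. (f x)\<^sup>2 - (2 * s) * (f x * g x) + s\<^sup>2 * (g x)\<^sup>2) = a - 2 * s * c + s\<^sup>2 * b"
      unfolding a_b_c_def using int integrable_mult_square[OF assms] by simp
    finally show ?thesis .
  qed
  have "b \<ge> 0" by (simp add: a_b_c_def)
  have "c\<^sup>2 \<le> a * b"
  proof (cases "b = 0")
    case True
    have "c = 0"
    proof (rule ccontr)
      assume "c \<noteq> 0"
      \<comment> \<open>With b = 0 the quadratic in s is affine, and at this s it takes the value a
        - (a + 1) = -1.\<close>
      then show False using q[of "(a + 1) / (2 * c)"] True by simp
    qed
    then show ?thesis using True by simp
  next
    case False
    then have "b > 0" using \<open>b \<ge> 0\<close> by simp
    \<comment> \<open>This s minimizes the quadratic, where nonnegativity is the Cauchy-Schwarz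
      inequality.\<close>
    then show ?thesis using q[of "c / b"] by (simp add: field_simps power2_eq_square)
  qed
  then show ?thesis
    unfolding a_b_c_def[symmetric] by (metis real_sqrt_abs real_sqrt_le_mono real_sqrt_mult)
qed

lemma Lp2_iff: "f \<in> Lp \<Omega> 2 \<longleftrightarrow>
    f \<in> borel_measurable (lebesgue_on \<Omega>) \<and> integrable (lebesgue_on \<Omega>) (\<lambda>x. (norm (f x))\<^sup>2)"
  by (simp add: Lp_def)

lemma Lp_norm_2: "Lp_norm \<Omega> 2 f = sqrt (LINT x|lebesgue_on \<Omega>. (norm (f x))\<^sup>2)"
  by (simp add: Lp_norm_def powr_half_sqrt)

lemma Lp_norm_2_square: "(Lp_norm \<Omega> 2 f)\<^sup>2 = (LINT x|lebesgue_on \<Omega>. (norm (f x))\<^sup>2)"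
  by (simp add: Lp_norm_2)

lemma Lp_norm_nonneg [simp]: "0 \<le> Lp_norm \<Omega> p f"
  by (simp add: Lp_norm_def)

lemma Lp2_measurable: "f \<in> Lp \<Omega> 2 \<Longrightarrow> f \<in> borel_measurable (lebesgue_on \<Omega>)"
  by (simp add: Lp2_iff)

lemma Lp2_integrable_norm_mult:
  assumes "f \<in> Lp \<Omega> 2" "g \<in> Lp \<Omega> 2"
  shows "integrable (lebesgue_on \<Omega>) (\<lambda>x. norm (f x) * norm (g x))"
    and "(LINT x|lebesgue_on \<Omega>. norm (f x) * norm (g x)) \<le> Lp_norm \<Omega> 2 f * Lp_norm \<Omega> 2 g"
proof -
  note [measurable] = Lp2_measurable[OF assms(1)] Lp2_measurable[OF assms(2)]
  show "integrable (lebesgue_on \<Omega>) (\<lambda>x. norm (f x) * norm (g x))"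
    using assms by (intro integrable_mult_square) (auto simp: Lp2_iff)
  have "(LINT x|lebesgue_on \<Omega>. norm (f x) * norm (g x)) \<le> \<bar>LINT x|lebesgue_on \<Omega>. norm (f x) * norm (g x)\<bar>"
    by simp
  also have "\<dots> \<le> Lp_norm \<Omega> 2 f * Lp_norm \<Omega> 2 g"
    unfolding Lp_norm_2 using assms by (intro integral_Cauchy_Schwarz) (auto simp: Lp2_iff)
  finally show "(LINT x|lebesgue_on \<Omega>. norm (f x) * norm (g x)) \<le> Lp_norm \<Omega> 2 f * Lp_norm \<Omega> 2 g" .
qed

text \<open>A common form for all products of two square integrable functions: inner products,
  scalar multiples, and products with a constant.\<close>

lemma Lp2_integrable_bilinear:
  assumes fg: "f \<in> Lp \<Omega> 2" "g \<in> Lp \<Omega> 2"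
    and h: "h \<in> borel_measurable (lebesgue_on \<Omega>)" "\<And>x. norm (h x) \<le> norm (f x) * norm (g x)"
  shows "integrable (lebesgue_on \<Omega>) (h :: _ \<Rightarrow> 'b :: {banach, second_countable_topology})"
    and "norm (LINT x|lebesgue_on \<Omega>. h x) \<le> Lp_norm \<Omega> 2 f * Lp_norm \<Omega> 2 g"
proof -
  show int: "integrable (lebesgue_on \<Omega>) h"
    by (rule Bochner_Integration.integrable_bound[OF Lp2_integrable_norm_mult(1)[OF fg] h(1)])
      (use h(2) in auto)
  have "norm (LINT x|lebesgue_on \<Omega>. h x) \<le> (LINT x|lebesgue_on \<Omega>. norm (h x))"
    by (rule integral_norm_bound)
  also have "\<dots> \<le> (LINT x|lebesgue_on \<Omega>. norm (f x) * norm (g x))"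
    using int h(2) Lp2_integrable_norm_mult(1)[OF fg] by (intro integral_mono) auto
  also have "\<dots> \<le> Lp_norm \<Omega> 2 f * Lp_norm \<Omega> 2 g"
    by (rule Lp2_integrable_norm_mult(2)[OF fg])
  finally show "norm (LINT x|lebesgue_on \<Omega>. h x) \<le> Lp_norm \<Omega> 2 f * Lp_norm \<Omega> 2 g" .
qed

lemma Lp2_inner:
  assumes "f \<in> Lp \<Omega> 2" "g \<in> Lp \<Omega> 2"
  shows Lp2_integrable_inner: "integrable (lebesgue_on \<Omega>) (\<lambda>x. f x \<bullet> g x)"
    and Lp2_Cauchy_Schwarz: "\<bar>LINT x|lebesgue_on \<Omega>. f x \<bullet> g x\<bar> \<le> Lp_norm \<Omega> 2 f * Lp_norm \<Omega> 2 g"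
  using Lp2_integrable_bilinear[OF assms, of "\<lambda>x. f x \<bullet> g x"] Cauchy_Schwarz_ineq2
    Lp2_measurable[OF assms(1)] Lp2_measurable[OF assms(2)]
  by auto

lemma Lp2_inner_self: "(LINT x|lebesgue_on \<Omega>. f x \<bullet> f x) = (Lp_norm \<Omega> 2 f)\<^sup>2"
  by (simp add: Lp_norm_2_square power2_norm_eq_inner)

lemma Lp2_scaleR: "f \<in> Lp \<Omega> 2 \<Longrightarrow> (\<lambda>x. a *\<^sub>R f x) \<in> Lp \<Omega> 2"
  by (auto simp: Lp2_iff power_mult_distrib)

lemma Lp2_add:
  assumes "f \<in> Lp \<Omega> 2" "g \<in> Lp \<Omega> 2"
  shows "(\<lambda>x. f x + g x) \<in> Lp \<Omega> 2"
proof -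
  note [measurable] = Lp2_measurable[OF assms(1)] Lp2_measurable[OF assms(2)]
  have "norm (f x + g x) ^ 2 = norm (f x) ^ 2 + 2 * (f x \<bullet> g x) + norm (g x) ^ 2" for x
    by (simp add: power2_norm_eq_inner inner_add inner_commute)
  then show ?thesis
    using assms Lp2_integrable_inner[OF assms] by (simp add: Lp2_iff)
qed

lemma Lp2_minus: "f \<in> Lp \<Omega> 2 \<Longrightarrow> (\<lambda>x. - f x) \<in> Lp \<Omega> 2"
  using Lp2_scaleR[of f \<Omega> "-1"] by simp

lemma Lp2_diff: "f \<in> Lp \<Omega> 2 \<Longrightarrow> g \<in> Lp \<Omega> 2 \<Longrightarrow> (\<lambda>x. f x - g x) \<in> Lp \<Omega> 2"
  using Lp2_add[OF _ Lp2_minus, of f \<Omega> g] by simp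

lemma Lp2_norm_scaleR: "Lp_norm \<Omega> 2 (\<lambda>x. a *\<^sub>R f x) = \<bar>a\<bar> * Lp_norm \<Omega> 2 f"
  by (simp add: Lp_norm_2 power_mult_distrib real_sqrt_mult)

lemma Lp2_norm_minus: "Lp_norm \<Omega> 2 (\<lambda>x. - f x) = Lp_norm \<Omega> 2 f"
  by (simp add: Lp_norm_2)

lemma Lp2_norm_minus_commute: "Lp_norm \<Omega> 2 (\<lambda>x. f x - g x) = Lp_norm \<Omega> 2 (\<lambda>x. g x - f x)"
  by (simp add: Lp_norm_2 norm_minus_commute)

lemma Lp2_triangle:
  assumes "f \<in> Lp \<Omega> 2" "g \<in> Lp \<Omega> 2"
  shows "Lp_norm \<Omega> 2 (\<lambda>x. f x + g x) \<le> Lp_norm \<Omega> 2 f + Lp_norm \<Omega> 2 g"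
proof (rule power2_le_imp_le)
  have "norm (f x + g x) ^ 2 = norm (f x) ^ 2 + 2 * (f x \<bullet> g x) + norm (g x) ^ 2" for x
    by (simp add: power2_norm_eq_inner inner_add inner_commute)
  then have "(Lp_norm \<Omega> 2 (\<lambda>x. f x + g x))\<^sup>2 = 
      (Lp_norm \<Omega> 2 f)\<^sup>2 + 2 * (LINT x|lebesgue_on \<Omega>. f x \<bullet> g x) + (Lp_norm \<Omega> 2 g)\<^sup>2"
    unfolding Lp_norm_2_square using assms Lp2_integrable_inner[OF assms] by (simp add: Lp2_iff)
  also have "\<dots> \<le> (Lp_norm \<Omega> 2 f + Lp_norm \<Omega> 2 g)\<^sup>2"
    using Lp2_Cauchy_Schwarz[OF assms] by (simp add: power2_sum)
  finally show "(Lp_norm \<Omega> 2 (\<lambda>x. f x + g x))\<^sup>2 \<le> (Lp_norm \<Omega> 2 f + Lp_norm \<Omega> 2 g)\<^sup>2" .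
qed simp

lemma Lp2_triangle_diff:
  assumes "f \<in> Lp \<Omega> 2" "g \<in> Lp \<Omega> 2"
  shows "Lp_norm \<Omega> 2 (\<lambda>x. f x - g x) \<le> Lp_norm \<Omega> 2 f + Lp_norm \<Omega> 2 g"
  using Lp2_triangle[OF assms(1) Lp2_minus[OF assms(2)]] by (simp add: Lp2_norm_minus)

lemma Lp2_norm_cong_AE:
  assumes "f \<in> Lp \<Omega> 2" "g \<in> borel_measurable (lebesgue_on \<Omega>)" "AE x in lebesgue_on \<Omega>. f x = g x"
  shows "Lp_norm \<Omega> 2 f = Lp_norm \<Omega> 2 g"
  unfolding Lp_norm_2 using assms
  by (intro arg_cong[of _ _ sqrt] integral_cong_AE) (auto simp: Lp2_iff elim: AE_mp)

lemma Lp2_norm_mono: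
  assumes f: "f \<in> Lp \<Omega> 2" and g: "g \<in> borel_measurable (lebesgue_on \<Omega>)"
    and le: "AE x in lebesgue_on \<Omega>. norm (g x) \<le> norm (f x)"
  shows "g \<in> Lp \<Omega> 2" "Lp_norm \<Omega> 2 g \<le> Lp_norm \<Omega> 2 f"
proof -
  have le': "AE x in lebesgue_on \<Omega>. (norm (g x))\<^sup>2 \<le> (norm (f x))\<^sup>2"
    using le by eventually_elim (simp add: power_mono)
  show "g \<in> Lp \<Omega> 2"
    using f g le' unfolding Lp2_iff
    by (auto intro!: Bochner_Integration.integrable_bound[of _ "\<lambda>x. (norm (f x))\<^sup>2" "\<lambda>x. (norm (g x))\<^sup>2"])
  then show "Lp_norm \<Omega> 2 g \<le> Lp_norm \<Omega> 2 f"
    unfolding Lp_norm_2 using f le' by (intro real_sqrt_le_mono integral_mono_AE) (auto simp: Lp2_iff)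
qed

lemma borel_measurable_vec_nth [measurable (raw)]:
  fixes f :: "'a \<Rightarrow> ('b::euclidean_space)^'n"
  shows "f \<in> borel_measurable M \<Longrightarrow> (\<lambda>x. f x $ i) \<in> borel_measurable M"
  by (erule borel_measurable_continuous_on[rotated]) (intro continuous_intros)

lemma Lp2_component:
  fixes f :: "real^2 \<Rightarrow> ('b::euclidean_space)^'n"
  assumes "f \<in> Lp \<Omega> 2"
  shows "(\<lambda>x. f x $ i) \<in> Lp \<Omega> 2" "Lp_norm \<Omega> 2 (\<lambda>x. f x $ i) \<le> Lp_norm \<Omega> 2 f"
  using Lp2_norm_mono[OF assms borel_measurable_vec_nth[OF Lp2_measurable[OF assms]]]
  by (simp_all add: Finite_Cartesian_Product.norm_nth_le)

lemma norm_vec_square: "(norm (v :: 'a::real_normed_vector ^ 'n))\<^sup>2 = (\<Sum>i\<in>UNIV. (norm (v $ i))\<^sup>2)"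
  by (simp add: norm_vec_def L2_set_def sum_nonneg)

lemma borel_measurable_vecI:
  fixes f :: "'a \<Rightarrow> ('b::euclidean_space)^'n"
  assumes "\<And>i. (\<lambda>x. f x $ i) \<in> borel_measurable M"
  shows "f \<in> borel_measurable M"
proof (subst borel_measurable_euclidean_space, intro ballI)
  fix b :: "'b^'n" assume "b \<in> Basis"
  have "(\<lambda>x. f x \<bullet> b) = (\<lambda>x. \<Sum>i\<in>UNIV. f x $ i \<bullet> b $ i)" by (simp add: inner_vec_def)
  then show "(\<lambda>x. f x \<bullet> b) \<in> borel_measurable M" using assms by simp
qed

lemma Lp2_vec_iff:
  fixes f :: "real^2 \<Rightarrow> ('b::euclidean_space)^'n"
  shows "f \<in> Lp \<Omega> 2 \<longleftrightarrow> (\<forall>i. (\<lambda>x. f x $ i) \<in> Lp \<Omega> 2)"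
proof
  assume f: "\<forall>i. (\<lambda>x. f x $ i) \<in> Lp \<Omega> 2"
  then have "f \<in> borel_measurable (lebesgue_on \<Omega>)"
    by (intro borel_measurable_vecI) (auto simp: Lp2_iff)
  then show "f \<in> Lp \<Omega> 2" using f by (auto simp: Lp2_iff norm_vec_square)
next
  assume "f \<in> Lp \<Omega> 2"
  then show "\<forall>i. (\<lambda>x. f x $ i) \<in> Lp \<Omega> 2"
    by (intro allI Lp2_component(1))
qed

lemma Lp2_norm_vec_square:
  fixes f :: "real^2 \<Rightarrow> ('b::euclidean_space)^'n"
  assumes "f \<in> Lp \<Omega> 2"
  shows "(Lp_norm \<Omega> 2 f)\<^sup>2 = (\<Sum>i\<in>UNIV. (Lp_norm \<Omega> 2 (\<lambda>x. f x $ i))\<^sup>2)"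
  using assms[unfolded Lp2_vec_iff] unfolding Lp_norm_2_square norm_vec_square
  by (subst Bochner_Integration.integral_sum) (auto simp: Lp2_iff)

lemma Lp4_iff: "f \<in> Lp \<Omega> 4 \<longleftrightarrow>
    f \<in> borel_measurable (lebesgue_on \<Omega>) \<and> integrable (lebesgue_on \<Omega>) (\<lambda>x. (norm (f x)) ^ 4)"
  by (simp add: Lp_def)

text \<open>The square of the L4 norm is the L2 norm of |f|^2; in this form Cauchy-Schwarz applies
  to products of squares.\<close>

lemma Lp_norm_4: "(Lp_norm \<Omega> 4 f)\<^sup>2 = sqrt (LINT x|lebesgue_on \<Omega>. ((norm (f x))\<^sup>2)\<^sup>2)"
proof -
  have "0 \<le> (LINT x|lebesgue_on \<Omega>. (norm (f x)) ^ 4)" by simp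
  then have "((LINT x|lebesgue_on \<Omega>. (norm (f x)) ^ 4) powr (1 / 4)) ^ 2
      = sqrt (LINT x|lebesgue_on \<Omega>. (norm (f x)) ^ 4)"
    by (simp add: powr_powr flip: powr_numeral powr_half_sqrt)
  then show ?thesis by (simp add: Lp_norm_def flip: power_mult)
qed

text \<open>Hoelder with exponents 2, 4, 4 as two applications of Cauchy-Schwarz: to a against |b|
  |c|, then to |b|^2 against |c|^2. It serves the convection term and the perturbation of the
  coefficient.\<close>

lemma integrable_Lp2_Lp4_Lp4:
  assumes a: "a \<in> Lp \<Omega> 2" and b: "b \<in> Lp \<Omega> 4" and c: "c \<in> Lp \<Omega> 4"
    and h: "h \<in> borel_measurable (lebesgue_on \<Omega>)"
      "\<And>x. \<bar>h x\<bar> \<le> norm (a x) * norm (b x) * norm (c x)"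
  shows "integrable (lebesgue_on \<Omega>) h"
    and "\<bar>LINT x|lebesgue_on \<Omega>. h x\<bar> \<le> Lp_norm \<Omega> 2 a * Lp_norm \<Omega> 4 b * Lp_norm \<Omega> 4 c"
proof -
  let ?M = "lebesgue_on \<Omega>"
  have [measurable]: "b \<in> borel_measurable ?M" "c \<in> borel_measurable ?M"
    using b c by (auto simp: Lp4_iff)
  have b2: "integrable ?M (\<lambda>x. ((norm (b x))\<^sup>2)\<^sup>2)" and c2: "integrable ?M (\<lambda>x. ((norm (c x))\<^sup>2)\<^sup>2)"
    using b c by (auto simp: Lp4_iff simp flip: power_mult)
  have bc: "(\<lambda>x. norm (b x) * norm (c x)) \<in> Lp \<Omega> 2"
    unfolding Lp2_iff using integrable_mult_square[OF _ _ b2 c2] by (simp add: power_mult_distrib)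
  have "(Lp_norm \<Omega> 2 (\<lambda>x. norm (b x) * norm (c x)))\<^sup>2 =
      \<bar>LINT x|?M. (norm (b x))\<^sup>2 * (norm (c x))\<^sup>2\<bar>"
    by (simp add: Lp_norm_2_square power_mult_distrib)
  also have "\<dots> \<le> (Lp_norm \<Omega> 4 b)\<^sup>2 * (Lp_norm \<Omega> 4 c)\<^sup>2"
    unfolding Lp_norm_4
    by (rule integral_Cauchy_Schwarz[where f = "\<lambda>x. (norm (b x))\<^sup>2" and g = "\<lambda>x. (norm (c x))\<^sup>2"];
        (rule b2 c2 | measurable))
  finally have le: "Lp_norm \<Omega> 2 (\<lambda>x. norm (b x) * norm (c x)) \<le> Lp_norm \<Omega> 4 b * Lp_norm \<Omega> 4 c"
    by (intro power2_le_imp_le[OF _ mult_nonneg_nonneg]) (simp_all add: power_mult_distrib)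
  have h': "norm (h x) \<le> norm (a x) * norm (norm (b x) * norm (c x))" for x
    using h(2)[of x] by (simp add: mult.assoc)
  show "integrable ?M h"
    by (rule Lp2_integrable_bilinear(1)[OF a bc h(1) h'])
  have "\<bar>LINT x|?M. h x\<bar> \<le> Lp_norm \<Omega> 2 a * Lp_norm \<Omega> 2 (\<lambda>x. norm (b x) * norm (c x))"
    using Lp2_integrable_bilinear(2)[OF a bc h(1) h'] by simp
  also have "\<dots> \<le> Lp_norm \<Omega> 2 a * (Lp_norm \<Omega> 4 b * Lp_norm \<Omega> 4 c)"
    by (intro mult_left_mono le) simp
  finally show "\<bar>LINT x|?M. h x\<bar> \<le> Lp_norm \<Omega> 2 a * Lp_norm \<Omega> 4 b * Lp_norm \<Omega> 4 c"
    by (simp add: mult.assoc)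
qed

subsection \<open>Weak gradients and Sobolev spaces\<close>

lemma test_function_has_derivative:
  "\<eta> \<in> test_functions S \<Longrightarrow> (\<eta> has_derivative frechet_derivative \<eta> (at x)) (at x)"
  using Ck_SucD(1)[of 0 \<eta>] by (simp add: test_functions_def)

lemma test_function_partial:
  assumes \<eta>: "\<eta> \<in> test_functions S" and b: "b \<in> Basis"
  shows "(\<lambda>x. frechet_derivative \<eta> (at x) b) \<in> test_functions S"
proof (rule test_functionsI[where K = "closure {x. \<eta> x \<noteq> 0}"])
  show "Ck k (\<lambda>x. frechet_derivative \<eta> (at x) b)" for k
    using \<eta> b Ck_SucD(2)[of k \<eta> b] by (auto simp: test_functions_def)
  show "{x. frechet_derivative \<eta> (at x) b \<noteq> 0} \<subseteq> closure {x. \<eta> x \<noteq> 0}"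
  proof (rule subsetI, rule ccontr)
    fix x assume x: "x \<in> {x. frechet_derivative \<eta> (at x) b \<noteq> 0}" "x \<notin> closure {x. \<eta> x \<noteq> 0}"
    \<comment> \<open>The complement of the closed support is an open neighbourhood of x on which
      the function is identically zero.\<close>
    have "((\<lambda>x. 0) has_derivative frechet_derivative \<eta> (at x)) (at x)"
      by (rule has_derivative_transform_within_open[OF test_function_has_derivative[OF \<eta>],
            of "- closure {x. \<eta> x \<noteq> 0}"])
        (use x closure_subset[of "{x. \<eta> x \<noteq> 0}"] in auto)
    then have "frechet_derivative \<eta> (at x) = (\<lambda>_. 0)"
      by (rule has_derivative_unique) simp
    then show False using x(1) by simp
  qed
qed (use \<eta> in \<open>auto simp: test_functions_def\<close>)

lemma test_function_outside: "\<eta> \<in> test_functions S \<Longrightarrow> x \<notin> S \<Longrightarrow> \<eta> x = 0"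
  using closure_subset[of "{x. \<eta> x \<noteq> 0}"] by (auto simp: test_functions_def)

lemma test_function_lincomb:
  assumes "\<eta> \<in> test_functions S" "\<eta>' \<in> test_functions S"
  shows "(\<lambda>x. a * \<eta> x + b * \<eta>' x) \<in> test_functions S"
proof (rule test_functionsI[where K = "closure {x. \<eta> x \<noteq> 0} \<union> closure {x. \<eta>' x \<noteq> 0}"])
  show "{x. a * \<eta> x + b * \<eta>' x \<noteq> 0} \<subseteq> closure {x. \<eta> x \<noteq> 0} \<union> closure {x. \<eta>' x \<noteq> 0}"
    using closure_subset[of "{x. \<eta> x \<noteq> 0}"] closure_subset[of "{x. \<eta>' x \<noteq> 0}"] by fastforce
qed (use assms in \<open>auto simp: test_functions_def intro!: Ck_add Ck_mult Ck_const\<close>)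

lemma lborel_integral_translate:
  fixes f :: "'a::euclidean_space \<Rightarrow> real"
  assumes "f \<in> borel_measurable borel"
  shows "(LINT x|lborel. f (c + x)) = (LINT x|lborel. f x)"
proof -
  have "(LINT x|lborel. f (c + x)) = (LINT x|distr lborel borel ((+) c). f x)"
    by (rule integral_distr[symmetric]) (use assms in auto)
  then show ?thesis by (simp add: lborel_distr_plus)
qed

lemma test_function_support_bounded:
  assumes "\<eta> \<in> test_functions S"
  obtains R where "\<And>x. \<eta> x \<noteq> 0 \<Longrightarrow> norm x \<le> R"
proof -
  have "bounded (closure {x. \<eta> x \<noteq> 0})"
    using assms by (auto simp: test_functions_def intro: compact_imp_bounded)
  then obtain R where "\<And>x. x \<in> closure {x. \<eta> x \<noteq> 0} \<Longrightarrow> norm x \<le> R"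
    by (auto simp: bounded_iff)
  then show ?thesis using closure_subset[of "{x. \<eta> x \<noteq> 0}"] that by blast
qed

text \<open>The derivative is the limit of difference quotients, whose integrals vanish by translation
  invariance.\<close>

lemma lborel_integral_partial_test:
  fixes \<eta> :: "'a::euclidean_space \<Rightarrow> real"
  assumes \<eta>: "\<eta> \<in> test_functions S" and b: "b \<in> Basis"
  shows "(LINT x|lborel. frechet_derivative \<eta> (at x) b) = 0"
proof -
  let ?d = "\<lambda>x. frechet_derivative \<eta> (at x) b"
  let ?h = "\<lambda>n. inverse (real (Suc n))"
  have cont: "continuous_on UNIV \<eta>" "continuous_on UNIV ?d"
    using test_function_continuous \<eta> test_function_partial[OF \<eta> b] by blast+
  have [measurable]: "\<eta> \<in> borel_measurable borel" "?d \<in> borel_measurable borel"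
    using cont by (auto intro: borel_measurable_continuous_onI)
  obtain B where B: "\<And>x. \<bar>?d x\<bar> \<le> B" using test_function_bounded[OF test_function_partial[OF \<eta> b]] by blast
  obtain R where R: "\<And>x. \<eta> x \<noteq> 0 \<Longrightarrow> norm x \<le> R" using test_function_support_bounded[OF \<eta>] by blast
  have line: "((\<lambda>t. \<eta> (x + t *\<^sub>R b)) has_real_derivative ?d (x + t *\<^sub>R b)) (at t)" for x t
  proof -
    have "((\<lambda>t. \<eta> (x + t *\<^sub>R b)) has_derivative (\<lambda>s. frechet_derivative \<eta> (at (x + t *\<^sub>R b)) (s *\<^sub>R b))) (at t)"
      by (rule has_derivative_compose[OF _ test_function_has_derivative[OF \<eta>]])
        (auto intro!: derivative_eq_intros)
    moreover have "frechet_derivative \<eta> (at y) (s *\<^sub>R b) = ?d y * s" for y s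
      using linear_cmul[OF has_derivative_linear[OF test_function_has_derivative[OF \<eta>]]] by simp
    ultimately show ?thesis by (simp add: has_field_derivative_def)
  qed
  have \<eta>_int: "integrable lborel \<eta>"
  proof -
    obtain C where C: "\<And>x. \<bar>\<eta> x\<bar> \<le> C" using test_function_bounded[OF \<eta>] by blast
    have "norm (\<eta> x) \<le> norm (C * indicator (cball 0 R) x)" for x
      using R[of x] C[of x] by (cases "\<eta> x = 0") auto
    moreover have "integrable lborel (\<lambda>x::'a. C * indicator (cball 0 R) x)"
      by (intro integrable_mult_right integrable_real_indicator) (auto simp: emeasure_lborel_cball_finite[unfolded infinity_ennreal_def])
    ultimately show ?thesis
      by (intro Bochner_Integration.integrable_bound[where g = \<eta> and f = "\<lambda>x. C * indicat_real (cball 0 R) x"]) auto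
  qed
  define D where "D n x = (\<eta> (?h n *\<^sub>R b + x) - \<eta> x) / ?h n" for n x
  have int_shift: "integrable lborel (\<lambda>x. \<eta> (c + x))" for c
  proof -
    have "integrable (distr lborel borel ((+) c)) \<eta>" using \<eta>_int by (simp add: lborel_distr_plus)
    then show ?thesis by (subst (asm) integrable_distr_eq) auto
  qed
  have D0: "(LINT x|lborel. D n x) = 0" for n
    unfolding D_def using \<eta>_int int_shift[of "?h n *\<^sub>R b"] lborel_integral_translate[of \<eta> "?h n *\<^sub>R b"]
    by simp
  have D_lim: "(\<lambda>n. D n x) \<longlonglongrightarrow> ?d x" for x
  proof -
    have "((\<lambda>h. (\<eta> (x + h *\<^sub>R b) - \<eta> x) / h) \<longlongrightarrow> ?d x) (at 0)"
      using line[of x 0] by (simp add: has_field_derivative_iff)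
    moreover have "filterlim ?h (at 0) sequentially"
      by (intro filterlim_atI LIMSEQ_inverse_real_of_nat) auto
    ultimately have "(\<lambda>n. (\<eta> (x + ?h n *\<^sub>R b) - \<eta> x) / ?h n) \<longlonglongrightarrow> ?d x"
      by (rule filterlim_compose)
    then show ?thesis unfolding D_def by (simp add: add.commute)
  qed
  \<comment> \<open>Inside the larger ball the mean value theorem bounds the quotient by the bound
    of the derivative. Outside it both points leave the support, because the shift has length at
    most 1.\<close>
  have D_bound: "norm (D n x) \<le> B * indicator (cball 0 (R + 1)) x" for n x
  proof (cases "x \<in> cball 0 (R + 1)")
    case True
    have h: "0 < ?h n" by simp
    obtain z where "\<eta> (x + ?h n *\<^sub>R b) - \<eta> (x + 0 *\<^sub>R b) = (?h n - 0) * ?d (x + z *\<^sub>R b)"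
      using MVT2[OF h, where f = "\<lambda>t. \<eta> (x + t *\<^sub>R b)" and f' = "\<lambda>t. ?d (x + t *\<^sub>R b)"] line by blast
    then have "D n x = ?d (x + z *\<^sub>R b)" by (simp add: D_def field_simps)
    then show ?thesis using B True by simp
  next
    case False
    have "norm (?h n *\<^sub>R b) \<le> 1" using b by (simp add: field_simps)
    then have "norm x \<le> norm (?h n *\<^sub>R b + x) + 1"
      using norm_triangle_ineq4[of "?h n *\<^sub>R b + x" "?h n *\<^sub>R b"] by simp
    then have "\<eta> (?h n *\<^sub>R b + x) = 0" "\<eta> x = 0"
      using False R[of x] R[of "?h n *\<^sub>R b + x"] by fastforce+
    then show ?thesis using False by (simp add: D_def)
  qed
  have "(\<lambda>n. LINT x|lborel. D n x) \<longlonglongrightarrow> (LINT x|lborel. ?d x)"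
  proof (rule integral_dominated_convergence[where w = "\<lambda>x. B * indicator (cball 0 (R + 1)) x"])
    show "integrable lborel (\<lambda>x::'a. B * indicator (cball 0 (R + 1)) x)"
      by (intro integrable_mult_right integrable_real_indicator) (auto simp: emeasure_lborel_cball_finite[unfolded infinity_ennreal_def])
    show "D n \<in> borel_measurable lborel" for n unfolding D_def by measurable
  qed (use D_lim D_bound in auto)
  then show ?thesis by (simp add: D0 LIMSEQ_const_iff)
qed

section \<open>Weak gradients on a bounded open set\<close>

locale planar_domain =
  fixes \<Omega> :: "(real^2) set"
  assumes open_domain: "open \<Omega>" and bounded_domain: "bounded \<Omega>"
begin

abbreviation "M \<equiv> lebesgue_on \<Omega>"

lemma domain_measurable [measurable]: "\<Omega> \<in> sets lebesgue"
  using open_domain by auto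

lemma finite_measure_domain: "finite_measure M"
  by (intro finite_measure_lebesgue_on lmeasurable_open open_domain bounded_domain)

lemma integrable_const_domain [simp]: "integrable M (\<lambda>x. c)"
  using finite_measure.integrable_const[OF finite_measure_domain] .

lemma Lp2_bounded:
  assumes "f \<in> borel_measurable M" "AE x in M. norm (f x) \<le> C"
  shows "f \<in> Lp \<Omega> 2"
proof -
  have "(\<lambda>x. \<bar>C\<bar>) \<in> Lp \<Omega> 2" by (simp add: Lp2_iff)
  moreover have "AE x in M. norm (f x) \<le> norm \<bar>C\<bar>"
    using assms(2) by eventually_elim simp
  ultimately show ?thesis using Lp2_norm_mono(1)[OF _ assms(1)] by blast
qed

lemma Lp2_integrable: "f \<in> Lp \<Omega> 2 \<Longrightarrow> integrable M (f :: _ \<Rightarrow> 'b::euclidean_space)"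
  by (rule Lp2_integrable_bilinear(1)[of f \<Omega> "\<lambda>x. 1::real"]) (auto simp: Lp2_iff)

lemma Lp2_bounded_mult:
  assumes f: "f \<in> Lp \<Omega> 2" and h: "h \<in> borel_measurable M" "AE x in M. \<bar>h x\<bar> \<le> C"
  shows "(\<lambda>x. h x *\<^sub>R f x) \<in> Lp \<Omega> 2" "Lp_norm \<Omega> 2 (\<lambda>x. h x *\<^sub>R f x) \<le> \<bar>C\<bar> * Lp_norm \<Omega> 2 f"
proof -
  have "AE x in M. norm (h x *\<^sub>R f x) \<le> norm (\<bar>C\<bar> *\<^sub>R f x)"
    using h(2) by eventually_elim (auto intro!: mult_right_mono)
  then show "(\<lambda>x. h x *\<^sub>R f x) \<in> Lp \<Omega> 2" "Lp_norm \<Omega> 2 (\<lambda>x. h x *\<^sub>R f x) \<le> \<bar>C\<bar> * Lp_norm \<Omega> 2 f"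
    using Lp2_norm_mono[OF Lp2_scaleR[OF f, of "\<bar>C\<bar>"], of "\<lambda>x. h x *\<^sub>R f x"] h(1) Lp2_measurable[OF f]
    by (auto simp: Lp2_norm_scaleR)
qed

lemma continuous_measurable: "continuous_on UNIV f \<Longrightarrow> f \<in> borel_measurable M"
  by (rule continuous_imp_measurable_on_sets_lebesgue) (auto intro: continuous_on_subset)

lemma test_function_Lp2: "\<eta> \<in> test_functions \<Omega> \<Longrightarrow> \<eta> \<in> Lp \<Omega> 2"
  by (metis (mono_tags, lifting) AE_I2 Lp2_bounded continuous_measurable real_norm_def
      test_function_bounded test_function_continuous)

lemma test_function_grad:
  assumes "\<eta> \<in> test_functions \<Omega>"
  shows "(\<lambda>x. grad \<eta> x $ i) \<in> test_functions \<Omega>" "grad \<eta> \<in> Lp \<Omega> 2"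
proof -
  show *: "(\<lambda>x. grad \<eta> x $ i) \<in> test_functions \<Omega>" for i
    using test_function_partial[OF assms, of "axis i 1"] by (simp add: grad_def)
  show "grad \<eta> \<in> Lp \<Omega> 2"
    using test_function_Lp2[OF *] by (simp add: Lp2_vec_iff)
qed

lemma grad_measurable:
  assumes "\<eta> \<in> test_functions \<Omega>"
  shows "grad \<eta> \<in> borel_measurable M"
  using test_function_grad(2)[OF assms] by (rule Lp2_measurable)

text \<open>A component may be moved inside a vector-valued integral when the integrand is
  integrable, which membership in L2 guarantees. All later arguments use the scalar form.\<close>

lemma is_weak_grad_iff:
  assumes f: "f \<in> Lp \<Omega> 2" and g: "g \<in> Lp \<Omega> 2"
  shows "is_weak_grad \<Omega> f g \<longleftrightarrow> (\<forall>\<eta>\<in>test_functions \<Omega>. \<forall>i.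
     (LINT x|M. f x * grad \<eta> x $ i) = - (LINT x|M. \<eta> x * g x $ i))"
proof -
  have 1: "integrable M (\<lambda>x. f x *\<^sub>R grad \<eta> x)" if "\<eta> \<in> test_functions \<Omega>" for \<eta>
    using Lp2_integrable_bilinear(1)[OF f test_function_grad(2)[OF that], of "\<lambda>x. f x *\<^sub>R grad \<eta> x"]
      Lp2_measurable[OF f] grad_measurable[OF that] by simp
  have 2: "integrable M (\<lambda>x. \<eta> x *\<^sub>R g x)" if "\<eta> \<in> test_functions \<Omega>" for \<eta>
    using Lp2_integrable_bilinear(1)[OF test_function_Lp2[OF that] g, of "\<lambda>x. \<eta> x *\<^sub>R g x"]
      Lp2_measurable[OF g] Lp2_measurable[OF test_function_Lp2[OF that]] by simp
  have comp: "(LINT x|M. h x) $ i = (LINT x|M. h x $ i)" if "integrable M h" for h :: "real^2 \<Rightarrow> real^2" and i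
    by (rule integral_bounded_linear[OF bounded_linear_vec_nth that, symmetric])
  show ?thesis
    unfolding is_weak_grad_def
    by (rule ball_cong[OF refl]) (simp add: vec_eq_iff comp 1 2)
qed

text \<open>The fundamental lemma applied to each component of the difference. Since
  \<open>wgrad\<close> is an arbitrary choice, this is what allows it to be computed almost
  everywhere.\<close>

lemma weak_grad_unique:
  assumes f: "f \<in> Lp \<Omega> 2" and g: "g \<in> Lp \<Omega> 2" "g' \<in> Lp \<Omega> 2"
    and w: "is_weak_grad \<Omega> f g" "is_weak_grad \<Omega> f g'"
  shows "AE x in M. g x = g' x"
proof -
  have "AE x in M. (g x - g' x) $ i = 0" for i
  proof (rule AE_zero_if_test_integrals_zero[OF open_domain bounded_domain])
    have d: "(\<lambda>x. (g x - g' x) $ i) \<in> Lp \<Omega> 2"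
      by (rule Lp2_component(1)[OF Lp2_diff[OF g]])
    show "integrable M (\<lambda>x. (g x - g' x) $ i)"
      by (rule Lp2_integrable[OF d])
    fix \<eta> assume \<eta>: "\<eta> \<in> test_functions \<Omega>"
    have i: "integrable M (\<lambda>x. \<eta> x * h x $ i)" if "h \<in> Lp \<Omega> 2" for h :: vfield
      using Lp2_integrable_inner[OF test_function_Lp2[OF \<eta>] Lp2_component(1)[OF that, of i]]
      by (simp only: inner_real_def)
    have "(LINT x|M. \<eta> x * g x $ i) = (LINT x|M. \<eta> x * g' x $ i)"
      using w[unfolded is_weak_grad_iff[OF f g(1)] is_weak_grad_iff[OF f g(2)], rule_format, OF \<eta>, of i]
      by simp
    then show "(LINT x|M. \<eta> x * (g x - g' x) $ i) = 0"
      using i[OF g(1)] i[OF g(2)] by (simp add: right_diff_distrib)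
  qed
  then have "AE x in M. \<forall>i. (g x - g' x) $ i = 0"
    by (subst AE_all_countable) auto
  then show ?thesis by eventually_elim (simp add: vec_eq_iff)
qed

lemma H1_D:
  assumes "f \<in> H1 \<Omega>"
  shows "f \<in> Lp \<Omega> 2" "wgrad \<Omega> f \<in> Lp \<Omega> 2" "is_weak_grad \<Omega> f (wgrad \<Omega> f)"
proof -
  show "f \<in> Lp \<Omega> 2" using assms by (simp add: H1_def)
  have "\<exists>g. g \<in> Lp \<Omega> 2 \<and> is_weak_grad \<Omega> f g" using assms by (auto simp: H1_def)
  from someI_ex[OF this] show "wgrad \<Omega> f \<in> Lp \<Omega> 2" "is_weak_grad \<Omega> f (wgrad \<Omega> f)"
    by (auto simp: wgrad_def)
qed

lemma H1_I:
  assumes "f \<in> Lp \<Omega> 2" "g \<in> Lp \<Omega> 2" "is_weak_grad \<Omega> f g"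
  shows "f \<in> H1 \<Omega>" "AE x in M. wgrad \<Omega> f x = g x"
proof -
  show H: "f \<in> H1 \<Omega>" using assms by (auto simp: H1_def)
  show "AE x in M. wgrad \<Omega> f x = g x"
    by (rule weak_grad_unique[OF H1_D(1,2)[OF H] assms(2) H1_D(3)[OF H] assms(3)])
qed

lemma H1_lincomb:
  assumes f: "f \<in> H1 \<Omega>" "g \<in> H1 \<Omega>"
  shows "(\<lambda>x. a * f x + b * g x) \<in> H1 \<Omega>"
    and "AE x in M. wgrad \<Omega> (\<lambda>x. a * f x + b * g x) x = a *\<^sub>R wgrad \<Omega> f x + b *\<^sub>R wgrad \<Omega> g x"
proof -
  note L = H1_D[OF f(1)] H1_D[OF f(2)]
  have 1: "(\<lambda>x. a * f x + b * g x) \<in> Lp \<Omega> 2"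
    using Lp2_add[OF Lp2_scaleR[OF L(1)] Lp2_scaleR[OF L(4)]] by simp
  have 2: "(\<lambda>x. a *\<^sub>R wgrad \<Omega> f x + b *\<^sub>R wgrad \<Omega> g x) \<in> Lp \<Omega> 2"
    by (intro Lp2_add Lp2_scaleR L)
  have 3: "is_weak_grad \<Omega> (\<lambda>x. a * f x + b * g x) (\<lambda>x. a *\<^sub>R wgrad \<Omega> f x + b *\<^sub>R wgrad \<Omega> g x)"
    unfolding is_weak_grad_iff[OF 1 2]
  proof (intro ballI allI)
    fix \<eta> i assume \<eta>: "\<eta> \<in> test_functions \<Omega>"
    have i: "integrable M (\<lambda>x. \<eta> x * h x $ i)" if "h \<in> Lp \<Omega> 2" for h :: vfield
      using Lp2_integrable_inner[OF test_function_Lp2[OF \<eta>] Lp2_component(1)[OF that, of i]]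
      by (simp only: inner_real_def)
    have j: "integrable M (\<lambda>x. h x * grad \<eta> x $ i)" if "h \<in> Lp \<Omega> 2" for h :: design
      using Lp2_integrable_inner[OF that Lp2_component(1)[OF test_function_grad(2)[OF \<eta>], of i]]
      by (simp only: inner_real_def)
    have "(LINT x|M. (a * f x + b * g x) * grad \<eta> x $ i) =
        a * (LINT x|M. f x * grad \<eta> x $ i) + b * (LINT x|M. g x * grad \<eta> x $ i)"
      using j[OF L(1)] j[OF L(4)] by (simp add: distrib_right mult.assoc)
    also have "\<dots> = - (a * (LINT x|M. \<eta> x * wgrad \<Omega> f x $ i) + b * (LINT x|M. \<eta> x * wgrad \<Omega> g x $ i))"
      using L(3,6) \<eta> unfolding is_weak_grad_iff[OF L(1,2)] is_weak_grad_iff[OF L(4,5)] by simp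
    also have "\<dots> = - (LINT x|M. \<eta> x * (a *\<^sub>R wgrad \<Omega> f x + b *\<^sub>R wgrad \<Omega> g x) $ i)"
      using i[OF L(2)] i[OF L(5)] by (simp add: distrib_left mult.left_commute)
    finally show "(LINT x|M. (a * f x + b * g x) * grad \<eta> x $ i) =
        - (LINT x|M. \<eta> x * (a *\<^sub>R wgrad \<Omega> f x + b *\<^sub>R wgrad \<Omega> g x) $ i)" .
  qed
  show "(\<lambda>x. a * f x + b * g x) \<in> H1 \<Omega>"
    "AE x in M. wgrad \<Omega> (\<lambda>x. a * f x + b * g x) x = a *\<^sub>R wgrad \<Omega> f x + b *\<^sub>R wgrad \<Omega> g x"
    using H1_I[OF 1 2 3] by auto
qed

text \<open>A test function extends by zero to the whole plane, where the integral of a partial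
  derivative vanishes.\<close>

lemma integral_partial_test:
  assumes "\<eta> \<in> test_functions \<Omega>"
  shows "(LINT x|M. grad \<eta> x $ i) = 0"
proof -
  let ?d = "\<lambda>x. frechet_derivative \<eta> (at x) (axis i 1)"
  have b: "axis i 1 \<in> (Basis :: (real^2) set)" by simp
  note t = test_function_partial[OF assms b]
  have [measurable]: "?d \<in> borel_measurable borel"
    using test_function_continuous[OF t] by (rule borel_measurable_continuous_onI)
  have "(LINT x|M. grad \<eta> x $ i) = (LINT x|M. ?d x)" by (simp add: grad_def)
  also have "\<dots> = (LINT x|lebesgue. (if x \<in> \<Omega> then ?d x else 0))"
    using Lebesgue_Measure.integral_restrict_UNIV[of \<Omega> ?d] by simp
  also have "(\<lambda>x. if x \<in> \<Omega> then ?d x else 0) = ?d"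
    using test_function_outside[OF t] by auto
  also have "(LINT x|lebesgue. ?d x) = (LINT x|lborel. ?d x)"
    by (rule integral_completion) simp
  also have "\<dots> = 0" by (rule lborel_integral_partial_test[OF assms b])
  finally show ?thesis .
qed

lemma grad_mult:
  assumes "\<eta> \<in> test_functions \<Omega>" "\<zeta> \<in> test_functions \<Omega>"
  shows "grad (\<lambda>x. \<eta> x * \<zeta> x) x = \<eta> x *\<^sub>R grad \<zeta> x + \<zeta> x *\<^sub>R grad \<eta> x"
proof -
  have "frechet_derivative (\<lambda>x. \<eta> x * \<zeta> x) (at x) =
      (\<lambda>h. \<eta> x * frechet_derivative \<zeta> (at x) h + frechet_derivative \<eta> (at x) h * \<zeta> x)"
    by (rule frechet_derivative_at[symmetric])
      (rule has_derivative_mult[OF test_function_has_derivative[OF assms(1)] test_function_has_derivative[OF assms(2)]])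
  then show ?thesis by (simp add: grad_def vec_eq_iff mult.commute)
qed

lemma test_function_mult:
  "\<eta> \<in> test_functions \<Omega> \<Longrightarrow> \<zeta> \<in> test_functions \<Omega> \<Longrightarrow> (\<lambda>x. \<eta> x * \<zeta> x) \<in> test_functions \<Omega>"
  by (rule test_function_mult_smooth) (auto simp: test_functions_def)

lemma test_function_H1:
  assumes "\<eta> \<in> test_functions \<Omega>"
  shows "\<eta> \<in> H1 \<Omega>" "AE x in M. wgrad \<Omega> \<eta> x = grad \<eta> x"
proof -
  note 1 = test_function_Lp2[OF assms] and 2 = test_function_grad(2)[OF assms]
  have "is_weak_grad \<Omega> \<eta> (grad \<eta>)"
    unfolding is_weak_grad_iff[OF 1 2]
  proof (intro ballI allI)
    fix \<zeta> i assume \<zeta>: "\<zeta> \<in> test_functions \<Omega>"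
    have j: "integrable M (\<lambda>x. f x * grad g x $ i)" if "f \<in> test_functions \<Omega>" "g \<in> test_functions \<Omega>" for f g
      using Lp2_integrable_inner[OF test_function_Lp2[OF that(1)] Lp2_component(1)[OF test_function_grad(2)[OF that(2)], of i]]
      by (simp only: inner_real_def)
    \<comment> \<open>Integration by parts: the product of the two test functions is again a test
      function, so the integral of its gradient is zero.\<close>
    have "(LINT x|M. \<eta> x * grad \<zeta> x $ i) + (LINT x|M. \<zeta> x * grad \<eta> x $ i) = (LINT x|M. grad (\<lambda>x. \<eta> x * \<zeta> x) x $ i)"
      using j[OF assms \<zeta>] j[OF \<zeta> assms] by (simp add: grad_mult[OF assms \<zeta>])
    then show "(LINT x|M. \<eta> x * grad \<zeta> x $ i) = - (LINT x|M. \<zeta> x * grad \<eta> x $ i)"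
      using integral_partial_test[OF test_function_mult[OF assms \<zeta>]] by simp
  qed
  from H1_I[OF 1 2 this] show "\<eta> \<in> H1 \<Omega>" "AE x in M. wgrad \<Omega> \<eta> x = grad \<eta> x" by auto
qed

lemma H1_norm_test_diff:
  assumes \<eta>: "\<eta> \<in> test_functions \<Omega>" and f: "f \<in> H1 \<Omega>"
  shows "H1_norm \<Omega> (\<lambda>x. \<eta> x - f x) =
    sqrt ((Lp_norm \<Omega> 2 (\<lambda>x. \<eta> x - f x))\<^sup>2 + (Lp_norm \<Omega> 2 (\<lambda>x. grad \<eta> x - wgrad \<Omega> f x))\<^sup>2)"
proof -
  note t = test_function_H1[OF \<eta>] test_function_grad(2)[OF \<eta>]
  have "(\<lambda>x. \<eta> x - f x) \<in> H1 \<Omega>"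
    and "AE x in M. wgrad \<Omega> (\<lambda>x. \<eta> x - f x) x = wgrad \<Omega> \<eta> x - wgrad \<Omega> f x"
    using H1_lincomb[OF t(1) f, of 1 "-1"] by simp_all
  then have "Lp_norm \<Omega> 2 (wgrad \<Omega> (\<lambda>x. \<eta> x - f x)) = Lp_norm \<Omega> 2 (\<lambda>x. grad \<eta> x - wgrad \<Omega> f x)"
    using t(2) H1_D(2)[OF f] t(3)
    by (intro Lp2_norm_cong_AE H1_D(2)) (auto intro: Lp2_measurable Lp2_diff)
  then show ?thesis by (simp add: H1_norm_def)
qed

text \<open>Replaces the chosen gradient of a difference by the classical gradient of the
  approximant minus \<open>wgrad \<Omega> f\<close>, and splits the H1 norm into its two
  parts.\<close>

lemma H10_iff: "f \<in> H10 \<Omega> \<longleftrightarrow> f \<in> H1 \<Omega> \<and> (\<exists>\<eta>. (\<forall>n. \<eta> n \<in> test_functions \<Omega>) \<and>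
    (\<lambda>n. Lp_norm \<Omega> 2 (\<lambda>x. \<eta> n x - f x)) \<longlonglongrightarrow> 0 \<and>
    (\<lambda>n. Lp_norm \<Omega> 2 (\<lambda>x. grad (\<eta> n) x - wgrad \<Omega> f x)) \<longlonglongrightarrow> 0)"
proof (cases "f \<in> H1 \<Omega>")
  case True
  have *: "(\<lambda>n. H1_norm \<Omega> (\<lambda>x. \<eta> n x - f x)) \<longlonglongrightarrow> 0 \<longleftrightarrow>
      (\<lambda>n. Lp_norm \<Omega> 2 (\<lambda>x. \<eta> n x - f x)) \<longlonglongrightarrow> 0 \<and>
      (\<lambda>n. Lp_norm \<Omega> 2 (\<lambda>x. grad (\<eta> n) x - wgrad \<Omega> f x)) \<longlonglongrightarrow> 0"
    if \<eta>: "\<forall>n. \<eta> n \<in> test_functions \<Omega>" for \<eta> :: "nat \<Rightarrow> design"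
  proof -
    define p where "p = (\<lambda>n. Lp_norm \<Omega> 2 (\<lambda>x. \<eta> n x - f x))"
    define q where "q = (\<lambda>n. Lp_norm \<Omega> 2 (\<lambda>x. grad (\<eta> n) x - wgrad \<Omega> f x))"
    have pq: "p n \<ge> 0" "q n \<ge> 0" for n by (auto simp: p_def q_def)
    have eq: "H1_norm \<Omega> (\<lambda>x. \<eta> n x - f x) = sqrt ((p n)\<^sup>2 + (q n)\<^sup>2)" for n
      using H1_norm_test_diff[OF _ True] \<eta> by (simp add: p_def q_def)
    have "(\<lambda>n. sqrt ((p n)\<^sup>2 + (q n)\<^sup>2)) \<longlonglongrightarrow> 0 \<longleftrightarrow> p \<longlonglongrightarrow> 0 \<and> q \<longlonglongrightarrow> 0"
    proof
      assume l: "(\<lambda>n. sqrt ((p n)\<^sup>2 + (q n)\<^sup>2)) \<longlonglongrightarrow> 0"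
      have "p n \<le> sqrt ((p n)\<^sup>2 + (q n)\<^sup>2)" "q n \<le> sqrt ((p n)\<^sup>2 + (q n)\<^sup>2)" for n
        using real_sqrt_sum_squares_ge1[of "p n" "q n"] real_sqrt_sum_squares_ge2[of "q n" "p n"] by auto
      then show "p \<longlonglongrightarrow> 0 \<and> q \<longlonglongrightarrow> 0"
        using pq by (auto intro!: tendsto_sandwich[OF _ _ tendsto_const l])
    next
      assume "p \<longlonglongrightarrow> 0 \<and> q \<longlonglongrightarrow> 0"
      then have "(\<lambda>n. sqrt ((p n)\<^sup>2 + (q n)\<^sup>2)) \<longlonglongrightarrow> sqrt (0\<^sup>2 + 0\<^sup>2)"
        by (intro tendsto_intros) auto
      then show "(\<lambda>n. sqrt ((p n)\<^sup>2 + (q n)\<^sup>2)) \<longlonglongrightarrow> 0" by simp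
    qed
    then show ?thesis unfolding eq by (simp add: p_def q_def)
  qed
  show ?thesis using True * by (auto simp: H10_def)
qed (simp add: H10_def)

lemma test_function_H10: "\<eta> \<in> test_functions \<Omega> \<Longrightarrow> \<eta> \<in> H10 \<Omega>"
proof -
  assume \<eta>: "\<eta> \<in> test_functions \<Omega>"
  note t = test_function_H1[OF \<eta>] test_function_grad(2)[OF \<eta>]
  have "Lp_norm \<Omega> 2 (\<lambda>x. grad \<eta> x - wgrad \<Omega> \<eta> x) = Lp_norm \<Omega> 2 (\<lambda>x. 0 :: real^2)"
    using t H1_D(2)[OF t(1)] by (intro Lp2_norm_cong_AE) (auto intro: Lp2_diff)
  then show "\<eta> \<in> H10 \<Omega>"
    unfolding H10_iff using \<eta> t(1) by (auto intro!: exI[of _ "\<lambda>n. \<eta>"] simp: Lp_norm_2)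
qed

lemma H10_H1: "f \<in> H10 \<Omega> \<Longrightarrow> f \<in> H1 \<Omega>"
  by (simp add: H10_def)

lemma grad_lincomb:
  assumes "\<eta> \<in> test_functions \<Omega>" "\<zeta> \<in> test_functions \<Omega>"
  shows "grad (\<lambda>x. a * \<eta> x + b * \<zeta> x) x = a *\<^sub>R grad \<eta> x + b *\<^sub>R grad \<zeta> x"
proof -
  have "frechet_derivative (\<lambda>x. a * \<eta> x + b * \<zeta> x) (at x) =
      (\<lambda>h. a * frechet_derivative \<eta> (at x) h + b * frechet_derivative \<zeta> (at x) h)"
    by (rule frechet_derivative_at[symmetric])
      (intro has_derivative_add has_derivative_mult_right test_function_has_derivative[OF assms(1)]
        test_function_has_derivative[OF assms(2)])
  then show ?thesis by (simp add: grad_def vec_eq_iff)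
qed

lemma Lp2_norm_lincomb_tendsto_0:
  fixes p q :: "nat \<Rightarrow> real^2 \<Rightarrow> 'b::euclidean_space"
  assumes "\<And>n. p n \<in> Lp \<Omega> 2" "\<And>n. q n \<in> Lp \<Omega> 2"
    and "(\<lambda>n. Lp_norm \<Omega> 2 (p n)) \<longlonglongrightarrow> 0" "(\<lambda>n. Lp_norm \<Omega> 2 (q n)) \<longlonglongrightarrow> 0"
  shows "(\<lambda>n. Lp_norm \<Omega> 2 (\<lambda>x. a *\<^sub>R p n x + b *\<^sub>R q n x)) \<longlonglongrightarrow> 0"
proof (rule tendsto_sandwich[OF _ _ tendsto_const])
  have "Lp_norm \<Omega> 2 (\<lambda>x. a *\<^sub>R p n x + b *\<^sub>R q n x) \<le> \<bar>a\<bar> * Lp_norm \<Omega> 2 (p n) + \<bar>b\<bar> * Lp_norm \<Omega> 2 (q n)" for n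
    using Lp2_triangle[OF Lp2_scaleR[OF assms(1)] Lp2_scaleR[OF assms(2)]] by (simp add: Lp2_norm_scaleR)
  then show "\<forall>\<^sub>F n in sequentially. Lp_norm \<Omega> 2 (\<lambda>x. a *\<^sub>R p n x + b *\<^sub>R q n x)
      \<le> \<bar>a\<bar> * Lp_norm \<Omega> 2 (p n) + \<bar>b\<bar> * Lp_norm \<Omega> 2 (q n)" by simp
  have "(\<lambda>n. \<bar>a\<bar> * Lp_norm \<Omega> 2 (p n) + \<bar>b\<bar> * Lp_norm \<Omega> 2 (q n)) \<longlonglongrightarrow> \<bar>a\<bar> * 0 + \<bar>b\<bar> * 0"
    by (intro tendsto_intros assms)
  then show "(\<lambda>n. \<bar>a\<bar> * Lp_norm \<Omega> 2 (p n) + \<bar>b\<bar> * Lp_norm \<Omega> 2 (q n)) \<longlonglongrightarrow> 0" by simp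
qed simp

lemma H10_lincomb:
  assumes "f \<in> H10 \<Omega>" "g \<in> H10 \<Omega>"
  shows "(\<lambda>x. a * f x + b * g x) \<in> H10 \<Omega>"
proof -
  have fg: "f \<in> H1 \<Omega>" "g \<in> H1 \<Omega>" using assms by (auto simp: H10_H1)
  obtain \<eta> where \<eta>: "\<And>n. \<eta> n \<in> test_functions \<Omega>"
    "(\<lambda>n. Lp_norm \<Omega> 2 (\<lambda>x. \<eta> n x - f x)) \<longlonglongrightarrow> 0"
    "(\<lambda>n. Lp_norm \<Omega> 2 (\<lambda>x. grad (\<eta> n) x - wgrad \<Omega> f x)) \<longlonglongrightarrow> 0"
    using assms(1) unfolding H10_iff by blast
  obtain \<zeta> where \<zeta>: "\<And>n. \<zeta> n \<in> test_functions \<Omega>"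
    "(\<lambda>n. Lp_norm \<Omega> 2 (\<lambda>x. \<zeta> n x - g x)) \<longlonglongrightarrow> 0"
    "(\<lambda>n. Lp_norm \<Omega> 2 (\<lambda>x. grad (\<zeta> n) x - wgrad \<Omega> g x)) \<longlonglongrightarrow> 0"
    using assms(2) unfolding H10_iff by blast
  let ?\<theta> = "\<lambda>n x. a * \<eta> n x + b * \<zeta> n x"
  have t: "?\<theta> n \<in> test_functions \<Omega>" for n
    by (rule test_function_lincomb[OF \<eta>(1) \<zeta>(1)])
  have "(\<lambda>n. Lp_norm \<Omega> 2 (\<lambda>x. a *\<^sub>R (\<eta> n x - f x) + b *\<^sub>R (\<zeta> n x - g x))) \<longlonglongrightarrow> 0"
    by (intro Lp2_norm_lincomb_tendsto_0 \<eta>(2) \<zeta>(2) Lp2_diff test_function_Lp2 \<eta>(1) \<zeta>(1) H1_D fg)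
  then have 1: "(\<lambda>n. Lp_norm \<Omega> 2 (\<lambda>x. ?\<theta> n x - (a * f x + b * g x))) \<longlonglongrightarrow> 0"
    by (simp add: algebra_simps)
  have "(\<lambda>n. Lp_norm \<Omega> 2 (\<lambda>x. a *\<^sub>R (grad (\<eta> n) x - wgrad \<Omega> f x) + b *\<^sub>R (grad (\<zeta> n) x - wgrad \<Omega> g x))) \<longlonglongrightarrow> 0"
    by (intro Lp2_norm_lincomb_tendsto_0 \<eta>(3) \<zeta>(3) Lp2_diff test_function_grad(2) \<eta>(1) \<zeta>(1) H1_D fg)
  moreover have "Lp_norm \<Omega> 2 (\<lambda>x. a *\<^sub>R (grad (\<eta> n) x - wgrad \<Omega> f x) + b *\<^sub>R (grad (\<zeta> n) x - wgrad \<Omega> g x))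
      = Lp_norm \<Omega> 2 (\<lambda>x. grad (?\<theta> n) x - wgrad \<Omega> (\<lambda>x. a * f x + b * g x) x)" for n
  proof (rule Lp2_norm_cong_AE)
    show "AE x in M. a *\<^sub>R (grad (\<eta> n) x - wgrad \<Omega> f x) + b *\<^sub>R (grad (\<zeta> n) x - wgrad \<Omega> g x)
       = grad (?\<theta> n) x - wgrad \<Omega> (\<lambda>x. a * f x + b * g x) x"
      using H1_lincomb(2)[OF fg, of a b]
      by eventually_elim (simp add: grad_lincomb[OF \<eta>(1) \<zeta>(1)] algebra_simps)
  qed (intro Lp2_measurable Lp2_add Lp2_scaleR Lp2_diff test_function_grad(2) \<eta>(1) \<zeta>(1) H1_D fg t
      H1_lincomb(1)[OF fg])+
  ultimately show ?thesis
    unfolding H10_iff using t 1 H1_lincomb(1)[OF fg, of a b] by (intro conjI exI[of _ ?\<theta>]) simp_all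
qed

section \<open>Vector fields and divergence-free fields\<close>

lemma H10_vec_D:
  assumes "v \<in> H10_vec \<Omega>"
  shows "(\<lambda>x. v x $ i) \<in> H10 \<Omega>" "v \<in> Lp \<Omega> 2" "wjac \<Omega> v \<in> Lp \<Omega> 2"
proof -
  show *: "(\<lambda>x. v x $ i) \<in> H10 \<Omega>" for i using assms by (simp add: H10_vec_def)
  show "v \<in> Lp \<Omega> 2" "wjac \<Omega> v \<in> Lp \<Omega> 2"
    using H1_D[OF H10_H1[OF *]] by (auto simp: Lp2_vec_iff[of v] Lp2_vec_iff[of "wjac \<Omega> v"] wjac_def)
qed

lemma H10_vec_lincomb:
  assumes u: "u \<in> H10_vec \<Omega>" "v \<in> H10_vec \<Omega>"
  shows "(\<lambda>x. a *\<^sub>R u x + b *\<^sub>R v x) \<in> H10_vec \<Omega>"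
    and "AE x in M. wjac \<Omega> (\<lambda>x. a *\<^sub>R u x + b *\<^sub>R v x) x = a *\<^sub>R wjac \<Omega> u x + b *\<^sub>R wjac \<Omega> v x"
proof -
  show "(\<lambda>x. a *\<^sub>R u x + b *\<^sub>R v x) \<in> H10_vec \<Omega>"
    using H10_lincomb H10_vec_D(1)[OF u(1)] H10_vec_D(1)[OF u(2)] by (simp add: H10_vec_def)
  have "AE x in M. \<forall>i. wjac \<Omega> (\<lambda>x. a *\<^sub>R u x + b *\<^sub>R v x) x $ i = (a *\<^sub>R wjac \<Omega> u x + b *\<^sub>R wjac \<Omega> v x) $ i"
    using H1_lincomb(2)[where a = a and b = b, OF H10_H1[OF H10_vec_D(1)[OF u(1)]] H10_H1[OF H10_vec_D(1)[OF u(2)]]]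
    by (subst AE_all_countable) (auto simp: wjac_def)
  then show "AE x in M. wjac \<Omega> (\<lambda>x. a *\<^sub>R u x + b *\<^sub>R v x) x = a *\<^sub>R wjac \<Omega> u x + b *\<^sub>R wjac \<Omega> v x"
    by eventually_elim (simp add: vec_eq_iff)
qed

lemma V_D:
  assumes "v \<in> V \<Omega>"
  shows "v \<in> H10_vec \<Omega>" "v \<in> Lp \<Omega> 2" "wjac \<Omega> v \<in> Lp \<Omega> 2" "AE x in M. trace (wjac \<Omega> v x) = 0"
  using assms H10_vec_D[of v] by (auto simp: V_def)

lemma V_lincomb:
  assumes u: "u \<in> V \<Omega>" "v \<in> V \<Omega>"
  shows "(\<lambda>x. a *\<^sub>R u x + b *\<^sub>R v x) \<in> V \<Omega>"
proof -
  note H = V_D(1)[OF u(1)] V_D(1)[OF u(2)]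
  have "AE x in M. trace (wjac \<Omega> (\<lambda>x. a *\<^sub>R u x + b *\<^sub>R v x) x) = 0"
    using V_D(4)[OF u(1)] V_D(4)[OF u(2)] H10_vec_lincomb(2)[OF H, of a b]
  proof eventually_elim
    case (elim x)
    have "trace (a *\<^sub>R wjac \<Omega> u x + b *\<^sub>R wjac \<Omega> v x) = a * trace (wjac \<Omega> u x) + b * trace (wjac \<Omega> v x)"
      by (simp add: trace_def sum.distrib sum_distrib_left)
    then show ?case using elim by simp
  qed
  then show ?thesis using H10_vec_lincomb(1)[OF H] by (simp add: V_def)
qed

lemma V_diff: "u \<in> V \<Omega> \<Longrightarrow> v \<in> V \<Omega> \<Longrightarrow> (\<lambda>x. u x - v x) \<in> V \<Omega>"
  using V_lincomb[of u v 1 "-1"] by simp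

lemma H10_vec_diff:
  assumes "u \<in> H10_vec \<Omega>" "v \<in> H10_vec \<Omega>"
  shows "(\<lambda>x. u x - v x) \<in> H10_vec \<Omega>"
    "AE x in M. wjac \<Omega> (\<lambda>x. u x - v x) x = wjac \<Omega> u x - wjac \<Omega> v x"
  using H10_vec_lincomb[OF assms, of 1 "-1"] by simp_all

text \<open>\<open>wjac\<close> is linear only up to null sets, which the norm does not see.\<close>

lemma V_norm_diff_eq:
  assumes u: "u \<in> H10_vec \<Omega>" "v \<in> H10_vec \<Omega>"
  shows "V_norm \<Omega> (\<lambda>x. u x - v x) = Lp_norm \<Omega> 2 (\<lambda>x. wjac \<Omega> u x - wjac \<Omega> v x)"
  unfolding V_norm_def
  using H10_vec_diff[OF u] H10_vec_D(3)[OF u(1)] H10_vec_D(3)[OF u(2)]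
  by (intro Lp2_norm_cong_AE H10_vec_D(3)) (auto intro: Lp2_diff Lp2_measurable)

lemma V_norm_nonneg [simp]: "0 \<le> V_norm \<Omega> v"
  by (simp add: V_norm_def)

end

subsection \<open>Convection and stationary states\<close>

text \<open>The norm on matrices is the Frobenius norm, which dominates the operator norm by
  Cauchy-Schwarz in each row.\<close>

lemma norm_matrix_vector_mult_inner_le:
  fixes A :: "real^'n^'m"
  shows "\<bar>(A *v a) \<bullet> c\<bar> \<le> norm A * norm a * norm c"
proof -
  have "norm (A *v a) \<le> L2_set (\<lambda>i. norm (A $ i) * norm a) UNIV"
    unfolding norm_vec_def[of "A *v a"]
    by (rule L2_set_mono) (simp_all add: matrix_vector_mul_component Cauchy_Schwarz_ineq2)
  also have "\<dots> = norm A * norm a"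
    by (simp add: norm_vec_def[of A] L2_set_left_distrib)
  finally have "norm (A *v a) * norm c \<le> norm A * norm a * norm c"
    by (rule mult_right_mono) simp
  then show ?thesis
    using Cauchy_Schwarz_ineq2[of "A *v a" c] by linarith
qed

locale navier_stokes = planar_domain \<Omega> for \<Omega> +
  fixes \<mu> cP cL :: real and fs :: vfield
  assumes \<mu>_pos: "\<mu> > 0"
    and cP_pos: "cP > 0" and cP: "\<And>v. v \<in> H10_vec \<Omega> \<Longrightarrow> Lp_norm \<Omega> 2 v \<le> cP * V_norm \<Omega> v"
    and cL_pos: "cL > 0" and H10_vec_Lp4: "\<And>v. v \<in> H10_vec \<Omega> \<Longrightarrow> v \<in> Lp \<Omega> 4"
    and cL: "\<And>v. v \<in> H10_vec \<Omega> \<Longrightarrow>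
       Lp_norm \<Omega> 4 v \<le> sqrt cL * sqrt (Lp_norm \<Omega> 2 v) * sqrt (V_norm \<Omega> v)"
    and fs: "fs \<in> Lp \<Omega> 2"
    and small: "2 * cP\<^sup>2 * cL * Lp_norm \<Omega> 2 fs < \<mu>\<^sup>2"
begin

text \<open>Ladyzhenskaya's inequality with its L2 factor estimated by Poincare's; this is the
  origin of every factor \<open>sqrt (cL * cP)\<close> below.\<close>

lemma Lp4_norm_le:
  assumes "v \<in> H10_vec \<Omega>"
  shows "Lp_norm \<Omega> 4 v \<le> sqrt (cL * cP) * V_norm \<Omega> v"
proof -
  have "Lp_norm \<Omega> 4 v \<le> sqrt cL * sqrt (Lp_norm \<Omega> 2 v) * sqrt (V_norm \<Omega> v)"
    by (rule cL[OF assms])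
  also have "\<dots> \<le> sqrt cL * sqrt (cP * V_norm \<Omega> v) * sqrt (V_norm \<Omega> v)"
    using cL_pos cP_pos cP[OF assms] by (intro mult_mono order_refl mult_nonneg_nonneg) auto
  also have "\<dots> = sqrt (cL * cP) * V_norm \<Omega> v"
    by (simp add: real_sqrt_mult)
  finally show ?thesis .
qed

lemma convection_measurable:
  assumes "u \<in> H10_vec \<Omega>" "v \<in> H10_vec \<Omega>" "w \<in> H10_vec \<Omega>"
  shows "(\<lambda>x. (wjac \<Omega> v x *v u x) \<bullet> w x) \<in> borel_measurable M"
proof -
  note [measurable] = Lp2_measurable[OF H10_vec_D(2)[OF assms(1)]] Lp2_measurable[OF H10_vec_D(2)[OF assms(3)]]
    Lp2_measurable[OF H10_vec_D(3)[OF assms(2)]]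
  have "(\<lambda>x. (wjac \<Omega> v x *v u x) \<bullet> w x) = (\<lambda>x. \<Sum>i\<in>UNIV. (wjac \<Omega> v x $ i \<bullet> u x) * w x $ i)"
    by (simp add: inner_vec_def[of "wjac \<Omega> v _ *v u _"] matrix_vector_mul_component)
  then show ?thesis by simp
qed

lemma b_form_bound:
  assumes "u \<in> H10_vec \<Omega>" "v \<in> H10_vec \<Omega>" "w \<in> H10_vec \<Omega>"
  shows "integrable M (\<lambda>x. (wjac \<Omega> v x *v u x) \<bullet> w x)"
    and "\<bar>b_form \<Omega> u v w\<bar> \<le> V_norm \<Omega> v * Lp_norm \<Omega> 4 u * Lp_norm \<Omega> 4 w"
  using integrable_Lp2_Lp4_Lp4[OF H10_vec_D(3)[OF assms(2)] H10_vec_Lp4[OF assms(1)] H10_vec_Lp4[OF assms(3)]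
      convection_measurable[OF assms]] norm_matrix_vector_mult_inner_le
  by (auto simp: b_form_def V_norm_def)

lemma b_form_diff:
  assumes u: "u \<in> H10_vec \<Omega>" and v: "v \<in> H10_vec \<Omega>" and w: "w \<in> H10_vec \<Omega>" and y: "y \<in> H10_vec \<Omega>"
  shows "b_form \<Omega> (\<lambda>x. u x - y x) v w = b_form \<Omega> u v w - b_form \<Omega> y v w"
    and "b_form \<Omega> u (\<lambda>x. v x - y x) w = b_form \<Omega> u v w - b_form \<Omega> u y w"
    and "b_form \<Omega> u v (\<lambda>x. w x - y x) = b_form \<Omega> u v w - b_form \<Omega> u v y"
proof -
  show "b_form \<Omega> (\<lambda>x. u x - y x) v w = b_form \<Omega> u v w - b_form \<Omega> y v w"
    using b_form_bound(1)[OF u v w] b_form_bound(1)[OF y v w]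
    by (simp add: b_form_def matrix_vector_mult_diff_distrib inner_diff_left)
  show "b_form \<Omega> u v (\<lambda>x. w x - y x) = b_form \<Omega> u v w - b_form \<Omega> u v y"
    using b_form_bound(1)[OF u v w] b_form_bound(1)[OF u v y]
    by (simp add: b_form_def inner_diff_right)
  have "b_form \<Omega> u (\<lambda>x. v x - y x) w =
      (LINT x|M. (wjac \<Omega> v x *v u x) \<bullet> w x - (wjac \<Omega> y x *v u x) \<bullet> w x)"
    unfolding b_form_def
  proof (rule integral_cong_AE)
    show "AE x in M. (wjac \<Omega> (\<lambda>x. v x - y x) x *v u x) \<bullet> w x =
        (wjac \<Omega> v x *v u x) \<bullet> w x - (wjac \<Omega> y x *v u x) \<bullet> w x"
      using H10_vec_diff(2)[OF v y]
      by eventually_elim (simp add: matrix_vector_mult_diff_rdistrib inner_diff_left)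
  qed (auto intro!: convection_measurable borel_measurable_diff u v w y H10_vec_diff)
  then show "b_form \<Omega> u (\<lambda>x. v x - y x) w = b_form \<Omega> u v w - b_form \<Omega> u y w"
    using b_form_bound(1)[OF u v w] b_form_bound(1)[OF u y w] by (simp add: b_form_def)
qed

text \<open>Adding the weak derivative identities of the components moves the gradient onto u as its
  divergence, the trace of \<open>wjac \<Omega> u\<close>, which is zero almost everywhere.\<close>

lemma V_orthogonal_grad:
  assumes u: "u \<in> V \<Omega>" and \<eta>: "\<eta> \<in> test_functions \<Omega>"
  shows "(LINT x|M. u x \<bullet> grad \<eta> x) = 0"
proof -
  note uH = H10_H1[OF H10_vec_D(1)[OF V_D(1)[OF u]]]
  have int: "integrable M (\<lambda>x. u x $ i * grad \<eta> x $ i)" for i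
    using Lp2_integrable_inner[OF Lp2_component(1)[OF V_D(2)[OF u], of i] Lp2_component(1)[OF test_function_grad(2)[OF \<eta>], of i]]
    by (simp only: inner_real_def)
  have int': "integrable M (\<lambda>x. \<eta> x * wgrad \<Omega> (\<lambda>x. u x $ i) x $ i)" for i
    using Lp2_integrable_inner[OF test_function_Lp2[OF \<eta>] Lp2_component(1)[OF H1_D(2)[OF uH[of i]], of i]]
    by (simp only: inner_real_def)
  have "(LINT x|M. u x \<bullet> grad \<eta> x) = (\<Sum>i\<in>UNIV. LINT x|M. u x $ i * grad \<eta> x $ i)"
    using int by (simp add: inner_vec_def)
  also have "\<dots> = (\<Sum>i\<in>UNIV. - (LINT x|M. \<eta> x * wgrad \<Omega> (\<lambda>x. u x $ i) x $ i))"
    using H1_D(3)[OF uH] \<eta> by (intro sum.cong refl) (simp add: is_weak_grad_iff[OF H1_D(1,2)[OF uH]])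
  also have "\<dots> = - (LINT x|M. (\<Sum>i\<in>UNIV. \<eta> x * wgrad \<Omega> (\<lambda>x. u x $ i) x $ i))"
    using int' by (simp add: sum_negf)
  also have "(LINT x|M. (\<Sum>i\<in>UNIV. \<eta> x * wgrad \<Omega> (\<lambda>x. u x $ i) x $ i)) = (LINT x|M. 0)"
  proof (rule integral_cong_AE)
    show "AE x in M. (\<Sum>i\<in>UNIV. \<eta> x * wgrad \<Omega> (\<lambda>x. u x $ i) x $ i) = 0"
      using V_D(4)[OF u] by eventually_elim (simp add: trace_def wjac_def flip: sum_distrib_left)
  qed (use int' in auto)
  finally show ?thesis by simp
qed

lemma test_vector_H10_vec:
  "(\<And>i. \<zeta> i \<in> test_functions \<Omega>) \<Longrightarrow> (\<lambda>x. \<chi> i. \<zeta> i x) \<in> H10_vec \<Omega>"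
  by (simp add: H10_vec_def test_function_H10)

text \<open>For smooth fields the integrand is half of u applied to the gradient of the squared
  length of the field, so orthogonality of u to gradients applies to each squared component.\<close>

lemma b_form_test_zero:
  assumes u: "u \<in> V \<Omega>" and \<zeta>: "\<And>i. \<zeta> i \<in> test_functions \<Omega>"
  shows "b_form \<Omega> u (\<lambda>x. \<chi> i. \<zeta> i x) (\<lambda>x. \<chi> i. \<zeta> i x) = 0"
proof -
  let ?z = "\<lambda>x. \<chi> i. \<zeta> i x"
  note z = test_vector_H10_vec[OF \<zeta>]
  note sq = test_function_mult[OF \<zeta> \<zeta>]
  have int: "integrable M (\<lambda>x. u x \<bullet> grad (\<lambda>x. \<zeta> i x * \<zeta> i x) x)" for i
    by (rule Lp2_integrable_inner[OF V_D(2)[OF u] test_function_grad(2)[OF sq]])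
  have "b_form \<Omega> u ?z ?z = (LINT x|M. (\<Sum>i\<in>UNIV. (u x \<bullet> grad (\<lambda>x. \<zeta> i x * \<zeta> i x) x) / 2))"
    unfolding b_form_def
  proof (rule integral_cong_AE)
    have "AE x in M. \<forall>i. wgrad \<Omega> (\<zeta> i) x = grad (\<zeta> i) x"
      by (subst AE_all_countable) (auto intro: test_function_H1(2) \<zeta>)
    then show "AE x in M. (wjac \<Omega> ?z x *v u x) \<bullet> ?z x = (\<Sum>i\<in>UNIV. (u x \<bullet> grad (\<lambda>x. \<zeta> i x * \<zeta> i x) x) / 2)"
    proof eventually_elim
      case (elim x)
      have inner_sum: "p \<bullet> q = (\<Sum>i\<in>UNIV. p $ i * q $ i)" for p q :: "real^2"
        by (simp add: inner_vec_def)
      have "(wjac \<Omega> ?z x *v u x) \<bullet> ?z x = (\<Sum>i\<in>UNIV. (grad (\<zeta> i) x \<bullet> u x) * \<zeta> i x)"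
        by (subst inner_sum) (simp add: matrix_vector_mul_component wjac_def elim)
      also have "\<dots> = (\<Sum>i\<in>UNIV. (u x \<bullet> grad (\<lambda>x. \<zeta> i x * \<zeta> i x) x) / 2)"
        by (intro sum.cong refl, simp only: grad_mult[OF \<zeta> \<zeta>] inner_add_right inner_scaleR_right)
          (simp add: inner_commute mult.commute)
      finally show ?case .
    qed
  qed (use int in \<open>auto intro!: convection_measurable V_D(1)[OF u] z\<close>)
  also have "\<dots> = (\<Sum>i\<in>UNIV. (LINT x|M. u x \<bullet> grad (\<lambda>x. \<zeta> i x * \<zeta> i x) x) / 2)"
    using int by simp
  also have "\<dots> = 0" by (simp add: V_orthogonal_grad[OF u sq])
  finally show ?thesis .
qed

text \<open>The approximating fields need not be divergence free; in the antisymmetry of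
  \<open>b_form\<close> only the transporting field has to be.\<close>

lemma H10_vec_approx:
  assumes z: "z \<in> H10_vec \<Omega>"
  obtains \<zeta> where "\<And>i n. \<zeta> i n \<in> test_functions \<Omega>"
    "(\<lambda>n. V_norm \<Omega> (\<lambda>x. (\<chi> i. \<zeta> i n x) - z x)) \<longlonglongrightarrow> 0"
proof -
  note H = H10_vec_D(1)[OF z]
  have "\<forall>i. \<exists>\<eta>. (\<forall>n. \<eta> n \<in> test_functions \<Omega>) \<and>
      (\<lambda>n. Lp_norm \<Omega> 2 (\<lambda>x. grad (\<eta> n) x - wgrad \<Omega> (\<lambda>x. z x $ i) x)) \<longlonglongrightarrow> 0"
  proof
    fix i
    obtain \<eta> where "(\<forall>n. \<eta> n \<in> test_functions \<Omega>) \<and>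
        (\<lambda>n. Lp_norm \<Omega> 2 (\<lambda>x. \<eta> n x - z x $ i)) \<longlonglongrightarrow> 0 \<and>
        (\<lambda>n. Lp_norm \<Omega> 2 (\<lambda>x. grad (\<eta> n) x - wgrad \<Omega> (\<lambda>x. z x $ i) x)) \<longlonglongrightarrow> 0"
      using H[of i, unfolded H10_iff, THEN conjunct2] by (rule exE)
    then show "\<exists>\<eta>. (\<forall>n. \<eta> n \<in> test_functions \<Omega>) \<and>
        (\<lambda>n. Lp_norm \<Omega> 2 (\<lambda>x. grad (\<eta> n) x - wgrad \<Omega> (\<lambda>x. z x $ i) x)) \<longlonglongrightarrow> 0"
      by (intro exI[of _ \<eta>]) simp
  qed
  then obtain \<zeta> where "\<forall>i. (\<forall>n. \<zeta> i n \<in> test_functions \<Omega>) \<and>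
      (\<lambda>n. Lp_norm \<Omega> 2 (\<lambda>x. grad (\<zeta> i n) x - wgrad \<Omega> (\<lambda>x. z x $ i) x)) \<longlonglongrightarrow> 0"
    by (rule exE[OF choice])
  then have \<zeta>: "\<And>i n. \<zeta> i n \<in> test_functions \<Omega>"
    "\<And>i. (\<lambda>n. Lp_norm \<Omega> 2 (\<lambda>x. grad (\<zeta> i n) x - wgrad \<Omega> (\<lambda>x. z x $ i) x)) \<longlonglongrightarrow> 0"
    by simp_all
  let ?z = "\<lambda>n x. \<chi> i. \<zeta> i n x"
  have zH: "?z n \<in> H10_vec \<Omega>" for n by (rule test_vector_H10_vec[OF \<zeta>(1)])
  have "(V_norm \<Omega> (\<lambda>x. ?z n x - z x))\<^sup>2 =
      (\<Sum>i\<in>UNIV. (Lp_norm \<Omega> 2 (\<lambda>x. grad (\<zeta> i n) x - wgrad \<Omega> (\<lambda>x. z x $ i) x))\<^sup>2)" for n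
  proof -
    have 1: "(V_norm \<Omega> (\<lambda>x. ?z n x - z x))\<^sup>2 =
        (\<Sum>i\<in>UNIV. (Lp_norm \<Omega> 2 (\<lambda>x. (wjac \<Omega> (?z n) x - wjac \<Omega> z x) $ i))\<^sup>2)"
      unfolding V_norm_diff_eq[OF zH z]
      by (rule Lp2_norm_vec_square) (intro Lp2_diff H10_vec_D(3) zH z)
    have 2: "Lp_norm \<Omega> 2 (\<lambda>x. (wjac \<Omega> (?z n) x - wjac \<Omega> z x) $ i) =
        Lp_norm \<Omega> 2 (\<lambda>x. grad (\<zeta> i n) x - wgrad \<Omega> (\<lambda>x. z x $ i) x)" for i
    proof (rule Lp2_norm_cong_AE)
      show "(\<lambda>x. (wjac \<Omega> (?z n) x - wjac \<Omega> z x) $ i) \<in> Lp \<Omega> 2"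
        by (intro Lp2_component(1) Lp2_diff H10_vec_D(3) zH z)
      show "AE x in M. (wjac \<Omega> (?z n) x - wjac \<Omega> z x) $ i = grad (\<zeta> i n) x - wgrad \<Omega> (\<lambda>x. z x $ i) x"
        using test_function_H1(2)[OF \<zeta>(1)] by eventually_elim (simp add: wjac_def)
    qed (intro Lp2_measurable Lp2_diff test_function_grad(2) \<zeta>(1) H1_D(2) H10_H1 H)
    show ?thesis unfolding 1 2 ..
  qed
  moreover have "(\<lambda>n. \<Sum>i\<in>UNIV. (Lp_norm \<Omega> 2 (\<lambda>x. grad (\<zeta> i n) x - wgrad \<Omega> (\<lambda>x. z x $ i) x))\<^sup>2)
      \<longlonglongrightarrow> (\<Sum>i\<in>(UNIV :: 2 set). 0\<^sup>2)"
    by (intro tendsto_intros \<zeta>(2))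
  ultimately have "(\<lambda>n. (V_norm \<Omega> (\<lambda>x. ?z n x - z x))\<^sup>2) \<longlonglongrightarrow> 0" by simp
  from tendsto_real_sqrt[OF this] have "(\<lambda>n. V_norm \<Omega> (\<lambda>x. ?z n x - z x)) \<longlonglongrightarrow> 0" by simp
  with \<zeta>(1) show ?thesis by (rule that)
qed

lemma V_norm_triangle:
  assumes "u \<in> H10_vec \<Omega>" "v \<in> H10_vec \<Omega>"
  shows "V_norm \<Omega> u \<le> V_norm \<Omega> (\<lambda>x. u x - v x) + V_norm \<Omega> v"
    and "V_norm \<Omega> (\<lambda>x. u x - v x) \<le> V_norm \<Omega> u + V_norm \<Omega> v"
  using Lp2_triangle[OF Lp2_diff[OF H10_vec_D(3)[OF assms(1)] H10_vec_D(3)[OF assms(2)]] H10_vec_D(3)[OF assms(2)]]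
    Lp2_triangle_diff[OF H10_vec_D(3)[OF assms(1)] H10_vec_D(3)[OF assms(2)]]
  unfolding V_norm_diff_eq[OF assms] by (simp_all add: V_norm_def)

text \<open>Density: with test fields y close to z, b(u,y,y) = 0 leaves two terms containing y - z,
  and both vanish in the limit by the bound of \<open>b_form\<close>.\<close>

lemma b_form_antisym:
  assumes u: "u \<in> V \<Omega>" and z: "z \<in> H10_vec \<Omega>"
  shows "b_form \<Omega> u z z = 0"
proof -
  note uH = V_D(1)[OF u]
  obtain \<zeta> where \<zeta>: "\<And>i n. \<zeta> i n \<in> test_functions \<Omega>"
    "(\<lambda>n. V_norm \<Omega> (\<lambda>x. (\<chi> i. \<zeta> i n x) - z x)) \<longlonglongrightarrow> 0"
    using H10_vec_approx[OF z] by blast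
  define y where "y = (\<lambda>n x. (\<chi> i. \<zeta> i n x) :: real^2)"
  define d where "d n = V_norm \<Omega> (\<lambda>x. y n x - z x)" for n
  have yH: "y n \<in> H10_vec \<Omega>" for n unfolding y_def by (rule test_vector_H10_vec[OF \<zeta>(1)])
  have eH: "(\<lambda>x. y n x - z x) \<in> H10_vec \<Omega>" for n by (rule H10_vec_diff(1)[OF yH z])
  have d: "d \<longlonglongrightarrow> 0" using \<zeta>(2) by (simp add: d_def[abs_def] y_def)
  let ?C = "Lp_norm \<Omega> 4 u * sqrt (cL * cP)"
  have bound: "\<bar>b_form \<Omega> u z z\<bar> \<le> ?C * (d n * V_norm \<Omega> z + (d n + V_norm \<Omega> z) * d n)" for n
  proof -
    have "b_form \<Omega> u (y n) (y n) = 0" unfolding y_def by (rule b_form_test_zero[OF u \<zeta>(1)])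
    then have "b_form \<Omega> u z z = - b_form \<Omega> u (\<lambda>x. y n x - z x) z - b_form \<Omega> u (y n) (\<lambda>x. y n x - z x)"
      using b_form_diff(2)[OF uH yH z z] b_form_diff(3)[OF uH yH yH z] by simp
    moreover have "\<bar>b_form \<Omega> u (\<lambda>x. y n x - z x) z\<bar> \<le> d n * Lp_norm \<Omega> 4 u * (sqrt (cL * cP) * V_norm \<Omega> z)"
      unfolding d_def using Lp4_norm_le[OF z]
      by (intro order_trans[OF b_form_bound(2)[OF uH eH z]] mult_left_mono) auto
    moreover have "\<bar>b_form \<Omega> u (y n) (\<lambda>x. y n x - z x)\<bar> \<le>
        (d n + V_norm \<Omega> z) * Lp_norm \<Omega> 4 u * (sqrt (cL * cP) * d n)"
      unfolding d_def using Lp4_norm_le[OF eH] V_norm_triangle(1)[OF yH z]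
      by (intro order_trans[OF b_form_bound(2)[OF uH yH eH]] mult_mono mult_right_mono mult_nonneg_nonneg) auto
    ultimately show ?thesis by (simp add: algebra_simps)
  qed
  have "(\<lambda>n. ?C * (d n * V_norm \<Omega> z + (d n + V_norm \<Omega> z) * d n)) \<longlonglongrightarrow>
      ?C * (0 * V_norm \<Omega> z + (0 + V_norm \<Omega> z) * 0)"
    by (intro tendsto_intros d)
  then have "\<bar>b_form \<Omega> u z z\<bar> \<le> ?C * (0 * V_norm \<Omega> z + (0 + V_norm \<Omega> z) * 0)"
    by (rule LIMSEQ_le_const) (use bound in auto)
  then show ?thesis by simp
qed

text \<open>The other term of the bilinear expansion is b(u, z, z) = 0 with z = u - v. The remaining
  one involves u only through z, so its coefficient is controlled by the stationary field
  alone.\<close>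

lemma b_form_difference:
  assumes u: "u \<in> V \<Omega>" and v: "v \<in> V \<Omega>"
  shows "b_form \<Omega> u u (\<lambda>x. u x - v x) - b_form \<Omega> v v (\<lambda>x. u x - v x) =
    b_form \<Omega> (\<lambda>x. u x - v x) v (\<lambda>x. u x - v x)"
proof -
  note H = V_D(1)[OF u] V_D(1)[OF v]
  note zH = H10_vec_diff(1)[OF H]
  show ?thesis
    using b_form_antisym[OF u zH] b_form_diff(2)[OF H(1) H(1) zH H(2)] b_form_diff(1)[OF H(1) H(2) zH H(2)]
    by simp
qed

text \<open>The bound on v gives V_norm v * cL * cP <= cP^2 * cL * |fs| / mu, and the smallness
  assumption says precisely that this is below mu / 2. Half of the coercivity survives.\<close>

lemma b_form_small:
  assumes z: "z \<in> H10_vec \<Omega>" and v: "v \<in> H10_vec \<Omega>" and vn: "\<mu> * V_norm \<Omega> v \<le> cP * Lp_norm \<Omega> 2 fs"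
  shows "\<bar>b_form \<Omega> z v z\<bar> \<le> \<mu> / 2 * (V_norm \<Omega> z)\<^sup>2"
proof -
  have "\<bar>b_form \<Omega> z v z\<bar> \<le> V_norm \<Omega> v * Lp_norm \<Omega> 4 z * Lp_norm \<Omega> 4 z"
    by (rule b_form_bound(2)[OF z v z])
  also have "\<dots> \<le> V_norm \<Omega> v * (sqrt (cL * cP) * V_norm \<Omega> z) * (sqrt (cL * cP) * V_norm \<Omega> z)"
    using Lp4_norm_le[OF z] cL_pos cP_pos by (intro mult_mono order_refl mult_nonneg_nonneg) auto
  also have "\<dots> = V_norm \<Omega> v * (cL * cP) * (V_norm \<Omega> z)\<^sup>2"
    using cL_pos cP_pos by (simp add: power2_eq_square mult.assoc)
  finally have 1: "\<bar>b_form \<Omega> z v z\<bar> \<le> V_norm \<Omega> v * (cL * cP) * (V_norm \<Omega> z)\<^sup>2" .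
  have "\<mu> * V_norm \<Omega> v * (cL * cP) \<le> cP * Lp_norm \<Omega> 2 fs * (cL * cP)"
    using cL_pos cP_pos by (intro mult_right_mono vn) auto
  also have "\<dots> \<le> \<mu>\<^sup>2 / 2" using small by (simp add: power2_eq_square algebra_simps)
  finally have "V_norm \<Omega> v * (cL * cP) \<le> \<mu> / 2"
    using \<mu>_pos by (simp add: power2_eq_square mult.assoc)
  then show ?thesis by (intro order_trans[OF 1] mult_right_mono) auto
qed

end

section \<open>Designs, stationary states and the pointwise energy estimate\<close>

lemma \<Phi>ad_D:
  assumes "\<phi> \<in> \<Phi>ad \<Omega>"
  shows "\<phi> \<in> H1 \<Omega>" "\<phi> \<in> borel_measurable (lebesgue_on \<Omega>)" "AE x in lebesgue_on \<Omega>. \<bar>\<phi> x\<bar> \<le> 1"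
  using assms by (auto simp: \<Phi>ad_def H1_def Lp2_iff)

text \<open>The Lipschitz estimate is anchored at 1, where the coefficient vanishes; the factor 2 is
  the length of [-1, 1].\<close>

lemma lipschitz_composition_bound:
  fixes \<alpha> :: "real \<Rightarrow> real"
  assumes L: "L-lipschitz_on UNIV \<alpha>" and \<alpha>1: "\<alpha> 1 = 0" and \<phi>: "\<phi> \<in> \<Phi>ad \<Omega>"
  shows "(\<lambda>x. \<alpha> (\<phi> x)) \<in> borel_measurable (lebesgue_on \<Omega>)" "AE x in lebesgue_on \<Omega>. \<bar>\<alpha> (\<phi> x)\<bar> \<le> 2 * L"
proof -
  have "continuous_on UNIV \<alpha>" using L by (rule lipschitz_on_continuous_on)
  then show "(\<lambda>x. \<alpha> (\<phi> x)) \<in> borel_measurable (lebesgue_on \<Omega>)"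
    using \<Phi>ad_D(2)[OF \<phi>] by (rule borel_measurable_continuous_on)
  show "AE x in lebesgue_on \<Omega>. \<bar>\<alpha> (\<phi> x)\<bar> \<le> 2 * L"
    using \<Phi>ad_D(3)[OF \<phi>]
  proof eventually_elim
    case (elim x)
    have "\<bar>\<alpha> (\<phi> x)\<bar> \<le> L * \<bar>\<phi> x - 1\<bar>"
      using lipschitz_onD[OF L, of "\<phi> x" 1] \<alpha>1 by (simp add: dist_real_def)
    also have "\<dots> \<le> L * 2" using elim lipschitz_on_nonneg[OF L] by (intro mult_left_mono) auto
    finally show ?case by simp
  qed
qed

locale navier_stokes_coefficient = navier_stokes +
  fixes \<alpha> :: "real \<Rightarrow> real" and L :: real
  assumes \<alpha>_nonneg: "\<And>s. \<alpha> s \<ge> 0" and \<alpha>_lipschitz: "L-lipschitz_on UNIV \<alpha>" and \<alpha>_1: "\<alpha> 1 = 0"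
begin

lemma a_form_integrable:
  assumes \<phi>: "\<phi> \<in> \<Phi>ad \<Omega>" and u: "u \<in> H10_vec \<Omega>" and w: "w \<in> H10_vec \<Omega>"
  shows "integrable M (\<lambda>x. wjac \<Omega> u x \<bullet> wjac \<Omega> w x)" "integrable M (\<lambda>x. \<alpha> (\<phi> x) * (u x \<bullet> w x))"
proof -
  show "integrable M (\<lambda>x. wjac \<Omega> u x \<bullet> wjac \<Omega> w x)"
    by (rule Lp2_integrable_inner[OF H10_vec_D(3)[OF u] H10_vec_D(3)[OF w]])
  show "integrable M (\<lambda>x. \<alpha> (\<phi> x) * (u x \<bullet> w x))"
    using Lp2_integrable_inner[OF Lp2_bounded_mult(1)[OF H10_vec_D(2)[OF u]
          lipschitz_composition_bound[OF \<alpha>_lipschitz \<alpha>_1 \<phi>]] H10_vec_D(2)[OF w]]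
    by simp
qed

lemma a_form_diff_left:
  assumes \<phi>: "\<phi> \<in> \<Phi>ad \<Omega>" and u: "u \<in> H10_vec \<Omega>" and v: "v \<in> H10_vec \<Omega>" and w: "w \<in> H10_vec \<Omega>"
  shows "a_form \<Omega> \<mu> \<alpha> \<phi> (\<lambda>x. u x - v x) w = a_form \<Omega> \<mu> \<alpha> \<phi> u w - a_form \<Omega> \<mu> \<alpha> \<phi> v w"
proof -
  note d = H10_vec_diff[OF u v]
  note i = a_form_integrable[OF \<phi> u w] a_form_integrable[OF \<phi> v w]
  have "(LINT x|M. wjac \<Omega> (\<lambda>x. u x - v x) x \<bullet> wjac \<Omega> w x) =
      (LINT x|M. wjac \<Omega> u x \<bullet> wjac \<Omega> w x - wjac \<Omega> v x \<bullet> wjac \<Omega> w x)"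
  proof (rule integral_cong_AE)
    show "AE x in M. wjac \<Omega> (\<lambda>x. u x - v x) x \<bullet> wjac \<Omega> w x = wjac \<Omega> u x \<bullet> wjac \<Omega> w x - wjac \<Omega> v x \<bullet> wjac \<Omega> w x"
      using d(2) by eventually_elim (simp add: inner_diff_left)
    show "(\<lambda>x. wjac \<Omega> (\<lambda>x. u x - v x) x \<bullet> wjac \<Omega> w x) \<in> borel_measurable M"
      using a_form_integrable(1)[OF \<phi> d(1) w] by auto
    show "(\<lambda>x. wjac \<Omega> u x \<bullet> wjac \<Omega> w x - wjac \<Omega> v x \<bullet> wjac \<Omega> w x) \<in> borel_measurable M"
      using i by auto
  qed
  then show ?thesis using i by (simp add: a_form_def inner_diff_left right_diff_distrib)
qed

lemma a_form_coercive:
  shows "\<mu> * (V_norm \<Omega> z)\<^sup>2 \<le> a_form \<Omega> \<mu> \<alpha> \<phi> z z"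
proof -
  have "0 \<le> (LINT x|M. \<alpha> (\<phi> x) * (z x \<bullet> z x))"
    using \<alpha>_nonneg by (intro integral_nonneg_AE) auto
  then show ?thesis by (simp add: a_form_def Lp2_inner_self V_norm_def)
qed

text \<open>The equation is tested with v itself: b(v, v, v) = 0 and the coefficient term is
  nonnegative, so the bound is uniform in the design.\<close>

lemma stationary_bound:
  assumes "stationary_solution \<Omega> \<mu> \<alpha> fs \<phi> v"
  shows "\<mu> * V_norm \<Omega> v \<le> cP * Lp_norm \<Omega> 2 fs"
proof -
  have v: "v \<in> V \<Omega>" and eq: "a_form \<Omega> \<mu> \<alpha> \<phi> v v + b_form \<Omega> v v v = (LINT x|M. fs x \<bullet> v x)"
    using assms by (auto simp: stationary_solution_def)
  have "\<mu> * (V_norm \<Omega> v)\<^sup>2 \<le> (LINT x|M. fs x \<bullet> v x)"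
    using a_form_coercive[of v \<phi>] eq b_form_antisym[OF v V_D(1)[OF v]] by simp
  also have "\<dots> \<le> Lp_norm \<Omega> 2 fs * Lp_norm \<Omega> 2 v"
    using Lp2_Cauchy_Schwarz[OF fs V_D(2)[OF v]] by simp
  also have "\<dots> \<le> Lp_norm \<Omega> 2 fs * (cP * V_norm \<Omega> v)"
    by (intro mult_left_mono cP V_D(1)[OF v]) simp
  finally have "(\<mu> * V_norm \<Omega> v) * V_norm \<Omega> v \<le> (cP * Lp_norm \<Omega> 2 fs) * V_norm \<Omega> v"
    by (simp add: power2_eq_square mult_ac)
  then show ?thesis
    using V_norm_nonneg[of v] cP_pos
    by (cases "V_norm \<Omega> v = 0") (auto dest: mult_right_le_imp_le)
qed

text \<open>The difference of the two equations is tested with z = v' - v and convection is absorbed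
  by \<open>b_form_small\<close>. The coefficient perturbation multiplies v and z, which both lie in
  L4, so the L2 distance of the designs suffices.\<close>

lemma stationary_stability:
  assumes \<phi>: "\<phi> \<in> \<Phi>ad \<Omega>" "\<phi>' \<in> \<Phi>ad \<Omega>"
    and v: "stationary_solution \<Omega> \<mu> \<alpha> fs \<phi> v" and v': "stationary_solution \<Omega> \<mu> \<alpha> fs \<phi>' v'"
  shows "\<mu> / 2 * V_norm \<Omega> (\<lambda>x. v' x - v x) \<le>
    L * sqrt (cL * cP) * Lp_norm \<Omega> 4 v * Lp_norm \<Omega> 2 (\<lambda>x. \<phi>' x - \<phi> x)"
proof -
  define z where "z = (\<lambda>x. v' x - v x)"
  have V: "v \<in> V \<Omega>" "v' \<in> V \<Omega>" using v v' by (auto simp: stationary_solution_def)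
  then have zV: "z \<in> V \<Omega>" unfolding z_def by (intro V_diff)
  note H = V_D(1)[OF V(1)] V_D(1)[OF V(2)] V_D(1)[OF zV]
  have e: "a_form \<Omega> \<mu> \<alpha> \<phi> v z + b_form \<Omega> v v z = a_form \<Omega> \<mu> \<alpha> \<phi>' v' z + b_form \<Omega> v' v' z"
    using v v' zV by (auto simp: stationary_solution_def)
  have b: "b_form \<Omega> v' v' z - b_form \<Omega> v v z = b_form \<Omega> z v z"
    unfolding z_def by (rule b_form_difference[OF V(2,1)])
  have a: "a_form \<Omega> \<mu> \<alpha> \<phi>' z z = a_form \<Omega> \<mu> \<alpha> \<phi>' v' z - a_form \<Omega> \<mu> \<alpha> \<phi>' v z"
    unfolding z_def by (rule a_form_diff_left[OF \<phi>(2) H(2,1)]) (use H(3) in \<open>simp add: z_def\<close>)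
  let ?d = "\<lambda>x. L * (\<phi>' x - \<phi> x)"
  have dL: "?d \<in> Lp \<Omega> 2"
    using Lp2_scaleR[OF Lp2_diff[OF H1_D(1)[OF \<Phi>ad_D(1)[OF \<phi>(2)]] H1_D(1)[OF \<Phi>ad_D(1)[OF \<phi>(1)]]], of L] by simp
  have dn: "Lp_norm \<Omega> 2 ?d = L * Lp_norm \<Omega> 2 (\<lambda>x. \<phi>' x - \<phi> x)"
    using Lp2_norm_scaleR[of \<Omega> L "\<lambda>x. \<phi>' x - \<phi> x"] lipschitz_on_nonneg[OF \<alpha>_lipschitz] by simp
  let ?h = "\<lambda>x. (\<alpha> (\<phi>' x) - \<alpha> (\<phi> x)) * (v x \<bullet> z x)"
  have hle: "\<bar>?h x\<bar> \<le> norm (?d x) * norm (v x) * norm (z x)" for x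
  proof -
    have "\<bar>\<alpha> (\<phi>' x) - \<alpha> (\<phi> x)\<bar> \<le> \<bar>?d x\<bar>"
      using lipschitz_onD[OF \<alpha>_lipschitz, of "\<phi>' x" "\<phi> x"] lipschitz_on_nonneg[OF \<alpha>_lipschitz]
      by (simp add: dist_real_def abs_mult)
    then show ?thesis
      using Cauchy_Schwarz_ineq2[of "v x" "z x"] unfolding abs_mult[of _ "v x \<bullet> z x"] mult.assoc
      by (intro mult_mono) auto
  qed
  have hm: "?h \<in> borel_measurable M"
    using a_form_integrable(2)[OF \<phi>(2) H(1,3)] a_form_integrable(2)[OF \<phi>(1) H(1,3)]
    by (simp add: left_diff_distrib borel_measurable_diff borel_measurable_integrable)
  have h: "(LINT x|M. ?h x) = a_form \<Omega> \<mu> \<alpha> \<phi>' v z - a_form \<Omega> \<mu> \<alpha> \<phi> v z"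
    using a_form_integrable(2)[OF \<phi>(2) H(1,3)] a_form_integrable(2)[OF \<phi>(1) H(1,3)]
    by (simp add: a_form_def left_diff_distrib)
  have "\<mu> * (V_norm \<Omega> z)\<^sup>2 \<le> a_form \<Omega> \<mu> \<alpha> \<phi>' z z" by (rule a_form_coercive)
  also have "\<dots> = - (LINT x|M. ?h x) - b_form \<Omega> z v z" using a b e h by simp
  also have "\<dots> \<le> \<bar>LINT x|M. ?h x\<bar> + \<mu> / 2 * (V_norm \<Omega> z)\<^sup>2"
    using b_form_small[OF H(3,1) stationary_bound[OF v]] by linarith
  finally have "\<mu> / 2 * (V_norm \<Omega> z)\<^sup>2 \<le> \<bar>LINT x|M. ?h x\<bar>" by simp
  also have "\<dots> \<le> Lp_norm \<Omega> 2 ?d * Lp_norm \<Omega> 4 v * Lp_norm \<Omega> 4 z"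
    by (rule integrable_Lp2_Lp4_Lp4(2)[OF dL H10_vec_Lp4[OF H(1)] H10_vec_Lp4[OF H(3)] hm hle])
  also have "\<dots> \<le> Lp_norm \<Omega> 2 ?d * Lp_norm \<Omega> 4 v * (sqrt (cL * cP) * V_norm \<Omega> z)"
    by (intro mult_left_mono Lp4_norm_le H) auto
  finally have "(\<mu> / 2 * V_norm \<Omega> z) * V_norm \<Omega> z \<le>
      (L * sqrt (cL * cP) * Lp_norm \<Omega> 4 v * Lp_norm \<Omega> 2 (\<lambda>x. \<phi>' x - \<phi> x)) * V_norm \<Omega> z"
    unfolding dn by (simp add: power2_eq_square mult_ac)
  then show ?thesis
    unfolding z_def[symmetric] using V_norm_nonneg[of z] cP_pos cL_pos lipschitz_on_nonneg[OF \<alpha>_lipschitz]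
    by (cases "V_norm \<Omega> z = 0") (auto dest: mult_right_le_imp_le)
qed

text \<open>At one time the evolution equation holds for all test fields, so z = u - v may be
  inserted. Of the coercivity \<open>\<mu>\<close>, convection takes one half and Young's inequality
  on the force one quarter; completing the square in the latter produces
  \<open>cP\<^sup>2 / \<mu>\<close>.\<close>

lemma evolution_pointwise:
  assumes \<phi>: "\<phi> \<in> \<Phi>ad \<Omega>" and v: "stationary_solution \<Omega> \<mu> \<alpha> fs \<phi> v"
    and u: "u \<in> V \<Omega>" and f: "f \<in> Lp \<Omega> 2"
    and eq: "\<And>\<psi>. \<psi> \<in> V \<Omega> \<Longrightarrow> g \<psi> + a_form \<Omega> \<mu> \<alpha> \<phi> u \<psi> + b_form \<Omega> u u \<psi> = (LINT x|M. f x \<bullet> \<psi> x)"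
  shows "g (\<lambda>x. u x - v x) + \<mu> / 4 * (V_norm \<Omega> (\<lambda>x. u x - v x))\<^sup>2 \<le>
    cP\<^sup>2 / \<mu> * (Lp_norm \<Omega> 2 (\<lambda>x. f x - fs x))\<^sup>2"
proof -
  define z where "z = (\<lambda>x. u x - v x)"
  have vV: "v \<in> V \<Omega>" using v by (auto simp: stationary_solution_def)
  then have zV: "z \<in> V \<Omega>" unfolding z_def using u by (intro V_diff)
  note H = V_D(1)[OF u] V_D(1)[OF vV] V_D(1)[OF zV]
  have e: "a_form \<Omega> \<mu> \<alpha> \<phi> v z + b_form \<Omega> v v z = (LINT x|M. fs x \<bullet> z x)"
    using v zV by (auto simp: stationary_solution_def)
  have b: "b_form \<Omega> u u z - b_form \<Omega> v v z = b_form \<Omega> z v z"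
    unfolding z_def by (rule b_form_difference[OF u vV])
  have a: "a_form \<Omega> \<mu> \<alpha> \<phi> z z = a_form \<Omega> \<mu> \<alpha> \<phi> u z - a_form \<Omega> \<mu> \<alpha> \<phi> v z"
    unfolding z_def by (rule a_form_diff_left[OF \<phi> H(1,2)]) (use H(3) in \<open>simp add: z_def\<close>)
  have "(LINT x|M. (f x - fs x) \<bullet> z x) = (LINT x|M. f x \<bullet> z x) - (LINT x|M. fs x \<bullet> z x)"
    using Lp2_integrable_inner[OF f V_D(2)[OF zV]] Lp2_integrable_inner[OF fs V_D(2)[OF zV]]
    by (simp add: inner_diff_left)
  then have "g z + \<mu> / 2 * (V_norm \<Omega> z)\<^sup>2 \<le> (LINT x|M. (f x - fs x) \<bullet> z x)"
    using eq[OF zV] a b e a_form_coercive[of z \<phi>] b_form_small[OF H(3,2) stationary_bound[OF v]] by linarith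
  also have "\<dots> \<le> Lp_norm \<Omega> 2 (\<lambda>x. f x - fs x) * Lp_norm \<Omega> 2 z"
    using Lp2_Cauchy_Schwarz[OF Lp2_diff[OF f fs] V_D(2)[OF zV]] by simp
  also have "\<dots> \<le> Lp_norm \<Omega> 2 (\<lambda>x. f x - fs x) * (cP * V_norm \<Omega> z)"
    by (intro mult_left_mono cP H) auto
  also have "\<dots> \<le> \<mu> / 4 * (V_norm \<Omega> z)\<^sup>2 + cP\<^sup>2 / \<mu> * (Lp_norm \<Omega> 2 (\<lambda>x. f x - fs x))\<^sup>2"
  proof -
    define X Y where "X = Lp_norm \<Omega> 2 (\<lambda>x. f x - fs x)" and "Y = V_norm \<Omega> z"
    have "0 \<le> (\<mu> * Y / 2 - cP * X)\<^sup>2 / \<mu>" using \<mu>_pos by simp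
    also have "\<dots> = \<mu> / 4 * Y\<^sup>2 + cP\<^sup>2 / \<mu> * X\<^sup>2 - X * (cP * Y)"
      using \<mu>_pos by (simp add: field_simps power2_eq_square)
    finally show ?thesis unfolding X_def Y_def by simp
  qed
  finally show ?thesis unfolding z_def by simp
qed

end

subsection \<open>Backward averages in time\<close>

abbreviation J :: "real \<Rightarrow> real \<Rightarrow> real measure" where
  "J a b \<equiv> lebesgue_on {a<..<b}"

text \<open>Endpoints are null sets. The translation gives access to gauge integrals over closed
  intervals, for which continuity of primitives and the fundamental theorem are used.\<close>

lemma integrable_J_iff:
  fixes f :: "real \<Rightarrow> real"
  shows "integrable (J a b) f \<longleftrightarrow> f absolutely_integrable_on {a..b}"
  by (subst absolutely_integrable_on_Icc_iff_Ioo) (simp add: integrable_restrict_space set_integrable_def)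

lemma integral_J:
  fixes f :: "real \<Rightarrow> real"
  assumes "integrable (J a b) f"
  shows "(LINT x|J a b. f x) = integral {a..b} f"
  using lebesgue_integral_eq_integral[OF assms] by (simp add: integral_open_interval_real)

lemma integrable_J_continuous:
  fixes f :: "real \<Rightarrow> real"
  shows "continuous_on {a..b} f \<Longrightarrow> integrable (J a b) f"
  by (simp add: integrable_J_iff absolutely_integrable_continuous_real)

lemma integrable_J_continuous_UNIV:
  fixes f :: "real \<Rightarrow> real"
  shows "continuous_on UNIV f \<Longrightarrow> integrable (J a b) f"
  by (rule integrable_J_continuous) (rule continuous_on_subset[OF _ subset_UNIV])

lemma integrable_J_subinterval:
  fixes f :: "real \<Rightarrow> real"
  shows "integrable (J a b) f \<Longrightarrow> a \<le> c \<Longrightarrow> d \<le> b \<Longrightarrow> integrable (J c d) f"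
  unfolding integrable_J_iff by (erule absolutely_integrable_on_subinterval) auto

lemma integrable_J_HK:
  fixes f :: "real \<Rightarrow> real"
  shows "integrable (J a b) f \<Longrightarrow> a \<le> c \<Longrightarrow> d \<le> b \<Longrightarrow> f integrable_on {c..d}"
  using integrable_J_subinterval[of a b f c d]
  by (simp add: integrable_J_iff set_lebesgue_integral_eq_integral(1))

lemma integral_J_subinterval_le:
  fixes f :: "real \<Rightarrow> real"
  assumes "integrable (J a b) f" "a \<le> c" "d \<le> b" "\<And>x. 0 \<le> f x"
  shows "(LINT x|J c d. f x) \<le> (LINT x|J a b. f x)"
  unfolding integral_J[OF assms(1)] integral_J[OF integrable_J_subinterval[OF assms(1-3)]]
  by (rule integral_subset_le) (use assms integrable_J_HK[OF assms(1)] in auto)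

text \<open>Backward averages with step h exist only on (h, T); this recovers the full interval as h
  tends to 0.\<close>

lemma integral_J_continuous_endpoint:
  fixes f :: "real \<Rightarrow> real"
  assumes f: "integrable (J 0 T) f" and T: "0 < T"
  shows "((\<lambda>h. LINT x|J h T. f x) \<longlongrightarrow> (LINT x|J 0 T. f x)) (at_right 0)"
proof -
  have f': "f integrable_on {0..T}" using f by (rule integrable_J_HK) auto
  have "continuous_on {0..T} (\<lambda>h. integral {h..T} f)"
    by (rule indefinite_integral_continuous_1'[OF f'])
  then have "((\<lambda>h. integral {h..T} f) \<longlongrightarrow> integral {0..T} f) (at 0 within {0..T})"
    using T by (auto simp: continuous_on)
  then have "((\<lambda>h. integral {h..T} f) \<longlongrightarrow> integral {0..T} f) (at_right 0)"
    using at_within_Icc_at_right[OF T] by simp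
  moreover have "\<forall>\<^sub>F h in at_right 0. integral {h..T} f = (LINT x|J h T. f x)"
    using eventually_at_right_less[of 0]
    by eventually_elim (use integral_J[OF integrable_J_subinterval[OF f]] in auto)
  ultimately show ?thesis
    unfolding integral_J[OF f] by (rule Lim_transform_eventually)
qed

text \<open>A continuous telescoping sum: after the shift everything cancels except two end strips
  of width h.\<close>

lemma integral_shift_difference:
  fixes P :: "real \<Rightarrow> real"
  assumes P: "continuous_on {0..T} P" and h: "0 < h" "h < T"
  shows "integrable (J h T) (\<lambda>t. P t - P (t - h))"
    and "(LINT t|J h T. P t - P (t - h)) = integral {T - h..T} P - integral {0..h} P"
proof -
  have c1: "continuous_on {h..T} P" by (rule continuous_on_subset[OF P]) (use h in auto)
  have c2: "continuous_on {h..T} (\<lambda>t. P (t - h))"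
    by (rule continuous_on_compose2[OF P]) (use h in \<open>auto intro!: continuous_intros\<close>)
  show i: "integrable (J h T) (\<lambda>t. P t - P (t - h))"
    by (intro integrable_J_continuous continuous_on_diff c1 c2)
  have shift: "integral {h..T} (\<lambda>t. P (t - h)) = integral {0..T - h} P"
    using integral_shift_Icc_real[of 0 "T - h" "\<lambda>t. P (t - h)" h] by (simp add: o_def)
  have PT: "P integrable_on {0..T}" by (rule integrable_continuous_real[OF P])
  have "(LINT t|J h T. P t - P (t - h)) = integral {h..T} P - integral {0..T - h} P"
    unfolding integral_J[OF i] shift[symmetric]
    by (intro integral_diff integrable_continuous_real c1 c2)
  moreover have "integral {0..h} P + integral {h..T} P = integral {0..T} P"
    "integral {0..T - h} P + integral {T - h..T} P = integral {0..T} P"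
    using h by (auto intro!: Henstock_Kurzweil_Integration.integral_combine PT)
  ultimately show "(LINT t|J h T. P t - P (t - h)) = integral {T - h..T} P - integral {0..h} P"
    by simp
qed

text \<open>Backward averaging does not increase the integral of a nonnegative function. The
  primitive is monotone, so the last strip is at most h times its final value, and the first strip
  is nonnegative.\<close>

lemma integral_average_le:
  fixes f :: "real \<Rightarrow> real"
  assumes f: "integrable (J 0 T) f" "\<And>t. 0 \<le> f t" and h: "0 < h" "h < T"
  shows "(LINT t|J h T. integral {0..t} f - integral {0..t - h} f) \<le> h * (LINT t|J 0 T. f t)"
proof -
  let ?P = "\<lambda>t. integral {0..t} f"
  have f': "f integrable_on {c..d}" if "0 \<le> c" "d \<le> T" for c d
    using f(1) that by (rule integrable_J_HK)
  have P: "continuous_on {0..T} ?P"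
    by (rule indefinite_integral_continuous_1) (use f' in auto)
  have "integral {T - h..T} ?P \<le> integral {T - h..T} (\<lambda>t. ?P T)"
  proof (rule integral_le)
    show "?P integrable_on {T - h..T}"
      by (rule integrable_continuous_real[OF continuous_on_subset[OF P]]) (use h in auto)
    show "?P t \<le> ?P T" if "t \<in> {T - h..T}" for t
      by (rule integral_subset_le) (use that h f f' in auto)
  qed auto
  also have "\<dots> = h * ?P T" using h by simp
  finally have "integral {T - h..T} ?P \<le> h * ?P T" .
  moreover have "0 \<le> integral {0..h} ?P"
  proof (rule Henstock_Kurzweil_Integration.integral_nonneg)
    show "?P integrable_on {0..h}"
      by (rule integrable_continuous_real[OF continuous_on_subset[OF P]]) (use h in auto)
    show "0 \<le> ?P t" if "t \<in> {0..h}" for t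
      by (rule Henstock_Kurzweil_Integration.integral_nonneg) (use that h f f' in auto)
  qed
  ultimately show ?thesis
    using integral_shift_difference(2)[OF P h] integral_J[OF f(1)] by simp
qed

text \<open>Induction along the construction of the integral. For an indicator, a Urysohn function
  between an inner closed and an outer open set is close in L1.\<close>

lemma continuous_approximation_L1:
  fixes f :: "real \<Rightarrow> real"
  assumes "integrable (J a b) f"
  shows "\<forall>e>0. \<exists>c. continuous_on UNIV c \<and> (LINT t|J a b. \<bar>f t - c t\<bar>) < e"
  using assms
proof (induction rule: integrable_induct)
  case (base A r)
  show ?case
  proof (intro allI impI)
    fix e :: real assume e: "e > 0"
    \<comment> \<open>Half of the admissible error for each of the sets \<open>U - A\<close> and
      \<open>A - K\<close>; the added 1 covers r = 0.\<close>
    define d where "d = e / (\<bar>r\<bar> + 1) / 2"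
    have d: "d > 0" using e by (simp add: d_def)
    have A: "A \<in> sets lebesgue" "A \<subseteq> {a<..<b}" using base(1) by (auto simp: sets_restrict_space_iff)
    obtain U where U: "open U" "A \<subseteq> U" "U - A \<in> lmeasurable" "emeasure lebesgue (U - A) < ennreal d"
      using sets_lebesgue_outer_open[OF A(1) d] by blast
    obtain K where K: "closed K" "K \<subseteq> A" "A - K \<in> lmeasurable" "emeasure lebesgue (A - K) < ennreal d"
      using sets_lebesgue_inner_closed[OF A(1) d] by blast
    \<comment> \<open>Equal to 1 on K and 0 off U, \<open>c\<close> differs from the indicator of A
      only on \<open>U - A\<close> and \<open>A - K\<close>, and there by at most 1.\<close>
    obtain c :: "real \<Rightarrow> real" where c: "continuous_on UNIV c" "\<And>x. c x \<in> closed_segment 1 0"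
      "\<And>x. x \<in> K \<Longrightarrow> c x = 1" "\<And>x. x \<in> - U \<Longrightarrow> c x = 0"
      using Urysohn[of K "- U" 1 "0::real"] K U by auto
    have c01: "0 \<le> c x" "c x \<le> 1" for x using c(2)[of x] by (auto simp: closed_segment_eq_real_ivl)
    have m: "integrable (J a b) (indicat_real S)" "(LINT t|J a b. indicator S t) \<le> d"
      if S: "S \<in> lmeasurable" "emeasure lebesgue S < ennreal d" for S
    proof -
      have "S \<inter> {a<..<b} \<in> lmeasurable"
        by (rule fmeasurable_Int_fmeasurable[OF S(1)]) simp
      then have i: "integrable lebesgue (\<lambda>t. indicat_real {a<..<b} t * indicat_real S t)"
        by (simp add: lmeasurable_iff_integrable flip: indicator_inter_arith) (simp add: Int_commute)
      then show "integrable (J a b) (indicat_real S)"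
        by (subst integrable_restrict_space) simp_all
      have "(LINT t|J a b. indicat_real S t) = (LINT t|lebesgue. indicat_real {a<..<b} t * indicat_real S t)"
        by (subst integral_restrict_space) auto
      also have "\<dots> \<le> (LINT t|lebesgue. indicat_real S t)"
      proof (intro integral_mono i)
        show "integrable lebesgue (indicat_real S)" using S(1) by (simp add: lmeasurable_iff_integrable)
      qed (simp add: indicator_def)
      also have "\<dots> = measure lebesgue S" using S(1) by (simp add: fmeasurable_def)
      also have "\<dots> \<le> d"
        using S(2) d unfolding emeasure_eq_measure2[OF S(1)] by (simp add: ennreal_less_iff)
      finally show "(LINT t|J a b. indicator S t) \<le> d" .
    qed
    have "(LINT t|J a b. \<bar>indicator A t *\<^sub>R r - r * c t\<bar>) \<le>
        (LINT t|J a b. \<bar>r\<bar> * (indicator (U - A) t + indicator (A - K) t))"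
    proof (rule integral_mono)
      have 1: "integrable (J a b) (\<lambda>t. indicator A t *\<^sub>R r)"
        using base by (intro integrable_scaleR_left integrable_real_indicator) auto
      have 2: "integrable (J a b) (\<lambda>t. r * c t)"
        by (intro integrable_mult_right integrable_J_continuous continuous_on_subset[OF c(1)]) auto
      show "integrable (J a b) (\<lambda>t. \<bar>indicator A t *\<^sub>R r - r * c t\<bar>)"
        using 1 2 by simp
      show "integrable (J a b) (\<lambda>t. \<bar>r\<bar> * (indicator (U - A) t + indicator (A - K) t))"
        using m(1)[OF U(3,4)] m(1)[OF K(3,4)] by simp
      show "\<bar>indicator A t *\<^sub>R r - r * c t\<bar> \<le> \<bar>r\<bar> * (indicator (U - A) t + indicator (A - K) t)" for t
      proof -
        have "\<bar>indicator A t - c t\<bar> \<le> indicator (U - A) t + indicator (A - K) t"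
          using c(3)[of t] c(4)[of t] c01[of t] U(2) K(2) by (auto simp: indicator_def split: if_splits)
        from mult_left_mono[OF this, of "\<bar>r\<bar>"] show ?thesis
          by (simp add: abs_mult[symmetric] algebra_simps)
      qed
    qed
    also have "\<dots> \<le> \<bar>r\<bar> * (d + d)"
    proof -
      show ?thesis
        using m[OF U(3,4)] m[OF K(3,4)] by (simp add: mult_left_mono add_mono)
    qed
    also have "\<dots> < (\<bar>r\<bar> + 1) * (d + d)" using d by (simp add: distrib_right)
    also have "\<dots> = e"
    proof -
      have "d + d = e / (\<bar>r\<bar> + 1)" unfolding d_def by (rule field_sum_of_halves)
      moreover have "\<bar>r\<bar> + 1 \<noteq> 0" using abs_ge_zero[of r] by linarith
      ultimately show ?thesis by simp
    qed
    finally show "\<exists>c. continuous_on UNIV c \<and> (LINT t|J a b. \<bar>indicator A t *\<^sub>R r - c t\<bar>) < e"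
      by (intro exI[of _ "\<lambda>t. r * c t"]) (auto intro!: continuous_intros c(1))
  qed
next
  case (add f g)
  show ?case
  proof (intro allI impI)
    fix e :: real assume e: "e > 0"
    have e2: "e / 2 > 0" using e by simp
    obtain c where c: "continuous_on UNIV c" "(LINT t|J a b. \<bar>f t - c t\<bar>) < e / 2"
      using add.IH(1)[rule_format, OF e2] by (elim exE conjE)
    obtain d where d: "continuous_on UNIV d" "(LINT t|J a b. \<bar>g t - d t\<bar>) < e / 2"
      using add.IH(2)[rule_format, OF e2] by (elim exE conjE)
    have i: "integrable (J a b) (\<lambda>t. f t - c t)" "integrable (J a b) (\<lambda>t. g t - d t)"
      using add.hyps integrable_J_continuous_UNIV[OF c(1)] integrable_J_continuous_UNIV[OF d(1)]
      by simp_all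
    have "(LINT t|J a b. \<bar>f t + g t - (c t + d t)\<bar>) \<le> (LINT t|J a b. \<bar>f t - c t\<bar> + \<bar>g t - d t\<bar>)"
    proof (rule integral_mono)
      show "integrable (J a b) (\<lambda>t. \<bar>f t + g t - (c t + d t)\<bar>)"
        using Bochner_Integration.integrable_add[OF i] by (simp add: algebra_simps)
    qed (use i in auto)
    also have "\<dots> < e" using i c(2) d(2) by simp
    finally show "\<exists>c. continuous_on UNIV c \<and> (LINT t|J a b. \<bar>f t + g t - c t\<bar>) < e"
      using c(1) d(1) by (intro exI[of _ "\<lambda>t. c t + d t"]) (auto intro!: continuous_intros)
  qed
next
  case (lim f s)
  show ?case
  proof (intro allI impI)
    fix e :: real assume e: "e > 0"
    have "(\<lambda>i. LINT t|J a b. \<bar>f t - s i t\<bar>) \<longlonglongrightarrow> (LINT t|J a b. \<bar>f t - f t\<bar>)"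
    proof (rule integral_dominated_convergence[where w = "\<lambda>t. 3 * \<bar>f t\<bar>"])
      \<comment> \<open>The simple functions of the induction are bounded by 2 |f|, hence 3 = 1 +
        2.\<close>
      show "AE t in J a b. norm \<bar>f t - s i t\<bar> \<le> 3 * \<bar>f t\<bar>" for i
        using lim.hyps(3)[of _ i] by (intro AE_I2) force
      show "AE t in J a b. (\<lambda>i. \<bar>f t - s i t\<bar>) \<longlonglongrightarrow> \<bar>f t - f t\<bar>"
        using lim.hyps(2) by (intro AE_I2 tendsto_intros) auto
    qed (use lim.hyps(1,4) in auto)
    then have "(\<lambda>i. LINT t|J a b. \<bar>f t - s i t\<bar>) \<longlonglongrightarrow> 0" by simp
    then have "\<forall>\<^sub>F i in sequentially. (LINT t|J a b. \<bar>f t - s i t\<bar>) < e / 2"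
      by (rule order_tendstoD) (use e in simp)
    then obtain i where i: "(LINT t|J a b. \<bar>f t - s i t\<bar>) < e / 2"
      by (auto simp: eventually_sequentially)
    obtain c where c: "continuous_on UNIV c" "(LINT t|J a b. \<bar>s i t - c t\<bar>) < e / 2"
      using lim.IH[rule_format, OF half_gt_zero[OF e], of i] by (elim exE conjE)
    have j: "integrable (J a b) (\<lambda>t. f t - s i t)" "integrable (J a b) (\<lambda>t. s i t - c t)"
      using lim.hyps(1,4) integrable_J_continuous_UNIV[OF c(1)] by simp_all
    have "(LINT t|J a b. \<bar>f t - c t\<bar>) \<le> (LINT t|J a b. \<bar>f t - s i t\<bar> + \<bar>s i t - c t\<bar>)"
    proof (rule integral_mono)
      show "integrable (J a b) (\<lambda>t. \<bar>f t - c t\<bar>)"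
        using Bochner_Integration.integrable_add[OF j] by simp
    qed (use j in auto)
    also have "\<dots> < e" using i c(2) j by simp
    finally show "\<exists>c. continuous_on UNIV c \<and> (LINT t|J a b. \<bar>f t - c t\<bar>) < e"
      using c(1) by auto
  qed
qed

text \<open>Lebesgue differentiation in L1. With a continuous c near f there are three errors of
  size e/4: the average of |f - c|, which averaging does not enlarge, the oscillation of c,
  controlled by uniform continuity with tolerance e/(4T), and |f - c| itself.\<close>

lemma average_tendsto_L1:
  fixes f :: "real \<Rightarrow> real"
  assumes f: "integrable (J 0 T) f" and T: "T > 0" and e: "e > 0"
  shows "\<forall>\<^sub>F h in at_right 0. (LINT t|J h T. \<bar>(integral {0..t} f - integral {0..t - h} f) / h - f t\<bar>) < e"
proof -
  obtain c where c: "continuous_on UNIV c" "(LINT t|J 0 T. \<bar>f t - c t\<bar>) < e / 4"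
    using continuous_approximation_L1[OF f, rule_format, OF divide_pos_pos[OF e zero_less_numeral[of "num.Bit0 (num.Bit0 num.One)"]]]
    by (elim exE conjE)
  have ci: "integrable (J 0 T) c" by (intro integrable_J_continuous continuous_on_subset[OF c(1)]) auto
  define q where "q t = \<bar>f t - c t\<bar>" for t
  have qi: "integrable (J 0 T) q" unfolding q_def using f ci by auto
  have "uniformly_continuous_on {0..T} c"
    by (rule compact_uniformly_continuous[OF continuous_on_subset[OF c(1)]]) auto
  moreover have "0 < e / (4 * T)" using e T by simp
  ultimately obtain \<delta> where "\<delta> > 0" "\<forall>t\<in>{0..T}. \<forall>s\<in>{0..T}. dist s t < \<delta> \<longrightarrow> dist (c s) (c t) < e / (4 * T)"
    unfolding uniformly_continuous_on_def by blast
  then have \<delta>: "\<delta> > 0" "\<And>s t. s \<in> {0..T} \<Longrightarrow> t \<in> {0..T} \<Longrightarrow> dist s t < \<delta> \<Longrightarrow> dist (c s) (c t) < e / (4 * T)"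
    by simp_all
  have HK: "g integrable_on {x..y}" if "integrable (J 0 T) g" "0 \<le> x" "y \<le> T" for g :: "real \<Rightarrow> real" and x y
    using that by (rule integrable_J_HK)
  have cont: "continuous_on {0..T} (\<lambda>t. integral {0..t} g)" if "integrable (J 0 T) g" for g :: "real \<Rightarrow> real"
    by (rule indefinite_integral_continuous_1[OF HK[OF that]]) auto
  have "\<forall>\<^sub>F h in at_right 0. h \<in> {0<..<min \<delta> T}"
    by (rule eventually_at_rightI[of 0 "min \<delta> T"]) (use \<delta> T in auto)
  then show ?thesis
  proof eventually_elim
    case (elim h)
    then have h: "0 < h" "h < \<delta>" "h < T" by auto
    let ?P = "\<lambda>t. integral {0..t} f" and ?Q = "\<lambda>t. integral {0..t} q"
    have diff: "integral {0..t} g - integral {0..t - h} g = integral {t - h..t} g"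
      if "integrable (J 0 T) g" "t \<in> {h<..<T}" for g :: "real \<Rightarrow> real" and t
      using Henstock_Kurzweil_Integration.integral_combine[of 0 "t - h" t g] HK[OF that(1)] that h by auto
    have pw: "\<bar>(?P t - ?P (t - h)) / h - f t\<bar> \<le> (?Q t - ?Q (t - h)) / h + e / (4 * T) + q t"
      if t: "t \<in> {h<..<T}" for t
    proof -
      have fi: "f integrable_on {t - h..t}" and qi': "q integrable_on {t - h..t}"
        using HK[OF f] HK[OF qi] t h by auto
      have "integral {t - h..t} (\<lambda>\<tau>. f \<tau> - c t) = integral {t - h..t} f - h * c t"
        using fi h by (subst Henstock_Kurzweil_Integration.integral_diff) auto
      moreover have "norm (integral {t - h..t} (\<lambda>\<tau>. f \<tau> - c t)) \<le> integral {t - h..t} (\<lambda>\<tau>. q \<tau> + e / (4 * T))"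
      proof (rule Henstock_Kurzweil_Integration.integral_norm_bound_integral)
        show "norm (f \<tau> - c t) \<le> q \<tau> + e / (4 * T)" if "\<tau> \<in> {t - h..t}" for \<tau>
        proof -
          have "dist (c \<tau>) (c t) < e / (4 * T)"
            using that t h by (intro \<delta>(2)) (auto simp: dist_real_def)
          then show ?thesis by (auto simp: q_def dist_real_def)
        qed
      qed (use fi qi' in \<open>auto intro!: Henstock_Kurzweil_Integration.integrable_diff Henstock_Kurzweil_Integration.integrable_add\<close>)
      moreover have "integral {t - h..t} (\<lambda>\<tau>. q \<tau> + e / (4 * T)) = integral {t - h..t} q + h * (e / (4 * T))"
        using qi' h by (subst Henstock_Kurzweil_Integration.integral_add) auto
      ultimately have "\<bar>?P t - ?P (t - h) - h * c t\<bar> \<le> ?Q t - ?Q (t - h) + h * (e / (4 * T))"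
        using diff[OF f t] diff[OF qi t] by simp
      from divide_right_mono[OF this, of h]
      have le: "\<bar>?P t - ?P (t - h) - h * c t\<bar> / h \<le> (?Q t - ?Q (t - h)) / h + e / (4 * T)"
        using h by (simp add: add_divide_distrib)
      have "(?P t - ?P (t - h)) / h - c t = (?P t - ?P (t - h) - h * c t) / h"
        using h by (simp add: field_simps)
      then have eq: "\<bar>?P t - ?P (t - h) - h * c t\<bar> / h = \<bar>(?P t - ?P (t - h)) / h - c t\<bar>"
        by (simp only: abs_divide abs_of_pos[OF h(1)])
      have "\<bar>X - f t\<bar> \<le> \<bar>X - c t\<bar> + q t" for X unfolding q_def by arith
      from this[of "(?P t - ?P (t - h)) / h"] le[unfolded eq] show ?thesis by linarith
    qed
    have Pi: "integrable (J h T) (\<lambda>t. (?P t - ?P (t - h)) / h)"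
      using integral_shift_difference(1)[OF cont[OF f]] h by simp
    have Qi: "integrable (J h T) (\<lambda>t. ?Q t - ?Q (t - h))"
      using integral_shift_difference(1)[OF cont[OF qi]] h by simp
    have sub: "integrable (J h T) f" "integrable (J h T) q"
      using f qi h by (auto intro: integrable_J_subinterval)
    have const: "integrable (J h T) (\<lambda>t. k)" for k :: real by (intro integrable_J_continuous) auto
    have "(LINT t|J h T. \<bar>(?P t - ?P (t - h)) / h - f t\<bar>) \<le>
        (LINT t|J h T. (?Q t - ?Q (t - h)) / h + e / (4 * T) + q t)"
      using pw Pi Qi sub const by (intro integral_mono) auto
    also have "\<dots> = (LINT t|J h T. ?Q t - ?Q (t - h)) / h + (LINT t|J h T. e / (4 * T)) + (LINT t|J h T. q t)"
      using Qi sub const by simp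
    also have "\<dots> \<le> e / 4 + e / 4 + e / 4"
    proof (intro add_mono)
      have q0: "0 \<le> q t" for t by (simp add: q_def)
      show "(LINT t|J h T. q t) \<le> e / 4"
        using integral_J_subinterval_le[OF qi, of h T] h c(2) q0 by (simp add: q_def)
      have "(LINT t|J h T. e / (4 * T)) \<le> (LINT t|J 0 T. e / (4 * T))"
        using e T h by (intro integral_J_subinterval_le integrable_J_continuous) auto
      also have "\<dots> = e / 4" using T by (simp add: measure_restrict_space)
      finally show "(LINT t|J h T. e / (4 * T)) \<le> e / 4" .
      have "(LINT t|J h T. ?Q t - ?Q (t - h)) / h \<le> (LINT t|J 0 T. q t)"
        using integral_average_le[OF qi q0 h(1,3)] h by (simp add: field_simps)
      also have "\<dots> \<le> e / 4" using c(2) by (simp add: q_def)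
      finally show "(LINT t|J h T. ?Q t - ?Q (t - h)) / h \<le> e / 4" .
    qed
    also have "\<dots> < e" using e by simp
    finally show ?case .
  qed
qed

text \<open>Testing with smooth bumps that increase to the indicator of an interval; the terms with \<open>m\<close>
  are controlled by approximating \<open>m\<close> uniformly by polynomials, since the derivatives of the bumps
  have total variation at most 2.\<close>

lemma weak_derivative_increment:
  fixes m g :: "real \<Rightarrow> real"
  assumes m: "continuous_on {0..T} m" and g: "integrable (J 0 T) g"
    and weak: "\<And>\<eta>. \<eta> \<in> test_functions {0<..<T} \<Longrightarrow>
      (LINT t|J 0 T. deriv \<eta> t * m t) = - (LINT t|J 0 T. \<eta> t * g t)"
    and st: "0 < s" "s < t" "t < T"
  shows "m t - m s = integral {s..t} g"
proof -
  define A where "A n x = flat_exp 0 (real n * (x - s))" for n x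
  define B where "B n x = flat_exp 0 (real n * (t - x))" for n x
  define A' where "A' n x = real n * flat_exp 2 (real n * (x - s))" for n x
  define B' where "B' n x = - (real n * flat_exp 2 (real n * (t - x)))" for n x
  define \<eta> where "\<eta> n = box_bump n s t" for n
  have \<eta>_eq: "\<eta> n x = A n x * B n x" for n x
    by (simp add: \<eta>_def box_bump_def A_def B_def)
  have test: "\<eta> n \<in> test_functions {0<..<T}" for n
    unfolding \<eta>_def by (rule box_bump_test) (use st in auto)
  have fe: "(flat_exp 0 has_real_derivative flat_exp 2 y) (at y)" for y
    using flat_exp_deriv[of 0 y] by (simp add: numeral_2_eq_2)
  have dA: "(A n has_real_derivative A' n x) (at x)" for n x
    unfolding A_def A'_def by (rule DERIV_cong[OF DERIV_chain2[OF fe]]) (auto intro!: derivative_eq_intros)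
  have dB: "(B n has_real_derivative B' n x) (at x)" for n x
    unfolding B_def B'_def by (rule DERIV_cong[OF DERIV_chain2[OF fe]]) (auto intro!: derivative_eq_intros)
  define D where "D n x = A' n x * B n x + A n x * B' n x" for n x
  have d\<eta>: "(\<eta> n has_real_derivative D n x) (at x)" for n x
    using DERIV_mult[OF dA[of n x] dB[of n x]] unfolding D_def \<eta>_eq[abs_def] by (simp add: mult.commute)
  have deriv_\<eta>: "deriv (\<eta> n) x = D n x" for n x by (rule DERIV_imp_deriv[OF d\<eta>])
  have cont_fe: "continuous_on UNIV (flat_exp k)" for k
    using Ck_flat_exp[of 0 k] by simp
  have cont: "continuous_on S (A n)" "continuous_on S (B n)" "continuous_on S (A' n)" "continuous_on S (B' n)" for n S
    unfolding A_def B_def A'_def B'_def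
    by (auto intro!: continuous_intros continuous_on_compose2[OF cont_fe])
  have cont\<eta>: "continuous_on S (\<eta> n)" and contD: "continuous_on S (D n)" for n S
    unfolding \<eta>_eq[abs_def] D_def by (intro continuous_intros cont)+
  have range: "0 \<le> A n x" "A n x \<le> 1" "0 \<le> B n x" "B n x \<le> 1" "0 \<le> A' n x" "B' n x \<le> 0" for n x
    unfolding A_def B_def A'_def B'_def using flat_exp_0_bounds by (auto simp: flat_exp_def)
  have end0: "\<eta> n 0 = 0" "\<eta> n T = 0" for n
    using test_function_outside[OF test[of n]] by auto
  have lim: "(\<lambda>n. LINT x|J 0 T. \<eta> n x * q x) \<longlonglongrightarrow> integral {s..t} q" if q: "integrable (J 0 T) q" for q
  proof -
    have "(\<lambda>n. LINT x|J 0 T. \<eta> n x * q x) \<longlonglongrightarrow> (LINT x|J 0 T. indicator (box s t) x * q x)"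
    proof (rule integral_dominated_convergence[where w = "\<lambda>x. norm (q x)"])
      have [measurable]: "q \<in> borel_measurable (J 0 T)" using q by auto
      have [measurable]: "\<eta> n \<in> borel_measurable (J 0 T)" for n
        by (rule continuous_imp_measurable_on_sets_lebesgue[OF cont\<eta>]) simp
      show "(\<lambda>x. \<eta> n x * q x) \<in> borel_measurable (J 0 T)" for n by measurable
      have [measurable]: "indicat_real (box s t) \<in> borel_measurable (J 0 T)"
        by (intro measurable_restrict_space1 borel_measurable_indicator) simp
      show "(\<lambda>x. indicator (box s t) x * q x) \<in> borel_measurable (J 0 T)" by measurable
      show "AE x in J 0 T. (\<lambda>n. \<eta> n x * q x) \<longlonglongrightarrow> indicator (box s t) x * q x"
        unfolding \<eta>_def by (intro AE_I2 tendsto_mult box_bump_tendsto tendsto_const)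
      show "AE x in J 0 T. norm (\<eta> n x * q x) \<le> norm (q x)" for n
        using box_bump_bounds[of n s t] unfolding \<eta>_def
        by (intro AE_I2) (simp add: abs_mult mult_left_le_one_le)
    qed (use q in auto)
    also have "(\<lambda>x. indicator (box s t) x * q x) = (\<lambda>x. if x \<in> {s<..<t} then q x else 0)"
      by (auto simp: indicator_def)
    also have "(LINT x|J 0 T. (if x \<in> {s<..<t} then q x else 0)) = (LINT x|J s t. q x)"
      by (rule Lebesgue_Measure.integral_restrict) (use st in auto)
    also have "\<dots> = integral {s..t} q"
      by (rule integral_J[OF integrable_J_subinterval[OF q]]) (use st in auto)
    finally show ?thesis .
  qed
  have "\<bar>m t - m s - integral {s..t} g\<bar> \<le> 0 + e" if "e > 0" for e :: real
  proof -
    \<comment> \<open>Two units of d come from the total variation of the bumps, one from each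
      endpoint when m is replaced by the polynomial.\<close>
    define d where "d = e / 4"
    have d: "d > 0" using that by (simp add: d_def)
    obtain p where p: "real_polynomial_function p" "\<And>x. x \<in> {0..T} \<Longrightarrow> \<bar>m x - p x\<bar> < d"
      using Stone_Weierstrass_real_polynomial_function[OF _ m d] by auto
    obtain p' where p': "real_polynomial_function p'" "\<And>x. (p has_real_derivative p' x) (at x)"
      using has_real_derivative_polynomial_function[OF p(1)] by auto
    have cp: "continuous_on S p" "continuous_on S p'" for S
      using p(1) p'(1) by (auto intro: continuous_on_polymonial_function simp: real_polynomial_function_eq)
    have fi: "integrable (J 0 T) (\<lambda>x. D n x * p x)" "integrable (J 0 T) (\<lambda>x. \<eta> n x * p' x)"
      "integrable (J 0 T) (\<lambda>x. D n x * m x)" for n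
      by (intro integrable_J_continuous continuous_intros contD cont\<eta> cp m)+
    \<comment> \<open>Here the polynomial is essential: m is only continuous and cannot be
      integrated by parts directly.\<close>
    have parts: "(LINT x|J 0 T. D n x * p x) = - (LINT x|J 0 T. \<eta> n x * p' x)" for n
    proof -
      have "((\<lambda>x. D n x * p x + \<eta> n x * p' x) has_integral (\<eta> n T * p T - \<eta> n 0 * p 0)) {0..T}"
      proof (rule fundamental_theorem_of_calculus)
        show "0 \<le> T" using st by simp
        show "((\<lambda>x. \<eta> n x * p x) has_vector_derivative D n x * p x + \<eta> n x * p' x) (at x within {0..T})" for x
          using DERIV_mult[OF d\<eta>[of n x] p'(2)[of x]]
          by (auto simp: has_real_derivative_iff_has_vector_derivative[symmetric] mult.commute
              intro: has_field_derivative_at_within)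
      qed
      then have "integral {0..T} (\<lambda>x. D n x * p x + \<eta> n x * p' x) = 0"
        by (simp add: end0 integral_unique)
      then have "(LINT x|J 0 T. D n x * p x + \<eta> n x * p' x) = 0"
        using integral_J[OF Bochner_Integration.integrable_add[OF fi(1,2)]] by simp
      then show ?thesis using fi by simp
    qed
    have variation: "(LINT x|J 0 T. \<bar>D n x\<bar>) \<le> 2" for n
    proof -
      have i: "integrable (J 0 T) (\<lambda>x. A' n x - B' n x)"
        by (intro integrable_J_continuous continuous_intros cont)
      have "(LINT x|J 0 T. \<bar>D n x\<bar>) \<le> (LINT x|J 0 T. A' n x - B' n x)"
      proof (rule integral_mono)
        show "integrable (J 0 T) (\<lambda>x. \<bar>D n x\<bar>)"
          by (intro integrable_J_continuous continuous_intros contD)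
        \<comment> \<open>\<open>A\<close> increases, \<open>B\<close> decreases and both have
          values in [0, 1]. The majorant is the derivative of \<open>A - B\<close>, whose total
          increment is at most 2.\<close>
        show "\<bar>D n x\<bar> \<le> A' n x - B' n x" for x
        proof -
          have "\<bar>A' n x * B n x\<bar> \<le> A' n x" "\<bar>A n x * B' n x\<bar> \<le> - B' n x"
            using range[of n x] mult_left_le_one_le[of "- B' n x" "A n x"] by (auto simp: abs_mult mult_left_le)
          then show ?thesis unfolding D_def by linarith
        qed
      qed (rule i)
      also have "\<dots> = (A n T - B n T) - (A n 0 - B n 0)"
      proof -
        have "((\<lambda>x. A' n x - B' n x) has_integral (A n T - B n T) - (A n 0 - B n 0)) {0..T}"
          by (rule fundamental_theorem_of_calculus)
            (use st DERIV_diff[OF dA dB] in \<open>auto simp: has_real_derivative_iff_has_vector_derivative[symmetric]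
              intro: has_field_derivative_at_within\<close>)
        then show ?thesis using integral_J[OF i] by (simp add: integral_unique)
      qed
      also have "\<dots> \<le> 2" using range(1-4)[of n T] range(1-4)[of n 0] by linarith
      finally show ?thesis .
    qed
    have close: "\<bar>- (LINT x|J 0 T. \<eta> n x * g x) + (LINT x|J 0 T. \<eta> n x * p' x)\<bar> \<le> d * 2" for n
    proof -
      have "- (LINT x|J 0 T. \<eta> n x * g x) + (LINT x|J 0 T. \<eta> n x * p' x) = (LINT x|J 0 T. D n x * (m x - p x))"
        using weak[OF test, of n] parts[of n] fi by (simp add: deriv_\<eta> right_diff_distrib)
      also have "\<bar>\<dots>\<bar> \<le> (LINT x|J 0 T. d * \<bar>D n x\<bar>)"
      proof (rule integral_abs_bound_integral)
        show "integrable (J 0 T) (\<lambda>x. D n x * (m x - p x))" "integrable (J 0 T) (\<lambda>x. d * \<bar>D n x\<bar>)"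
          by (intro integrable_J_continuous continuous_intros contD cp m)+
        show "\<bar>D n x * (m x - p x)\<bar> \<le> d * \<bar>D n x\<bar>" if "x \<in> space (J 0 T)" for x
          using mult_right_mono[OF less_imp_le[OF p(2)[of x]], of "\<bar>D n x\<bar>"] that
          by (simp add: abs_mult mult.commute)
      qed
      also have "\<dots> = d * (LINT x|J 0 T. \<bar>D n x\<bar>)" by simp
      also have "\<dots> \<le> d * 2" using variation d by (intro mult_left_mono) auto
      finally show ?thesis .
    qed
    have "(\<lambda>n. \<bar>- (LINT x|J 0 T. \<eta> n x * g x) + (LINT x|J 0 T. \<eta> n x * p' x)\<bar>)
        \<longlonglongrightarrow> \<bar>- integral {s..t} g + integral {s..t} p'\<bar>"
      by (intro tendsto_intros lim g integrable_J_continuous cp)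
    then have "\<bar>- integral {s..t} g + integral {s..t} p'\<bar> \<le> d * 2"
      by (rule LIMSEQ_le_const2) (use close in auto)
    moreover have "integral {s..t} p' = p t - p s"
      by (rule integral_unique[OF fundamental_theorem_of_calculus])
        (use st p'(2) in \<open>auto simp: has_real_derivative_iff_has_vector_derivative[symmetric] intro: has_field_derivative_at_within\<close>)
    moreover have "\<bar>m s - p s\<bar> < d" "\<bar>m t - p t\<bar> < d" using st by (auto intro!: p(2))
    ultimately show ?thesis unfolding d_def by linarith
  qed
  then have "\<bar>m t - m s - integral {s..t} g\<bar> \<le> 0" by (rule field_le_epsilon)
  then show ?thesis by simp
qed

text \<open>Rests on the completeness of Lebesgue measure. Quantities depending on time are mostly
  identified only almost everywhere, and their measurability is transferred this way.\<close>

lemma borel_measurable_lebesgue_on_cong_AE: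
  fixes f g :: "'a::euclidean_space \<Rightarrow> real"
  assumes f: "f \<in> borel_measurable (lebesgue_on S)" and S: "S \<in> sets lebesgue"
    and eq: "AE x in lebesgue_on S. f x = g x"
  shows "g \<in> borel_measurable (lebesgue_on S)"
proof -
  have "AE x in lebesgue. (if x \<in> S then f x else 0) = (if x \<in> S then g x else 0)"
    using eq S by (subst (asm) AE_restrict_space_iff) auto
  from borel_measurable_AE[OF _ this] show ?thesis
    using f S by (simp add: borel_measurable_if)
qed

lemma borel_measurable_lebesgue_on_AE_limit:
  fixes f :: "nat \<Rightarrow> 'a::euclidean_space \<Rightarrow> real"
  assumes f: "\<And>n. f n \<in> borel_measurable (lebesgue_on S)" and S: "S \<in> sets lebesgue"
    and lim: "AE x in lebesgue_on S. (\<lambda>n. f n x) \<longlonglongrightarrow> g x"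
  shows "g \<in> borel_measurable (lebesgue_on S)"
proof (rule borel_measurable_lebesgue_on_cong_AE[OF _ S])
  show "(\<lambda>x. lim (\<lambda>n. f n x)) \<in> borel_measurable (lebesgue_on S)"
    using f by (rule borel_measurable_lim_metric)
  show "AE x in lebesgue_on S. lim (\<lambda>n. f n x) = g x"
    using lim by eventually_elim (rule limI)
qed

text \<open>L2, V and the dual of V are sets of functions, not types. These axioms isolate what the
  Bochner arguments use, so that one development covers all three.\<close>

locale seminormed_functions =
  fixes X :: "('a \<Rightarrow> 'b::ab_group_add) set" and N :: "('a \<Rightarrow> 'b) \<Rightarrow> real"
  assumes diff: "f \<in> X \<Longrightarrow> g \<in> X \<Longrightarrow> (\<lambda>x. f x - g x) \<in> X"
    and nonneg: "f \<in> X \<Longrightarrow> 0 \<le> N f"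
    and triangle_diff: "f \<in> X \<Longrightarrow> g \<in> X \<Longrightarrow> N (\<lambda>x. f x - g x) \<le> N f + N g"
    and diff_commute: "f \<in> X \<Longrightarrow> g \<in> X \<Longrightarrow> N (\<lambda>x. f x - g x) = N (\<lambda>x. g x - f x)"
begin

lemma zero: "f \<in> X \<Longrightarrow> (\<lambda>x. 0) \<in> X"
  using diff[of f f] by simp

lemma triangle:
  assumes "f \<in> X" "g \<in> X" "h \<in> X"
  shows "N (\<lambda>x. f x - g x) \<le> N (\<lambda>x. f x - h x) + N (\<lambda>x. h x - g x)"
  using triangle_diff[OF diff[OF assms(1,3)] diff[OF assms(2,3)]] diff_commute[OF assms(2,3)] by simp

lemma N_le:
  assumes "f \<in> X" "g \<in> X"
  shows "N f \<le> N (\<lambda>x. f x - g x) + N g"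
  using triangle[OF assms(1) zero[OF assms(1)] assms(2)] by simp

lemma N_abs_diff:
  assumes "f \<in> X" "g \<in> X"
  shows "\<bar>N f - N g\<bar> \<le> N (\<lambda>x. f x - g x)"
  using N_le[OF assms] N_le[OF assms(2,1)] diff_commute[OF assms] by simp

text \<open>Any F composed with simple functions is simple, hence measurable, and continuity of F
  passes this to the almost everywhere limit. The simple parameter \<open>k\<close> admits pairings
  of \<open>g t\<close> with a moving test field.\<close>

lemma bochner_measurable:
  assumes u: "u \<in> bochner_L2 T X N" and k: "simple_function (J 0 T) k"
    and F: "\<And>t f s. t \<in> {0<..<T} \<Longrightarrow> f \<in> X \<Longrightarrow> (\<And>n. s n \<in> X) \<Longrightarrow>
      (\<lambda>n::nat. N (\<lambda>x. s n x - f x)) \<longlonglongrightarrow> 0 \<Longrightarrow> (\<lambda>n. F (k t) (s n)) \<longlonglongrightarrow> F (k t) f"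
  shows "(\<lambda>t. F (k t) (u t) :: real) \<in> borel_measurable (J 0 T)"
proof -
  obtain s where s: "\<And>n. simple_function (J 0 T) (s n)" "\<And>n t. t \<in> {0<..<T} \<Longrightarrow> s n t \<in> X"
    "AE t in J 0 T. (\<lambda>n::nat. N (\<lambda>x. s n t x - u t x)) \<longlonglongrightarrow> 0"
    and uX: "AE t in J 0 T. u t \<in> X"
    using u unfolding bochner_L2_def by blast
  show ?thesis
  proof (rule borel_measurable_lebesgue_on_AE_limit)
    show "(\<lambda>t. F (k t) (s n t)) \<in> borel_measurable (J 0 T)" for n
      by (rule borel_measurable_simple_function[OF simple_function_compose2[OF k s(1)]])
    show "AE t in J 0 T. (\<lambda>n. F (k t) (s n t)) \<longlonglongrightarrow> F (k t) (u t)"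
      using s(3) uX AE_space
      by eventually_elim (rule F, use s(2) in auto)
  qed simp
qed

lemma bochner_measurable_norm_diff:
  assumes u: "u \<in> bochner_L2 T X N" and k: "simple_function (J 0 T) k"
    and kX: "\<And>t. t \<in> {0<..<T} \<Longrightarrow> k t \<in> X"
  shows "(\<lambda>t. N (\<lambda>x. k t x - u t x)) \<in> borel_measurable (J 0 T)"
proof (rule bochner_measurable[where F = "\<lambda>c v. N (\<lambda>x. c x - v x)", OF u k])
  fix t f and s :: "nat \<Rightarrow> 'a \<Rightarrow> 'b"
  assume a: "t \<in> {0<..<T}" "f \<in> X" "\<And>n. s n \<in> X" "(\<lambda>n. N (\<lambda>x. s n x - f x)) \<longlonglongrightarrow> 0"
  note kt = kX[OF a(1)]
  have "\<bar>N (\<lambda>x. k t x - s n x) - N (\<lambda>x. k t x - f x)\<bar> \<le> N (\<lambda>x. s n x - f x)" for n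
    using N_abs_diff[OF diff[OF kt a(3)] diff[OF kt a(2)], of n] diff_commute[OF a(3,2), of n] by simp
  then have "(\<lambda>n. N (\<lambda>x. k t x - s n x) - N (\<lambda>x. k t x - f x)) \<longlonglongrightarrow> 0"
    by (intro Lim_null_comparison[OF _ a(4)]) auto
  then show "(\<lambda>n. N (\<lambda>x. k t x - s n x)) \<longlonglongrightarrow> N (\<lambda>x. k t x - f x)"
    by (rule LIM_zero_cancel)
qed

lemma bochner_measurable_norm:
  assumes u: "u \<in> bochner_L2 T X N"
  shows "(\<lambda>t. N (u t)) \<in> borel_measurable (J 0 T)"
proof (rule bochner_measurable[where F = "\<lambda>c v. N v" and k = "\<lambda>t. ()", OF u])
  fix f and s :: "nat \<Rightarrow> 'a \<Rightarrow> 'b"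
  assume a: "f \<in> X" "\<And>n. s n \<in> X" "(\<lambda>n. N (\<lambda>x. s n x - f x)) \<longlonglongrightarrow> 0"
  have "(\<lambda>n. N (s n) - N f) \<longlonglongrightarrow> 0"
    using N_abs_diff[OF a(2,1)] by (intro Lim_null_comparison[OF _ a(3)]) auto
  then show "(\<lambda>n. N (s n)) \<longlonglongrightarrow> N f" by (rule LIM_zero_cancel)
qed auto

text \<open>\<open>bochner_L2\<close> provides simple functions converging almost everywhere,
  without control in L2. Truncating them at twice the norm of \<open>u\<close> supplies the majorant
  9 (N (u t))^2 for dominated convergence.\<close>

lemma bochner_approximation:
  assumes u: "u \<in> bochner_L2 T X N" and T: "T > 0" and e: "e > 0"
  obtains s where "simple_function (J 0 T) s" "\<And>t. t \<in> {0<..<T} \<Longrightarrow> s t \<in> X"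
    "integrable (J 0 T) (\<lambda>t. (N (\<lambda>x. s t x - u t x))\<^sup>2)"
    "(LINT t|J 0 T. (N (\<lambda>x. s t x - u t x))\<^sup>2) < e"
proof -
  obtain s where s: "\<And>n. simple_function (J 0 T) (s n)" "\<And>n t. t \<in> {0<..<T} \<Longrightarrow> s n t \<in> X"
    "AE t in J 0 T. (\<lambda>n::nat. N (\<lambda>x. s n t x - u t x)) \<longlonglongrightarrow> 0"
    and uX: "AE t in J 0 T. u t \<in> X" and int: "integrable (J 0 T) (\<lambda>t. (N (u t))\<^sup>2)"
    using u unfolding bochner_L2_def by blast
  have zeroX: "(\<lambda>x. 0) \<in> X" using zero[OF s(2)[of "T / 2"]] T by auto
  \<comment> \<open>Where \<open>N (u t) > 0\<close>, convergence makes the truncation inactive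
    eventually; where \<open>N (u t) = 0\<close>, the zero function is itself at distance 0 from
    \<open>u t\<close>.\<close>
  define r where "r n t = (if N (s n t) \<le> 2 * N (u t) then s n t else (\<lambda>x. 0))" for n t
  have Nu [measurable]: "(\<lambda>t. N (u t)) \<in> borel_measurable (J 0 T)" by (rule bochner_measurable_norm[OF u])
  have [measurable]: "(\<lambda>t. N (s n t)) \<in> borel_measurable (J 0 T)" for n
    by (rule borel_measurable_simple_function[OF simple_function_compose1[OF s(1)]])
  have r: "simple_function (J 0 T) (r n)" for n
    unfolding r_def by (intro simple_function_If s(1) simple_function_const) measurable
  have rX: "r n t \<in> X" if "t \<in> {0<..<T}" for n t
    using s(2)[OF that] zeroX by (simp add: r_def)
  have rm: "(\<lambda>t. N (\<lambda>x. r n t x - u t x)) \<in> borel_measurable (J 0 T)" for n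
    by (rule bochner_measurable_norm_diff[OF u r rX])
  have bound: "AE t in J 0 T. (N (\<lambda>x. r n t x - u t x))\<^sup>2 \<le> 9 * (N (u t))\<^sup>2" for n
    using uX AE_space
  proof eventually_elim
    case (elim t)
    then have t: "t \<in> {0<..<T}" by simp
    have "N (\<lambda>x. 0) \<le> 2 * N (u t)"
      using triangle_diff[OF elim(1) elim(1)] by simp
    then have "N (r n t) \<le> 2 * N (u t)" by (simp add: r_def)
    then have "N (\<lambda>x. r n t x - u t x) \<le> 3 * N (u t)"
      using triangle_diff[OF rX[OF t, of n] elim(1)] by linarith
    then have "(N (\<lambda>x. r n t x - u t x))\<^sup>2 \<le> (3 * N (u t))\<^sup>2"
      by (rule power_mono) (rule nonneg[OF diff[OF rX[OF t] elim(1)]])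
    then show ?case by (simp add: power_mult_distrib)
  qed
  have conv: "AE t in J 0 T. (\<lambda>n. (N (\<lambda>x. r n t x - u t x))\<^sup>2) \<longlonglongrightarrow> 0"
    using s(3) uX AE_space
  proof eventually_elim
    case (elim t)
    then have t: "t \<in> {0<..<T}" by simp
    have "\<forall>\<^sub>F n in sequentially. N (\<lambda>x. r n t x - u t x) \<le> N (\<lambda>x. s n t x - u t x)"
    proof (cases "N (u t) = 0")
      case True
      have "N (\<lambda>x. 0 - u t x) = 0" using diff_commute[OF zeroX elim(2)] True by simp
      then show ?thesis
        using nonneg[OF diff[OF s(2)[OF t] elim(2)]] by (auto simp: r_def)
    next
      case False
      then have "N (u t) > 0" using nonneg[OF elim(2)] by simp
      from order_tendstoD(2)[OF elim(1) this] show ?thesis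
      proof eventually_elim
        case (elim n)
        then have "N (s n t) \<le> 2 * N (u t)" using N_le[OF s(2)[OF t] \<open>u t \<in> X\<close>, of n] by simp
        then show ?case by (simp add: r_def)
      qed
    qed
    then have "(\<lambda>n. N (\<lambda>x. r n t x - u t x)) \<longlonglongrightarrow> 0"
      by (intro tendsto_sandwich[OF _ _ tendsto_const elim(1)])
        (use nonneg[OF diff[OF rX[OF t] elim(2)]] in auto)
    from tendsto_power[OF this, of 2] show ?case by simp
  qed
  have i: "integrable (J 0 T) (\<lambda>t. (N (\<lambda>x. r n t x - u t x))\<^sup>2)" for n
  proof (rule Bochner_Integration.integrable_bound)
    show "integrable (J 0 T) (\<lambda>t. 9 * (N (u t))\<^sup>2)" using int by simp
    show "AE t in J 0 T. norm ((N (\<lambda>x. r n t x - u t x))\<^sup>2) \<le> norm (9 * (N (u t))\<^sup>2)"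
      using bound[of n] by eventually_elim simp
  qed (use rm in simp)
  have "(\<lambda>n. LINT t|J 0 T. (N (\<lambda>x. r n t x - u t x))\<^sup>2) \<longlonglongrightarrow> (LINT t|J 0 T. 0)"
  proof (rule integral_dominated_convergence[where w = "\<lambda>t. 9 * (N (u t))\<^sup>2"])
    show "AE t in J 0 T. norm ((N (\<lambda>x. r n t x - u t x))\<^sup>2) \<le> 9 * (N (u t))\<^sup>2" for n
      using bound[of n] by eventually_elim simp
  qed (use int rm conv in auto)
  then have "\<forall>\<^sub>F n in sequentially. (LINT t|J 0 T. (N (\<lambda>x. r n t x - u t x))\<^sup>2) < e"
    using e by (intro order_tendstoD(2)) auto
  then obtain n where "(LINT t|J 0 T. (N (\<lambda>x. r n t x - u t x))\<^sup>2) < e"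
    by (auto simp: eventually_sequentially)
  then show ?thesis by (intro that[of "r n"] r rX i)
qed

lemma bochner_diff_const:
  assumes u: "u \<in> bochner_L2 T X N" and c: "c \<in> X"
  shows "(\<lambda>t x. u t x - c x) \<in> bochner_L2 T X N"
proof -
  obtain s where s: "\<And>n. simple_function (J 0 T) (s n)" "\<And>n t. t \<in> {0<..<T} \<Longrightarrow> s n t \<in> X"
    "AE t in J 0 T. (\<lambda>n::nat. N (\<lambda>x. s n t x - u t x)) \<longlonglongrightarrow> 0"
    and uX: "AE t in J 0 T. u t \<in> X" and int: "integrable (J 0 T) (\<lambda>t. (N (u t))\<^sup>2)"
    using u unfolding bochner_L2_def by blast
  define r where "r n t = (\<lambda>x. s n t x - c x)" for n t
  have r: "simple_function (J 0 T) (r n)" for n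
    unfolding r_def by (rule simple_function_compose1[OF s(1)])
  have 1: "AE t in J 0 T. (\<lambda>x. u t x - c x) \<in> X"
    using uX by eventually_elim (rule diff[OF _ c])
  have m: "(\<lambda>t. N (\<lambda>x. u t x - c x)) \<in> borel_measurable (J 0 T)"
  proof (rule borel_measurable_lebesgue_on_cong_AE)
    show "(\<lambda>t. N (\<lambda>x. c x - u t x)) \<in> borel_measurable (J 0 T)"
      using bochner_measurable_norm_diff[OF u, of "\<lambda>t. c"] c by simp
    show "AE t in J 0 T. N (\<lambda>x. c x - u t x) = N (\<lambda>x. u t x - c x)"
      using uX by eventually_elim (rule diff_commute[OF c])
  qed simp
  have 2: "integrable (J 0 T) (\<lambda>t. (N (\<lambda>x. u t x - c x))\<^sup>2)"
  proof (rule Bochner_Integration.integrable_bound)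
    show "integrable (J 0 T) (\<lambda>t. 2 * (N (u t))\<^sup>2 + 2 * (N c)\<^sup>2)"
      using int integrable_J_continuous_UNIV[OF continuous_on_const, of 0 T "2 * (N c)\<^sup>2"] by simp
    show "AE t in J 0 T. norm ((N (\<lambda>x. u t x - c x))\<^sup>2) \<le> norm (2 * (N (u t))\<^sup>2 + 2 * (N c)\<^sup>2)"
      using uX
    proof eventually_elim
      case (elim t)
      have "(N (\<lambda>x. u t x - c x))\<^sup>2 \<le> (N (u t) + N c)\<^sup>2"
        by (rule power_mono[OF triangle_diff[OF elim c] nonneg[OF diff[OF elim c]]])
      also have "\<dots> \<le> 2 * (N (u t))\<^sup>2 + 2 * (N c)\<^sup>2"
        using sum_squares_bound[of "N (u t)" "N c"] by (simp add: power2_sum)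
      finally show ?case by simp
    qed
  qed (use m in simp)
  have 3: "AE t in J 0 T. (\<lambda>n. N (\<lambda>x. r n t x - (u t x - c x))) \<longlonglongrightarrow> 0"
    using s(3) by eventually_elim (simp add: r_def)
  have 4: "r n t \<in> X" if "t \<in> {0<..<T}" for n t
    unfolding r_def by (rule diff[OF s(2)[OF that] c])
  show ?thesis
    unfolding bochner_L2_def using 1 2 3 4 r by blast
qed

end

subsection \<open>The energy inequality\<close>

lemma seminormed_Lp2: "seminormed_functions (Lp \<Omega> 2) (Lp_norm \<Omega> 2)"
  by standard (auto intro: Lp2_diff Lp2_triangle_diff Lp2_norm_minus_commute)

lemma AE_J_subinterval:
  assumes "AE t in J a b. P t" "a \<le> c" "d \<le> b"
  shows "AE t in J c d. P t"
  using assms(1) by (simp add: AE_restrict_space_iff) (erule eventually_mono, use assms(2,3) in auto)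

lemma Lp2_norm_diff_square:
  assumes "f \<in> Lp \<Omega> 2" "g \<in> Lp \<Omega> 2"
  shows "(Lp_norm \<Omega> 2 (\<lambda>x. f x - g x))\<^sup>2 =
    (Lp_norm \<Omega> 2 f)\<^sup>2 - 2 * (LINT x|lebesgue_on \<Omega>. f x \<bullet> g x) + (Lp_norm \<Omega> 2 g)\<^sup>2"
proof -
  have "norm (f x - g x) ^ 2 = norm (f x) ^ 2 - 2 * (f x \<bullet> g x) + norm (g x) ^ 2" for x
    by (simp add: power2_norm_eq_inner inner_diff inner_commute)
  then show ?thesis
    unfolding Lp_norm_2_square using assms Lp2_integrable_inner[OF assms] by (simp add: Lp2_iff)
qed

lemma test_function_deriv:
  fixes \<eta> :: "real \<Rightarrow> real"
  assumes \<eta>: "\<eta> \<in> test_functions S"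
  shows "(\<eta> has_real_derivative deriv \<eta> t) (at t)" "continuous_on UNIV (deriv \<eta>)"
proof -
  have d: "(\<eta> has_real_derivative frechet_derivative \<eta> (at t) 1) (at t)" for t
  proof -
    have eq: "frechet_derivative \<eta> (at t) = (*) (frechet_derivative \<eta> (at t) 1)"
    proof
      fix h
      show "frechet_derivative \<eta> (at t) h = frechet_derivative \<eta> (at t) 1 * h"
        using linear_cmul[OF has_derivative_linear[OF test_function_has_derivative[OF \<eta>]], of t h 1] by simp
    qed
    show ?thesis
      unfolding has_field_derivative_def eq[symmetric] by (rule test_function_has_derivative[OF \<eta>])
  qed
  have eq: "deriv \<eta> = (\<lambda>t. frechet_derivative \<eta> (at t) 1)"
    by (rule ext) (rule DERIV_imp_deriv[OF d])
  show "(\<eta> has_real_derivative deriv \<eta> t) (at t)" unfolding eq by (rule d)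
  show "continuous_on UNIV (deriv \<eta>)"
    unfolding eq by (rule test_function_continuous[OF test_function_partial[OF \<eta>]]) simp
qed

context navier_stokes
begin

lemma seminormed_V: "seminormed_functions (V \<Omega>) (V_norm \<Omega>)"
proof
  show "V_norm \<Omega> (\<lambda>x. f x - g x) = V_norm \<Omega> (\<lambda>x. g x - f x)" if "f \<in> V \<Omega>" "g \<in> V \<Omega>" for f g
    using V_norm_diff_eq[OF V_D(1)[OF that(1)] V_D(1)[OF that(2)]]
      V_norm_diff_eq[OF V_D(1)[OF that(2)] V_D(1)[OF that(1)]]
    by (simp add: Lp2_norm_minus_commute[of \<Omega> "wjac \<Omega> f"])
qed (auto intro: V_diff V_norm_triangle(2) V_D(1))

lemma V_norm_scaleR:
  assumes "u \<in> V \<Omega>"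
  shows "V_norm \<Omega> (\<lambda>x. a *\<^sub>R u x) = \<bar>a\<bar> * V_norm \<Omega> u"
proof -
  note H = V_D(1)[OF assms]
  have "V_norm \<Omega> (\<lambda>x. a *\<^sub>R u x) = Lp_norm \<Omega> 2 (\<lambda>x. a *\<^sub>R wjac \<Omega> u x)"
    unfolding V_norm_def using H10_vec_lincomb[OF H H, of a 0]
    by (intro Lp2_norm_cong_AE H10_vec_D(3) Lp2_measurable Lp2_scaleR H) simp_all
  then show ?thesis by (simp add: Lp2_norm_scaleR V_norm_def)
qed

text \<open>A real supremum is informative only for bounded sets; the second fact makes
  \<open>dual_norm\<close> usable.\<close>

lemma V_dual_D:
  assumes F: "F \<in> V_dual \<Omega>"
  shows V_dual_linear: "\<And>f g a b. f \<in> V \<Omega> \<Longrightarrow> g \<in> V \<Omega> \<Longrightarrow> F (\<lambda>x. a *\<^sub>R f x + b *\<^sub>R g x) = a * F f + b * F g"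
    and V_dual_bdd: "bdd_above ((\<lambda>f. \<bar>F f\<bar>) ` {f \<in> V \<Omega>. V_norm \<Omega> f \<le> 1})"
proof -
  show "\<And>f g a b. f \<in> V \<Omega> \<Longrightarrow> g \<in> V \<Omega> \<Longrightarrow> F (\<lambda>x. a *\<^sub>R f x + b *\<^sub>R g x) = a * F f + b * F g"
    using F by (simp add: dual_space_def)
  obtain C where C: "\<forall>f\<in>V \<Omega>. \<bar>F f\<bar> \<le> C * V_norm \<Omega> f" using F by (auto simp: dual_space_def)
  have "\<bar>F f\<bar> \<le> \<bar>C\<bar>" if "f \<in> V \<Omega>" "V_norm \<Omega> f \<le> 1" for f
  proof -
    have "\<bar>F f\<bar> \<le> C * V_norm \<Omega> f" using C that by blast
    also have "\<dots> \<le> \<bar>C\<bar> * 1" using that by (intro mult_mono) auto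
    finally show ?thesis by simp
  qed
  then show "bdd_above ((\<lambda>f. \<bar>F f\<bar>) ` {f \<in> V \<Omega>. V_norm \<Omega> f \<le> 1})"
    by (intro bdd_aboveI2[of _ _ "\<bar>C\<bar>"]) auto
qed

lemma V_dual_diff: "F \<in> V_dual \<Omega> \<Longrightarrow> f \<in> V \<Omega> \<Longrightarrow> g \<in> V \<Omega> \<Longrightarrow> F (\<lambda>x. f x - g x) = F f - F g"
  using V_dual_linear[of F f g 1 "-1"] by simp

lemma V_dual_le:
  assumes F: "F \<in> V_dual \<Omega>" and \<psi>: "\<psi> \<in> V \<Omega>"
  shows "\<bar>F \<psi>\<bar> \<le> V_dual_norm \<Omega> F * V_norm \<Omega> \<psi>"
proof (cases "V_norm \<Omega> \<psi> = 0")
  case True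
  \<comment> \<open>\<open>\<psi>\<close> cannot be normalized here; the continuity constant shows
    that the functional vanishes on it.\<close>
  obtain C where "\<forall>f\<in>V \<Omega>. \<bar>F f\<bar> \<le> C * V_norm \<Omega> f" using F by (auto simp: dual_space_def)
  then show ?thesis using True \<psi> by fastforce
next
  case False
  then have pos: "V_norm \<Omega> \<psi> > 0" using V_norm_nonneg[of \<psi>] by linarith
  define f where "f = (\<lambda>x. (1 / V_norm \<Omega> \<psi>) *\<^sub>R \<psi> x)"
  have f: "f \<in> V \<Omega>" using V_lincomb[OF \<psi> \<psi>, of "1 / V_norm \<Omega> \<psi>" 0] by (simp add: f_def)
  have "V_norm \<Omega> f = 1" unfolding f_def V_norm_scaleR[OF \<psi>] using pos by simp
  then have "\<bar>F f\<bar> \<le> V_dual_norm \<Omega> F"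
    unfolding dual_norm_def using f by (intro cSUP_upper[OF _ V_dual_bdd[OF F]]) auto
  moreover have "F f = F \<psi> / V_norm \<Omega> \<psi>"
    using V_dual_linear[OF F \<psi> \<psi>, of "1 / V_norm \<Omega> \<psi>" 0] by (simp add: f_def)
  ultimately show ?thesis using pos by (simp add: field_simps)
qed

lemma zero_in_V:
  assumes "\<psi> \<in> V \<Omega>"
  shows "(\<lambda>x. 0) \<in> V \<Omega>" "V_norm \<Omega> (\<lambda>x. 0) = 0"
  using V_lincomb[OF assms assms, of 0 0] V_norm_scaleR[OF assms, of 0] by simp_all

lemma H10_const_zero: "(\<lambda>x. 0) \<in> H10 \<Omega>"
  by (rule test_function_H10) (rule test_functionsI[where K = "{}"], auto intro: Ck_const)

text \<open>The zero field lies in the unit ball of V, so the suprema defining dual norms range over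
  a nonempty set.\<close>

lemma V_nonempty: "(\<lambda>x. 0) \<in> V \<Omega>" "V_norm \<Omega> (\<lambda>x. 0) = 0"
proof -
  have H: "(\<lambda>x. 0) \<in> H10_vec \<Omega>" by (simp add: H10_vec_def H10_const_zero)
  have "AE x in M. wjac \<Omega> (\<lambda>x. 0) x = 0"
    using H10_vec_lincomb(2)[OF H H, of 0 0] by simp
  then have "(\<lambda>x. 0) \<in> V \<Omega>"
    unfolding V_def using H by (auto elim!: eventually_mono simp: trace_def)
  then show "(\<lambda>x. 0) \<in> V \<Omega>" "V_norm \<Omega> (\<lambda>x. 0) = 0" using zero_in_V by auto
qed

lemma seminormed_V_dual: "seminormed_functions (V_dual \<Omega>) (V_dual_norm \<Omega>)"
proof
  have ne: "{f \<in> V \<Omega>. V_norm \<Omega> f \<le> 1} \<noteq> {}" using V_nonempty by auto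
  fix F G assume F: "F \<in> V_dual \<Omega>" and G: "G \<in> V_dual \<Omega>"
  obtain C D where C: "\<forall>f\<in>V \<Omega>. \<bar>F f\<bar> \<le> C * V_norm \<Omega> f" and D: "\<forall>f\<in>V \<Omega>. \<bar>G f\<bar> \<le> D * V_norm \<Omega> f"
    using F G by (auto simp: dual_space_def)
  have "\<bar>F f - G f\<bar> \<le> (C + D) * V_norm \<Omega> f" if "f \<in> V \<Omega>" for f
  proof -
    have "\<bar>F f\<bar> \<le> C * V_norm \<Omega> f" "\<bar>G f\<bar> \<le> D * V_norm \<Omega> f" using C D that by auto
    then show ?thesis unfolding distrib_right by linarith
  qed
  then show "(\<lambda>x. F x - G x) \<in> V_dual \<Omega>"
    using V_dual_linear[OF F] V_dual_linear[OF G]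
    by (auto simp: dual_space_def algebra_simps intro!: exI[of _ "C + D"])
  show "V_dual_norm \<Omega> (\<lambda>x. F x - G x) \<le> V_dual_norm \<Omega> F + V_dual_norm \<Omega> G"
    unfolding dual_norm_def[of _ _ "\<lambda>x. F x - G x"]
  proof (rule cSUP_least[OF ne])
    fix f assume "f \<in> {f \<in> V \<Omega>. V_norm \<Omega> f \<le> 1}"
    then have "\<bar>F f\<bar> \<le> V_dual_norm \<Omega> F" "\<bar>G f\<bar> \<le> V_dual_norm \<Omega> G"
      unfolding dual_norm_def by (auto intro!: cSUP_upper V_dual_bdd F G)
    then show "\<bar>F f - G f\<bar> \<le> V_dual_norm \<Omega> F + V_dual_norm \<Omega> G" by linarith
  qed
next
  fix F assume F: "F \<in> V_dual \<Omega>"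
  have "\<bar>F (\<lambda>x. 0)\<bar> \<le> V_dual_norm \<Omega> F"
    unfolding dual_norm_def by (rule cSUP_upper[OF _ V_dual_bdd[OF F]]) (use V_nonempty in auto)
  then show "0 \<le> V_dual_norm \<Omega> F" by linarith
qed (simp add: dual_norm_def abs_minus_commute)

text \<open>The one-sided Lions-Magenes inequality: only backward differences of \<open>w\<close> are tested with
  \<open>w\<close> itself, and \<open>N t - N (t - h) \<le> \<integral>\<^bsub>t - h\<^esub>\<^bsup>t\<^esup> g(\<tau>)(z(t)) d\<tau>\<close> for \<open>N = \<parallel>w\<parallel>\<^sup>2 / 2\<close> is averaged
  over \<open>t\<close>.\<close>

lemma energy_inequality:
  assumes T: "T > 0"
    and z: "z \<in> bochner_L2 T (V \<Omega>) (V_norm \<Omega>)"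
    and g: "g \<in> bochner_L2 T (V_dual \<Omega>) (V_dual_norm \<Omega>)"
    and weak: "\<And>\<eta> \<psi>. \<eta> \<in> test_functions {0<..<T} \<Longrightarrow> \<psi> \<in> V \<Omega> \<Longrightarrow>
      (LINT t|J 0 T. deriv \<eta> t * (LINT x|M. z t x \<bullet> \<psi> x)) = - (LINT t|J 0 T. \<eta> t * g t \<psi>)"
    and w: "\<And>t. t \<in> {0..T} \<Longrightarrow> w t \<in> Lp \<Omega> 2"
    and w_cont: "\<And>t. t \<in> {0..T} \<Longrightarrow> ((\<lambda>s. Lp_norm \<Omega> 2 (\<lambda>x. w s x - w t x)) \<longlongrightarrow> 0) (at t within {0..T})"
    and wz: "AE t in J 0 T. AE x in M. w t x = z t x"
  shows "integrable (J 0 T) (\<lambda>t. g t (z t))"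
    and "- ((Lp_norm \<Omega> 2 (w 0))\<^sup>2 / 2) \<le> (LINT t|J 0 T. g t (z t))"
proof -
  interpret VS: seminormed_functions "V \<Omega>" "V_norm \<Omega>" by (rule seminormed_V)
  interpret DS: seminormed_functions "V_dual \<Omega>" "V_dual_norm \<Omega>" by (rule seminormed_V_dual)
  have const: "integrable (J a b) (\<lambda>t. k)" for a b k :: real
    by (rule integrable_J_continuous_UNIV) (rule continuous_on_const)

  \<comment> \<open>Measurability and integrability of pairings with the time derivative\<close>
  define G where "G t = V_dual_norm \<Omega> (g t)" for t
  have gX: "AE t in J 0 T. g t \<in> V_dual \<Omega>" and G2: "integrable (J 0 T) (\<lambda>t. (G t)\<^sup>2)"
    using g by (auto simp: bochner_L2_def G_def)
  have zX: "AE t in J 0 T. z t \<in> V \<Omega>" and z2: "integrable (J 0 T) (\<lambda>t. (V_norm \<Omega> (z t))\<^sup>2)"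
    using z by (auto simp: bochner_L2_def)
  have Gm [measurable]: "G \<in> borel_measurable (J 0 T)"
    unfolding G_def by (rule DS.bochner_measurable_norm[OF g])

  have g_meas: "(\<lambda>t. g t (k t)) \<in> borel_measurable (J 0 T)"
    if k: "simple_function (J 0 T) k" and kX: "\<And>t. t \<in> {0<..<T} \<Longrightarrow> k t \<in> V \<Omega>" for k
  proof (rule DS.bochner_measurable[where F = "\<lambda>\<psi> \<gamma>. \<gamma> \<psi>", OF g k])
    fix t F and s :: "nat \<Rightarrow> vfield \<Rightarrow> real"
    assume a: "t \<in> {0<..<T}" "F \<in> V_dual \<Omega>" "\<And>n. s n \<in> V_dual \<Omega>"
      "(\<lambda>n. V_dual_norm \<Omega> (\<lambda>x. s n x - F x)) \<longlonglongrightarrow> 0"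
    have "\<bar>s n (k t) - F (k t)\<bar> \<le> V_dual_norm \<Omega> (\<lambda>x. s n x - F x) * V_norm \<Omega> (k t)" for n
      by (rule V_dual_le[OF DS.diff[OF a(3,2)] kX[OF a(1)]])
    then have "(\<lambda>n. s n (k t) - F (k t)) \<longlonglongrightarrow> 0"
      by (intro Lim_null_comparison[OF _ tendsto_mult_left_zero[OF a(4), of "V_norm \<Omega> (k t)"]]) auto
    then show "(\<lambda>n. s n (k t)) \<longlonglongrightarrow> F (k t)" by (rule LIM_zero_cancel)
  qed
  have g_int: "integrable (J 0 T) (\<lambda>t. g t \<psi>)" if \<psi>: "\<psi> \<in> V \<Omega>" for \<psi>
  proof (rule Bochner_Integration.integrable_bound)
    show "integrable (J 0 T) (\<lambda>t. (1 + (G t)\<^sup>2) * V_norm \<Omega> \<psi>)"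
      using G2 const by (intro integrable_mult_left Bochner_Integration.integrable_add)
    show "(\<lambda>t. g t \<psi>) \<in> borel_measurable (J 0 T)" using g_meas[of "\<lambda>t. \<psi>"] \<psi> by simp
    show "AE t in J 0 T. norm (g t \<psi>) \<le> norm ((1 + (G t)\<^sup>2) * V_norm \<Omega> \<psi>)"
      using gX
    proof eventually_elim
      case (elim t)
      have "G t \<le> 1 + (G t)\<^sup>2"
        using sum_squares_bound[of 1 "G t"] zero_le_power2[of "G t"] by (simp only: power_one mult_1_right)
      then have "G t * V_norm \<Omega> \<psi> \<le> (1 + (G t)\<^sup>2) * V_norm \<Omega> \<psi>" by (rule mult_right_mono) simp
      then show ?case using V_dual_le[OF elim \<psi>] by (simp add: G_def)
    qed
  qed

  \<comment> \<open>Scalar increments of the continuous representative\<close>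
  define m where "m \<psi> t = (LINT x|M. w t x \<bullet> \<psi> x)" for \<psi> t
  have m_cont: "continuous_on {0..T} (m \<psi>)" if \<psi>: "\<psi> \<in> V \<Omega>" for \<psi>
    unfolding continuous_on_def
  proof (intro ballI)
    fix t assume t: "t \<in> {0..T}"
    have "\<forall>\<^sub>F s in at t within {0..T}. norm (m \<psi> s - m \<psi> t) \<le> Lp_norm \<Omega> 2 (\<lambda>x. w s x - w t x) * Lp_norm \<Omega> 2 \<psi>"
      unfolding eventually_at_filter
    proof (intro always_eventually allI impI)
      fix s assume s: "s \<in> {0..T}"
      have "m \<psi> s - m \<psi> t = (LINT x|M. (w s x - w t x) \<bullet> \<psi> x)"
        unfolding m_def inner_diff_left using Lp2_integrable_inner[OF w V_D(2)[OF \<psi>]] s t by simp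
      then show "norm (m \<psi> s - m \<psi> t) \<le> Lp_norm \<Omega> 2 (\<lambda>x. w s x - w t x) * Lp_norm \<Omega> 2 \<psi>"
        using Lp2_Cauchy_Schwarz[OF Lp2_diff[OF w[OF s] w[OF t]] V_D(2)[OF \<psi>]] by simp
    qed
    then have "((\<lambda>s. m \<psi> s - m \<psi> t) \<longlongrightarrow> 0) (at t within {0..T})"
      by (rule Lim_null_comparison[OF _ tendsto_mult_left_zero[OF w_cont[OF t]]])
    then show "(m \<psi> \<longlongrightarrow> m \<psi> t) (at t within {0..T})" by (rule LIM_zero_cancel)
  qed
  define E where "E t = (Lp_norm \<Omega> 2 (w t))\<^sup>2 / 2" for t
  have E_cont: "continuous_on {0..T} E"
  proof -
    interpret L: seminormed_functions "Lp \<Omega> 2" "Lp_norm \<Omega> 2" by (rule seminormed_Lp2)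
    have "continuous_on {0..T} (\<lambda>t. Lp_norm \<Omega> 2 (w t))"
      unfolding continuous_on_def
    proof (intro ballI)
      fix t assume t: "t \<in> {0..T}"
      have "\<forall>\<^sub>F s in at t within {0..T}. norm (Lp_norm \<Omega> 2 (w s) - Lp_norm \<Omega> 2 (w t)) \<le> Lp_norm \<Omega> 2 (\<lambda>x. w s x - w t x)"
        unfolding eventually_at_filter using L.N_abs_diff[OF w w[OF t]] by (auto intro!: always_eventually)
      then have "((\<lambda>s. Lp_norm \<Omega> 2 (w s) - Lp_norm \<Omega> 2 (w t)) \<longlongrightarrow> 0) (at t within {0..T})"
        by (rule Lim_null_comparison[OF _ w_cont[OF t]])
      then show "((\<lambda>t. Lp_norm \<Omega> 2 (w t)) \<longlongrightarrow> Lp_norm \<Omega> 2 (w t)) (at t within {0..T})" by (rule LIM_zero_cancel)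
    qed
    then show ?thesis unfolding E_def by (intro continuous_intros) auto
  qed
  \<comment> \<open>The quantifier over f stands inside, so the exceptional times do not depend on
    the field tested with.\<close>
  have wz': "AE t in J 0 T. \<forall>f\<in>Lp \<Omega> 2. (LINT x|M. f x \<bullet> w t x) = (LINT x|M. f x \<bullet> z t x)"
    using wz zX AE_space
  proof eventually_elim
    case (elim t)
    then have t: "t \<in> {0..T}" by auto
    show ?case
    proof (intro ballI)
      fix f :: vfield assume f: "f \<in> Lp \<Omega> 2"
      show "(LINT x|M. f x \<bullet> w t x) = (LINT x|M. f x \<bullet> z t x)"
      proof (rule integral_cong_AE)
        show "(\<lambda>x. f x \<bullet> w t x) \<in> borel_measurable M" "(\<lambda>x. f x \<bullet> z t x) \<in> borel_measurable M"
          using Lp2_integrable_inner[OF f w[OF t]] Lp2_integrable_inner[OF f V_D(2)[OF elim(2)]] by auto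
        show "AE x in M. f x \<bullet> w t x = f x \<bullet> z t x" using elim(1) by eventually_elim simp
      qed
    qed
  qed
  \<comment> \<open>Continuity of \<open>m \<psi>\<close> gives this for every pair of times and
    every field without an exceptional set, so later \<open>\<psi>\<close> may be \<open>z t\<close>
    although that field depends on the endpoint t.\<close>
  have increment: "m \<psi> t - m \<psi> s = integral {s..t} (\<lambda>\<tau>. g \<tau> \<psi>)"
    if \<psi>: "\<psi> \<in> V \<Omega>" and st: "0 < s" "s < t" "t < T" for \<psi> s t
  proof (rule weak_derivative_increment[OF m_cont[OF \<psi>] g_int[OF \<psi>] _ st])
    fix \<eta> assume \<eta>: "\<eta> \<in> test_functions {0<..<T}"
    have "continuous_on {0..T} (deriv \<eta>)"
      by (rule continuous_on_subset[OF test_function_deriv(2)[OF \<eta>]]) simp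
    then have "continuous_on {0..T} (\<lambda>t. deriv \<eta> t * m \<psi> t)"
      by (intro continuous_on_mult m_cont[OF \<psi>])
    then have meas: "(\<lambda>t. deriv \<eta> t * m \<psi> t) \<in> borel_measurable (J 0 T)"
      by (intro borel_measurable_integrable integrable_J_continuous)
    have eq: "AE t in J 0 T. deriv \<eta> t * m \<psi> t = deriv \<eta> t * (LINT x|M. z t x \<bullet> \<psi> x)"
      using wz' by eventually_elim (use \<psi> V_D(2)[OF \<psi>] in \<open>simp add: m_def inner_commute\<close>)
    show "(LINT t|J 0 T. deriv \<eta> t * m \<psi> t) = - (LINT t|J 0 T. \<eta> t * g t \<psi>)"
      unfolding weak[OF \<eta> \<psi>, symmetric]
      by (rule integral_cong_AE[OF meas borel_measurable_lebesgue_on_cong_AE[OF meas _ eq] eq]) simp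
  qed

  \<comment> \<open>Integrability of the pairing of the derivative with the state\<close>
  show gz: "integrable (J 0 T) (\<lambda>t. g t (z t))"
  proof (rule Bochner_Integration.integrable_bound)
    show "integrable (J 0 T) (\<lambda>t. (G t)\<^sup>2 + (V_norm \<Omega> (z t))\<^sup>2)" using G2 z2 by simp
    obtain s where s: "\<And>n. simple_function (J 0 T) (s n)" "\<And>n t. t \<in> {0<..<T} \<Longrightarrow> s n t \<in> V \<Omega>"
      "AE t in J 0 T. (\<lambda>n::nat. V_norm \<Omega> (\<lambda>x. s n t x - z t x)) \<longlonglongrightarrow> 0"
      using z unfolding bochner_L2_def by blast
    show "(\<lambda>t. g t (z t)) \<in> borel_measurable (J 0 T)"
    proof (rule borel_measurable_lebesgue_on_AE_limit)
      show "(\<lambda>t. g t (s n t)) \<in> borel_measurable (J 0 T)" for n by (rule g_meas[OF s(1,2)])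
      show "AE t in J 0 T. (\<lambda>n. g t (s n t)) \<longlonglongrightarrow> g t (z t)"
        using s(3) gX zX AE_space
      proof eventually_elim
        case (elim t)
        then have t: "t \<in> {0<..<T}" by simp
        have "\<bar>g t (s n t) - g t (z t)\<bar> \<le> G t * V_norm \<Omega> (\<lambda>x. s n t x - z t x)" for n
          using V_dual_le[OF elim(2) V_diff[OF s(2)[OF t, of n] elim(3)]] V_dual_diff[OF elim(2) s(2)[OF t, of n] elim(3)]
          by (simp add: G_def)
        then have "(\<lambda>n. g t (s n t) - g t (z t)) \<longlonglongrightarrow> 0"
          by (intro Lim_null_comparison[OF _ tendsto_mult_right_zero[OF elim(1), of "G t"]]) auto
        then show ?case by (rule LIM_zero_cancel)
      qed
    qed simp
    show "AE t in J 0 T. norm (g t (z t)) \<le> norm ((G t)\<^sup>2 + (V_norm \<Omega> (z t))\<^sup>2)"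
      using gX zX
    proof eventually_elim
      case (elim t)
      have "\<bar>g t (z t)\<bar> \<le> G t * V_norm \<Omega> (z t)" unfolding G_def by (rule V_dual_le[OF elim])
      moreover have "2 * (G t * V_norm \<Omega> (z t)) \<le> (G t)\<^sup>2 + (V_norm \<Omega> (z t))\<^sup>2"
        using sum_squares_bound[of "G t" "V_norm \<Omega> (z t)"] by simp
      moreover have "0 \<le> \<bar>g t (z t)\<bar>" by simp
      ultimately have "\<bar>g t (z t)\<bar> \<le> (G t)\<^sup>2 + (V_norm \<Omega> (z t))\<^sup>2" by linarith
      then show ?case by simp
    qed
  qed

  \<comment> \<open>Approximation by a simple function and the pointwise inequality\<close>
  define I where "I = (LINT t|J 0 T. (G t)\<^sup>2)"
  have I0: "0 \<le> I" by (simp add: I_def)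
  \<comment> \<open>The 4 collects one e each for the initial strip, the endpoint of the integral
    and the finite sum of averages, plus two halves from replacing z by the simple function. The two
    replacements also cost e/2 times \<open>I\<close> each.\<close>
  have main: "- E 0 \<le> (LINT t|J 0 T. g t (z t)) + e * (I + 4)" if e: "e > 0" for e :: real
  proof -
    have e2: "e\<^sup>2 > 0" using e by simp
    obtain s where s: "simple_function (J 0 T) s" "\<And>t. t \<in> {0<..<T} \<Longrightarrow> s t \<in> V \<Omega>"
      "integrable (J 0 T) (\<lambda>t. (V_norm \<Omega> (\<lambda>x. s t x - z t x))\<^sup>2)"
      "(LINT t|J 0 T. (V_norm \<Omega> (\<lambda>x. s t x - z t x))\<^sup>2) < e\<^sup>2"
      using VS.bochner_approximation[OF z T e2] by blast
    define r where "r t = V_norm \<Omega> (\<lambda>x. s t x - z t x)" for t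
    \<comment> \<open>Finiteness of the value set is the point of the approximation: the L1
      convergence of averages is needed for finitely many fixed fields only.\<close>
    define R where "R = s ` {0<..<T}"
    have R: "finite R" "R \<subseteq> V \<Omega>"
      using simple_functionD(1)[OF s(1)] s(2) by (auto simp: R_def)
    have r2: "integrable (J 0 T) (\<lambda>t. (r t)\<^sup>2)" "(LINT t|J 0 T. (r t)\<^sup>2) \<le> e\<^sup>2"
      using s(3,4) by (auto simp: r_def)
    define P where "P \<psi> t = integral {0..t} (\<lambda>\<tau>. g \<tau> \<psi>)" for \<psi> t
    define Q where "Q t = integral {0..t} (\<lambda>\<tau>. (G \<tau>)\<^sup>2)" for t
    \<comment> \<open>The product G(tau) r(t) is split into a function of tau, to be averaged
      backwards, and a function of t. The weight e is balanced by the bound e^2 on the integral of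
      r^2.\<close>
    have young: "G' * r' \<le> e / 2 * G'\<^sup>2 + r'\<^sup>2 / (2 * e)" for G' r' :: real
    proof -
      have "0 \<le> (e * G' - r')\<^sup>2 / (2 * e)" using e by simp
      also have "\<dots> = e / 2 * G'\<^sup>2 + r'\<^sup>2 / (2 * e) - G' * r'"
        using e by (simp add: field_simps power2_eq_square)
      finally show ?thesis by simp
    qed
    have replace: "\<bar>\<gamma> (z t) - \<gamma> (s t)\<bar> \<le> e / 2 * (V_dual_norm \<Omega> \<gamma>)\<^sup>2 + (r t)\<^sup>2 / (2 * e)"
      if "\<gamma> \<in> V_dual \<Omega>" "z t \<in> V \<Omega>" "t \<in> {0<..<T}" for \<gamma> t
    proof -
      have "\<bar>\<gamma> (s t) - \<gamma> (z t)\<bar> \<le> V_dual_norm \<Omega> \<gamma> * r t"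
        using V_dual_le[OF that(1) V_diff[OF s(2)[OF that(3)] that(2)]]
          V_dual_diff[OF that(1) s(2)[OF that(3)] that(2)] by (simp add: r_def)
      then show ?thesis using young[of "V_dual_norm \<Omega> \<gamma>" "r t"] by linarith
    qed
    have gs: "integrable (J 0 T) (\<lambda>t. g t (s t))"
    proof (rule Bochner_Integration.integrable_bound)
      show "integrable (J 0 T) (\<lambda>t. \<bar>g t (z t)\<bar> + (e / 2 * (G t)\<^sup>2 + (r t)\<^sup>2 / (2 * e)))"
        using gz G2 r2(1) by simp
      show "(\<lambda>t. g t (s t)) \<in> borel_measurable (J 0 T)" by (rule g_meas[OF s(1,2)])
      show "AE t in J 0 T. norm (g t (s t)) \<le> norm (\<bar>g t (z t)\<bar> + (e / 2 * (G t)\<^sup>2 + (r t)\<^sup>2 / (2 * e)))"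
        using gX zX AE_space
      proof eventually_elim
        case (elim t)
        then show ?case using replace[of "g t" t] by (simp add: G_def)
      qed
    qed
    have step8: "(LINT t|J 0 T. g t (s t)) \<le> (LINT t|J 0 T. g t (z t)) + (e / 2 * I + e / 2)"
    proof -
      have "(LINT t|J 0 T. g t (s t)) \<le> (LINT t|J 0 T. g t (z t) + (e / 2 * (G t)\<^sup>2 + (r t)\<^sup>2 / (2 * e)))"
      proof (rule integral_mono_AE)
        show "AE t in J 0 T. g t (s t) \<le> g t (z t) + (e / 2 * (G t)\<^sup>2 + (r t)\<^sup>2 / (2 * e))"
          using gX zX AE_space
        proof eventually_elim
          case (elim t)
          then show ?case using replace[of "g t" t] by (simp add: G_def abs_le_iff)
        qed
      qed (use gs gz G2 r2(1) in auto)
      also have "\<dots> = (LINT t|J 0 T. g t (z t)) + (e / 2 * I + (LINT t|J 0 T. (r t)\<^sup>2) / (2 * e))"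
        using gz G2 r2(1) by (simp add: I_def)
      also have "(LINT t|J 0 T. (r t)\<^sup>2) / (2 * e) \<le> e\<^sup>2 / (2 * e)"
        using r2(2) e by (intro divide_right_mono) auto
      finally show ?thesis using e by (simp add: power2_eq_square)
    qed
    \<comment> \<open>The sum over \<open>R\<close> dominates the one summand belonging to the value
      \<open>s t\<close>, which makes the averaging error independent of which value is taken at
      t.\<close>
    have pointwise: "AE t in J h T. (E t - E (t - h)) / h \<le> g t (s t)
        + (\<Sum>\<psi>\<in>R. \<bar>(P \<psi> t - P \<psi> (t - h)) / h - g t \<psi>\<bar>) + e / 2 * ((Q t - Q (t - h)) / h) + (r t)\<^sup>2 / (2 * e)"
      if h: "0 < h" "h < T" for h
    proof -
      have "AE t in J h T. z t \<in> V \<Omega>"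
        "AE t in J h T. \<forall>f\<in>Lp \<Omega> 2. (LINT x|M. f x \<bullet> w t x) = (LINT x|M. f x \<bullet> z t x)"
        using zX wz' h by (auto intro: AE_J_subinterval)
      then show ?thesis using AE_space
      proof eventually_elim
        case (elim t)
        then have t: "h < t" "t < T" and zt: "z t \<in> V \<Omega>" by auto
        then have t': "t \<in> {0<..<T}" "t \<in> {0..T}" "t - h \<in> {0..T}" using h by auto
        have diff: "integral {0..t} q - integral {0..t - h} q = integral {t - h..t} q"
          if "integrable (J 0 T) q" for q :: "real \<Rightarrow> real"
          using Henstock_Kurzweil_Integration.integral_combine[of 0 "t - h" t q]
            integrable_J_HK[OF that, of 0 t] t h by auto
        have 1: "(LINT x|M. w t x \<bullet> w t x) = m (z t) t" "(LINT x|M. w (t - h) x \<bullet> w t x) = m (z t) (t - h)"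
          unfolding m_def using elim(2) zt w t' by auto
        \<comment> \<open>From the nonnegative square of w(t - h) - w(t): half the difference of
          squares is at most the inner product of w(t) - w(t - h) with w(t). The later state is the
          test field, and it may be written as z(t).\<close>
        have "E t - E (t - h) \<le> m (z t) t - m (z t) (t - h)"
          using Lp2_norm_diff_square[OF w[OF t'(3)] w[OF t'(2)]] 1
            zero_le_power2[of "Lp_norm \<Omega> 2 (\<lambda>x. w (t - h) x - w t x)"]
          unfolding E_def Lp2_inner_self by simp
        also have "\<dots> = integral {t - h..t} (\<lambda>\<tau>. g \<tau> (z t))"
          by (rule increment[OF zt]) (use t h in auto)
        also have "\<dots> \<le> integral {t - h..t} (\<lambda>\<tau>. g \<tau> (s t) + (e / 2 * (G \<tau>)\<^sup>2 + (r t)\<^sup>2 / (2 * e)))"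
        proof -
          have i1: "integrable (J (t - h) t) (\<lambda>\<tau>. g \<tau> (z t))"
            by (rule integrable_J_subinterval[OF g_int[OF zt]]) (use t h in auto)
          have i2: "integrable (J (t - h) t) (\<lambda>\<tau>. g \<tau> (s t) + (e / 2 * (G \<tau>)\<^sup>2 + (r t)\<^sup>2 / (2 * e)))"
            by (rule integrable_J_subinterval[of 0 T]) (use g_int[OF s(2)[OF t'(1)]] G2 const t h in auto)
          have "AE \<tau> in J (t - h) t. g \<tau> \<in> V_dual \<Omega>"
            by (rule AE_J_subinterval[OF gX]) (use t h in auto)
          then have "AE \<tau> in J (t - h) t. g \<tau> (z t) \<le> g \<tau> (s t) + (e / 2 * (G \<tau>)\<^sup>2 + (r t)\<^sup>2 / (2 * e))"
          proof eventually_elim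
            case (elim \<tau>)
            then show ?case using replace[OF elim zt t'(1)] by (simp add: G_def abs_le_iff)
          qed
          from integral_mono_AE[OF i1 i2 this] show ?thesis
            unfolding integral_J[OF i1] integral_J[OF i2] .
        qed
        also have "\<dots> = integral {t - h..t} (\<lambda>\<tau>. g \<tau> (s t)) + (e / 2 * integral {t - h..t} (\<lambda>\<tau>. (G \<tau>)\<^sup>2) + h * ((r t)\<^sup>2 / (2 * e)))"
        proof -
          have 1: "(\<lambda>\<tau>. g \<tau> (s t)) integrable_on {t - h..t}"
            by (rule integrable_J_HK[OF g_int[OF s(2)[OF t'(1)]]]) (use t h in auto)
          have 2: "(\<lambda>\<tau>. (G \<tau>)\<^sup>2) integrable_on {t - h..t}"
            by (rule integrable_J_HK[OF G2]) (use t h in auto)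
          have 3: "(\<lambda>\<tau>. e / 2 * (G \<tau>)\<^sup>2) integrable_on {t - h..t}"
            using integrable_cmul[OF 2, of "e / 2"] by simp
          have 4: "(\<lambda>\<tau>. (r t)\<^sup>2 / (2 * e)) integrable_on {t - h..t}" by (rule integrable_const_ivl)
          show ?thesis
            using h unfolding Henstock_Kurzweil_Integration.integral_add[OF 1 Henstock_Kurzweil_Integration.integrable_add[OF 3 4]]
              Henstock_Kurzweil_Integration.integral_add[OF 3 4] by simp
        qed
        also have "\<dots> = (P (s t) t - P (s t) (t - h)) + (e / 2 * (Q t - Q (t - h)) + h * ((r t)\<^sup>2 / (2 * e)))"
          unfolding P_def Q_def diff[OF g_int[OF s(2)[OF t'(1)]]] diff[OF G2] ..
        finally have "(E t - E (t - h)) / h \<le>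
            ((P (s t) t - P (s t) (t - h)) + (e / 2 * (Q t - Q (t - h)) + h * ((r t)\<^sup>2 / (2 * e)))) / h"
          using h by (intro divide_right_mono) auto
        also have "\<dots> = (P (s t) t - P (s t) (t - h)) / h + e / 2 * ((Q t - Q (t - h)) / h) + (r t)\<^sup>2 / (2 * e)"
          using h by (simp add: add_divide_distrib)
        finally have 2: "(E t - E (t - h)) / h \<le> (P (s t) t - P (s t) (t - h)) / h + e / 2 * ((Q t - Q (t - h)) / h) + (r t)\<^sup>2 / (2 * e)" .
        have "s t \<in> R" using t' by (auto simp: R_def)
        from member_le_sum[OF this _ R(1), of "\<lambda>\<psi>. \<bar>(P \<psi> t - P \<psi> (t - h)) / h - g t \<psi>\<bar>"]
        have "\<bar>(P (s t) t - P (s t) (t - h)) / h - g t (s t)\<bar> \<le> (\<Sum>\<psi>\<in>R. \<bar>(P \<psi> t - P \<psi> (t - h)) / h - g t \<psi>\<bar>)" by simp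
        with 2 show ?case by linarith
      qed
    qed

    \<comment> \<open>Choice of the step h\<close>
    have P_cont: "continuous_on {0..T} (P \<psi>)" if "\<psi> \<in> V \<Omega>" for \<psi>
      unfolding P_def by (rule indefinite_integral_continuous_1[OF integrable_J_HK[OF g_int[OF that]]]) auto
    have Q_cont: "continuous_on {0..T} Q"
      unfolding Q_def by (rule indefinite_integral_continuous_1[OF integrable_J_HK[OF G2]]) auto
    \<comment> \<open>An equal share of e for each value in \<open>R\<close>; the added 1 keeps the
      denominator positive.\<close>
    define d where "d = e / (real (card R) + 1)"
    have d: "d > 0" using e by (simp add: d_def add_nonneg_pos)
    have "\<forall>\<^sub>F h in at_right 0. \<forall>\<psi>\<in>R. (LINT t|J h T. \<bar>(P \<psi> t - P \<psi> (t - h)) / h - g t \<psi>\<bar>) < d"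
    proof (rule eventually_ball_finite[OF R(1)], intro ballI)
      fix \<psi> assume "\<psi> \<in> R"
      then have "\<psi> \<in> V \<Omega>" using R by auto
      then show "\<forall>\<^sub>F h in at_right 0. (LINT t|J h T. \<bar>(P \<psi> t - P \<psi> (t - h)) / h - g t \<psi>\<bar>) < d"
        unfolding P_def by (intro average_tendsto_L1 g_int T d)
    qed
    moreover have "\<forall>\<^sub>F h in at_right 0. (LINT t|J h T. g t (s t)) < (LINT t|J 0 T. g t (s t)) + e"
      by (rule order_tendstoD(2)[OF integral_J_continuous_endpoint[OF gs T]]) (use e in simp)
    moreover have "\<forall>\<^sub>F h in at_right 0. \<forall>t\<in>{0..h}. E t \<le> E 0 + e"
    proof -
      have "(E \<longlongrightarrow> E 0) (at 0 within {0..T})" using E_cont T by (auto simp: continuous_on)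
      then have "\<forall>\<^sub>F t in at 0 within {0..T}. E t < E 0 + e" by (rule order_tendstoD(2)) (use e in simp)
      then obtain b where b: "b > 0" "\<And>t. t \<in> {0..T} \<Longrightarrow> t \<noteq> 0 \<Longrightarrow> dist t 0 < b \<Longrightarrow> E t < E 0 + e"
        unfolding eventually_at by auto
      show ?thesis
      proof (rule eventually_at_rightI[of 0 "min b T"])
        fix h assume h: "h \<in> {0<..<min b T}"
        show "\<forall>t\<in>{0..h}. E t \<le> E 0 + e"
        proof
          fix t assume t: "t \<in> {0..h}"
          show "E t \<le> E 0 + e"
            using b(2)[of t] t h e by (cases "t = 0") (auto simp: dist_real_def)
        qed
      qed (use b T in auto)
    qed
    moreover have "\<forall>\<^sub>F h in at_right 0. h \<in> {0<..<T}"
      by (rule eventually_at_rightI[of 0 T]) (use T in auto)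
    ultimately have "\<forall>\<^sub>F h in at_right 0. (\<forall>\<psi>\<in>R. (LINT t|J h T. \<bar>(P \<psi> t - P \<psi> (t - h)) / h - g t \<psi>\<bar>) < d) \<and>
        (LINT t|J h T. g t (s t)) < (LINT t|J 0 T. g t (s t)) + e \<and> (\<forall>t\<in>{0..h}. E t \<le> E 0 + e) \<and> h \<in> {0<..<T}"
      by eventually_elim blast
    from eventually_happens'[OF _ this] obtain h where "(\<forall>\<psi>\<in>R. (LINT t|J h T. \<bar>(P \<psi> t - P \<psi> (t - h)) / h - g t \<psi>\<bar>) < d) \<and>
        (LINT t|J h T. g t (s t)) < (LINT t|J 0 T. g t (s t)) + e \<and> (\<forall>t\<in>{0..h}. E t \<le> E 0 + e) \<and> h \<in> {0<..<T}"
      by (auto simp: trivial_limit_at_right_real)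
    then have hR: "\<And>\<psi>. \<psi> \<in> R \<Longrightarrow> (LINT t|J h T. \<bar>(P \<psi> t - P \<psi> (t - h)) / h - g t \<psi>\<bar>) < d"
      and hs: "(LINT t|J h T. g t (s t)) < (LINT t|J 0 T. g t (s t)) + e"
      and hE: "\<And>t. t \<in> {0..h} \<Longrightarrow> E t \<le> E 0 + e" and h: "0 < h" "h < T"
      by auto

    \<comment> \<open>Integration of the pointwise inequality\<close>
    have iE: "integrable (J h T) (\<lambda>t. (E t - E (t - h)) / h)"
      using integral_shift_difference(1)[OF E_cont h] by simp
    have iQ: "integrable (J h T) (\<lambda>t. (Q t - Q (t - h)) / h)"
      using integral_shift_difference(1)[OF Q_cont h] by simp
    have iP: "integrable (J h T) (\<lambda>t. \<bar>(P \<psi> t - P \<psi> (t - h)) / h - g t \<psi>\<bar>)" if "\<psi> \<in> R" for \<psi>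
    proof -
      have \<psi>: "\<psi> \<in> V \<Omega>" using that R by auto
      have "integrable (J h T) (\<lambda>t. g t \<psi>)" by (rule integrable_J_subinterval[OF g_int[OF \<psi>]]) (use h in auto)
      then show ?thesis using integral_shift_difference(1)[OF P_cont[OF \<psi>] h] by simp
    qed
    have igs: "integrable (J h T) (\<lambda>t. g t (s t))" by (rule integrable_J_subinterval[OF gs]) (use h in auto)
    have ir: "integrable (J h T) (\<lambda>t. (r t)\<^sup>2)" by (rule integrable_J_subinterval[OF r2(1)]) (use h in auto)
    \<comment> \<open>The difference quotients of \<open>E\<close> telescope to two end strips: the
      one at T is nonnegative and is dropped, the one at 0 is at most h (E 0 + e).\<close>
    have "- (E 0 + e) \<le> (LINT t|J h T. (E t - E (t - h)) / h)"
    proof -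
      have "integral {0..h} E \<le> integral {0..h} (\<lambda>t. E 0 + e)"
        by (rule integral_le) (use hE h in \<open>auto intro!: integrable_continuous_real continuous_on_subset[OF E_cont]\<close>)
      moreover have "0 \<le> integral {T - h..T} E"
        by (rule Henstock_Kurzweil_Integration.integral_nonneg)
          (use h in \<open>auto intro!: integrable_continuous_real continuous_on_subset[OF E_cont] simp: E_def\<close>)
      ultimately have "- h * (E 0 + e) \<le> (LINT t|J h T. E t - E (t - h))"
        unfolding integral_shift_difference(2)[OF E_cont h] using h by simp
      then show ?thesis using h by (simp add: field_simps)
    qed
    also have "\<dots> \<le> (LINT t|J h T. g t (s t) + (\<Sum>\<psi>\<in>R. \<bar>(P \<psi> t - P \<psi> (t - h)) / h - g t \<psi>\<bar>)
        + e / 2 * ((Q t - Q (t - h)) / h) + (r t)\<^sup>2 / (2 * e))"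
      by (rule integral_mono_AE[OF iE _ pointwise[OF h]])
        (intro Bochner_Integration.integrable_add Bochner_Integration.integrable_sum integrable_mult_right
          integrable_divide igs iP iQ ir)
    also have "\<dots> = (LINT t|J h T. g t (s t)) + (\<Sum>\<psi>\<in>R. LINT t|J h T. \<bar>(P \<psi> t - P \<psi> (t - h)) / h - g t \<psi>\<bar>)
        + e / 2 * (LINT t|J h T. (Q t - Q (t - h)) / h) + (LINT t|J h T. (r t)\<^sup>2) / (2 * e)"
    proof -
      have iS: "integrable (J h T) (\<lambda>t. \<Sum>\<psi>\<in>R. \<bar>(P \<psi> t - P \<psi> (t - h)) / h - g t \<psi>\<bar>)"
        by (rule Bochner_Integration.integrable_sum[OF iP])
      have iQ': "integrable (J h T) (\<lambda>t. e / 2 * ((Q t - Q (t - h)) / h))"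
        by (rule integrable_mult_right[OF iQ])
      have ir': "integrable (J h T) (\<lambda>t. (r t)\<^sup>2 / (2 * e))" by (rule integrable_divide[OF ir])
      note add = Bochner_Integration.integrable_add[OF igs iS]
      show ?thesis
        by (simp only: Bochner_Integration.integral_add[OF Bochner_Integration.integrable_add[OF add iQ'] ir']
            Bochner_Integration.integral_add[OF add iQ'] Bochner_Integration.integral_add[OF igs iS]
            Bochner_Integration.integral_sum[OF iP] integral_mult_right_zero integral_divide_zero)
    qed
    also have "\<dots> \<le> ((LINT t|J 0 T. g t (s t)) + e) + e + e / 2 * I + e / 2"
    proof (intro add_mono)
      show "(LINT t|J h T. g t (s t)) \<le> (LINT t|J 0 T. g t (s t)) + e" using hs by simp
      have "(\<Sum>\<psi>\<in>R. LINT t|J h T. \<bar>(P \<psi> t - P \<psi> (t - h)) / h - g t \<psi>\<bar>) \<le> (\<Sum>\<psi>\<in>R. d)"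
        by (rule sum_mono) (use hR in \<open>auto intro: less_imp_le\<close>)
      also have "\<dots> = real (card R) * d" by simp
      also have "\<dots> \<le> (real (card R) + 1) * d" using d by (intro mult_right_mono) auto
      also have "\<dots> = e" unfolding d_def by (simp add: add_nonneg_eq_0_iff)
      finally show "(\<Sum>\<psi>\<in>R. LINT t|J h T. \<bar>(P \<psi> t - P \<psi> (t - h)) / h - g t \<psi>\<bar>) \<le> e" .
      have "(LINT t|J h T. Q t - Q (t - h)) \<le> h * I"
        unfolding Q_def I_def by (rule integral_average_le[OF G2 _ h]) simp
      then have "(LINT t|J h T. (Q t - Q (t - h)) / h) \<le> I" using h by (simp add: field_simps)
      then show "e / 2 * (LINT t|J h T. (Q t - Q (t - h)) / h) \<le> e / 2 * I"
        using e by (intro mult_left_mono) auto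
      have "(LINT t|J h T. (r t)\<^sup>2) \<le> e\<^sup>2"
        using integral_J_subinterval_le[OF r2(1), of h T] r2(2) h by simp
      then show "(LINT t|J h T. (r t)\<^sup>2) / (2 * e) \<le> e / 2"
        using e by (simp add: field_simps power2_eq_square)
    qed
    finally show ?thesis using step8 e by (simp add: algebra_simps)
  qed
  have "- E 0 \<le> (LINT t|J 0 T. g t (z t)) + e" if "e > 0" for e :: real
    using main[of "e / (I + 4)"] that I0 by (simp add: add_nonneg_pos)
  then have "- E 0 \<le> (LINT t|J 0 T. g t (z t))" by (rule field_le_epsilon)
  then show "- ((Lp_norm \<Omega> 2 (w 0))\<^sup>2 / 2) \<le> (LINT t|J 0 T. g t (z t))" by (simp add: E_def)
qed

end

subsection \<open>Decay of the evolution towards the stationary state\<close>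

context planar_domain
begin

lemma weighted_square_integrable:
  assumes \<rho>: "\<rho> \<in> borel_measurable M" "AE x in M. \<bar>\<rho> x\<bar> \<le> C" and f: "f \<in> Lp \<Omega> 2"
  shows "integrable M (\<lambda>x. \<rho> x * (norm (f x))\<^sup>2)"
  using Lp2_integrable_inner[OF Lp2_bounded_mult(1)[OF f \<rho>] f]
  by (simp add: power2_norm_eq_inner)

text \<open>Expansion |u - d|^2 - |v - d|^2 = |u - v|^2 + 2 (u - v, v - d), weighted and estimated
  by Cauchy-Schwarz. The quadratic and the mixed term are kept apart because they decay at different
  rates.\<close>

lemma weighted_square_diff:
  assumes \<rho>: "\<rho> \<in> borel_measurable M" "AE x in M. \<bar>\<rho> x\<bar> \<le> C" and C: "0 \<le> C"
    and u: "u \<in> Lp \<Omega> 2" and v: "v \<in> Lp \<Omega> 2" and d: "d \<in> Lp \<Omega> 2"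
  shows "\<bar>(LINT x|M. \<rho> x * (norm (u x - d x))\<^sup>2) - (LINT x|M. \<rho> x * (norm (v x - d x))\<^sup>2)\<bar>
    \<le> C * ((Lp_norm \<Omega> 2 (\<lambda>x. u x - v x))\<^sup>2 + 2 * Lp_norm \<Omega> 2 (\<lambda>x. u x - v x) * Lp_norm \<Omega> 2 (\<lambda>x. v x - d x))"
proof -
  note L = Lp2_diff[OF u v] Lp2_diff[OF v d] Lp2_diff[OF u d]
  note R = Lp2_bounded_mult[OF L(1) \<rho>]
  have "\<rho> x * (norm (u x - d x))\<^sup>2 - \<rho> x * (norm (v x - d x))\<^sup>2 =
      (\<rho> x *\<^sub>R (u x - v x)) \<bullet> (u x - v x) + 2 * ((\<rho> x *\<^sub>R (u x - v x)) \<bullet> (v x - d x))" for x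
    by (simp add: power2_norm_eq_inner inner_diff inner_commute algebra_simps)
  then have "(LINT x|M. \<rho> x * (norm (u x - d x))\<^sup>2) - (LINT x|M. \<rho> x * (norm (v x - d x))\<^sup>2) =
      (LINT x|M. (\<rho> x *\<^sub>R (u x - v x)) \<bullet> (u x - v x) + 2 * ((\<rho> x *\<^sub>R (u x - v x)) \<bullet> (v x - d x)))"
    using weighted_square_integrable[OF \<rho> L(2)] weighted_square_integrable[OF \<rho> L(3)]
    by (subst Bochner_Integration.integral_diff[symmetric]) simp_all
  also have "\<dots> = (LINT x|M. (\<rho> x *\<^sub>R (u x - v x)) \<bullet> (u x - v x)) + 2 * (LINT x|M. (\<rho> x *\<^sub>R (u x - v x)) \<bullet> (v x - d x))"
    using Lp2_integrable_inner[OF R(1) L(1)] Lp2_integrable_inner[OF R(1) L(2)]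
    by (subst Bochner_Integration.integral_add) simp_all
  finally have eq: "(LINT x|M. \<rho> x * (norm (u x - d x))\<^sup>2) - (LINT x|M. \<rho> x * (norm (v x - d x))\<^sup>2) = \<dots>" .
  have "\<bar>LINT x|M. (\<rho> x *\<^sub>R (u x - v x)) \<bullet> y x\<bar> \<le> C * Lp_norm \<Omega> 2 (\<lambda>x. u x - v x) * Lp_norm \<Omega> 2 y"
    if "y \<in> Lp \<Omega> 2" for y
    using Lp2_Cauchy_Schwarz[OF R(1) that] mult_right_mono[OF R(2), of "Lp_norm \<Omega> 2 y"] C by simp
  from this[OF L(1)] this[OF L(2)] show ?thesis
    unfolding eq by (simp add: algebra_simps power2_eq_square)
qed

end

context navier_stokes
begin

lemma Lp2_norm_V_le: "v \<in> V \<Omega> \<Longrightarrow> Lp_norm \<Omega> 2 v \<le> cP * V_norm \<Omega> v"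
  by (rule cP[OF V_D(1)])

text \<open>By Poincare and \<open>weighted_square_diff\<close> the functional is continuous along
  sequences converging in \<open>V_norm\<close>, so it may be composed with a Bochner function
  without joint measurability in time and space.\<close>

lemma weighted_square_bochner_measurable:
  assumes \<rho>: "\<rho> \<in> borel_measurable M" "AE x in M. \<bar>\<rho> x\<bar> \<le> C" and C: "0 \<le> C" and d: "d \<in> Lp \<Omega> 2"
    and u: "u \<in> bochner_L2 T (V \<Omega>) (V_norm \<Omega>)"
  shows "(\<lambda>t. LINT x|M. \<rho> x * (norm (u t x - d x))\<^sup>2) \<in> borel_measurable (J 0 T)"
proof -
  interpret VS: seminormed_functions "V \<Omega>" "V_norm \<Omega>" by (rule seminormed_V)
  show ?thesis
  proof (rule VS.bochner_measurable[where k = "\<lambda>t. ()" and F = "\<lambda>_ v. LINT x|M. \<rho> x * (norm (v x - d x))\<^sup>2", OF u])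
    fix f and s :: "nat \<Rightarrow> vfield"
    assume f: "f \<in> V \<Omega>" and s: "\<And>n. s n \<in> V \<Omega>" and lim: "(\<lambda>n. V_norm \<Omega> (\<lambda>x. s n x - f x)) \<longlonglongrightarrow> 0"
    define p where "p n = Lp_norm \<Omega> 2 (\<lambda>x. s n x - f x)" for n
    have "p \<longlonglongrightarrow> 0"
    proof (rule tendsto_sandwich[OF _ _ tendsto_const tendsto_mult_right_zero[OF lim, of cP]])
      show "\<forall>\<^sub>F n in sequentially. p n \<le> cP * V_norm \<Omega> (\<lambda>x. s n x - f x)"
        unfolding p_def using Lp2_norm_V_le[OF V_diff[OF s f]] by simp
    qed (simp add: p_def)
    then have "(\<lambda>n. C * ((p n)\<^sup>2 + 2 * p n * Lp_norm \<Omega> 2 (\<lambda>x. f x - d x))) \<longlonglongrightarrow>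
        C * (0\<^sup>2 + 2 * 0 * Lp_norm \<Omega> 2 (\<lambda>x. f x - d x))"
      by (intro tendsto_intros)
    then have bound_lim: "(\<lambda>n. C * ((p n)\<^sup>2 + 2 * p n * Lp_norm \<Omega> 2 (\<lambda>x. f x - d x))) \<longlonglongrightarrow> 0" by simp
    have "(\<lambda>n. (LINT x|M. \<rho> x * (norm (s n x - d x))\<^sup>2) - (LINT x|M. \<rho> x * (norm (f x - d x))\<^sup>2)) \<longlonglongrightarrow> 0"
      by (rule Lim_null_comparison[OF always_eventually bound_lim], rule allI, unfold real_norm_def p_def,
          rule weighted_square_diff[OF \<rho> C V_D(2)[OF s] V_D(2)[OF f] d])
    then show "(\<lambda>n. LINT x|M. \<rho> x * (norm (s n x - d x))\<^sup>2) \<longlonglongrightarrow> (LINT x|M. \<rho> x * (norm (f x - d x))\<^sup>2)"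
      by (rule LIM_zero_cancel)
  qed auto
qed

text \<open>The mixed term of the quadratic functional is split by Young's inequality with weight
  \<open>sqrt T\<close>.\<close>

lemma time_average_weighted_square:
  assumes \<rho>: "\<rho> \<in> borel_measurable M" "AE x in M. \<bar>\<rho> x\<bar> \<le> C" and C: "0 \<le> C" and d: "d \<in> Lp \<Omega> 2"
    and u: "u \<in> bochner_L2 T (V \<Omega>) (V_norm \<Omega>)" and v: "v \<in> V \<Omega>" and T: "T > 0"
    and X: "(LINT t|J 0 T. (V_norm \<Omega> (\<lambda>x. u t x - v x))\<^sup>2) \<le> X"
    and D: "Lp_norm \<Omega> 2 (\<lambda>x. v x - d x) \<le> D"
  shows "\<bar>1 / T * (LINT t|J 0 T. LINT x|M. \<rho> x * (norm (u t x - d x))\<^sup>2) - (LINT x|M. \<rho> x * (norm (v x - d x))\<^sup>2)\<bar>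
    \<le> C * (cP\<^sup>2 * X / T + (cP\<^sup>2 * X + D\<^sup>2) / sqrt T)"
proof -
  interpret VS: seminormed_functions "V \<Omega>" "V_norm \<Omega>" by (rule seminormed_V)
  define Q where "Q v = (LINT x|M. \<rho> x * (norm (v x - d x))\<^sup>2)" for v
  define y where "y t = (V_norm \<Omega> (\<lambda>x. u t x - v x))\<^sup>2" for t
  have const: "integrable (J 0 T) (\<lambda>t. k)" for k :: real
    by (rule integrable_J_continuous_UNIV) (rule continuous_on_const)
  have yi: "integrable (J 0 T) y"
    using VS.bochner_diff_const[OF u v] by (simp add: bochner_L2_def y_def[abs_def])
  have uX: "AE t in J 0 T. u t \<in> V \<Omega>" using u by (simp add: bochner_L2_def)
  have Dn: "Lp_norm \<Omega> 2 (\<lambda>x. v x - d x) ^ 2 \<le> D\<^sup>2" by (rule power_mono[OF D]) simp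
  let ?b = "\<lambda>t. C * ((cP\<^sup>2 + sqrt T * cP\<^sup>2) * y t + D\<^sup>2 / sqrt T)"
  have bound: "AE t in J 0 T. \<bar>Q (u t) - Q v\<bar> \<le> ?b t"
    using uX
  proof eventually_elim
    case (elim t)
    define p where "p = Lp_norm \<Omega> 2 (\<lambda>x. u t x - v x)"
    define q where "q = Lp_norm \<Omega> 2 (\<lambda>x. v x - d x)"
    have sT: "sqrt T > 0" using T by simp
    have "p \<le> cP * V_norm \<Omega> (\<lambda>x. u t x - v x)"
      unfolding p_def by (rule Lp2_norm_V_le[OF V_diff[OF elim v]])
    from power_mono[OF this, of 2] have p2: "p\<^sup>2 \<le> cP\<^sup>2 * y t"
      by (simp add: p_def y_def power_mult_distrib)
    have "0 \<le> (sqrt T * p - q)\<^sup>2 / sqrt T" using sT by simp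
    also have "\<dots> = sqrt T * p\<^sup>2 + q\<^sup>2 / sqrt T - 2 * p * q"
    proof -
      have "(a * p - q)\<^sup>2 / a = a * p\<^sup>2 + q\<^sup>2 / a - 2 * p * q" if "a > 0" for a
        using that by (simp add: field_simps power2_eq_square)
      from this[OF sT] show ?thesis .
    qed
    finally have "2 * p * q \<le> sqrt T * p\<^sup>2 + q\<^sup>2 / sqrt T" by simp
    also have "\<dots> \<le> sqrt T * (cP\<^sup>2 * y t) + D\<^sup>2 / sqrt T"
      using p2 Dn sT unfolding q_def by (intro add_mono mult_left_mono divide_right_mono) auto
    finally have pq: "p\<^sup>2 + 2 * p * q \<le> (cP\<^sup>2 + sqrt T * cP\<^sup>2) * y t + D\<^sup>2 / sqrt T"
      using p2 by (simp add: algebra_simps)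
    have "\<bar>Q (u t) - Q v\<bar> \<le> C * (p\<^sup>2 + 2 * p * q)"
      unfolding Q_def p_def q_def by (rule weighted_square_diff[OF \<rho> C V_D(2)[OF elim] V_D(2)[OF v] d])
    also have "\<dots> \<le> ?b t" by (rule mult_left_mono[OF pq C])
    finally show ?case .
  qed
  have bi: "integrable (J 0 T) ?b" using yi const by simp
  have Qm: "(\<lambda>t. Q (u t)) \<in> borel_measurable (J 0 T)"
    unfolding Q_def by (rule weighted_square_bochner_measurable[OF \<rho> C d u])
  have Qi': "integrable (J 0 T) (\<lambda>t. Q (u t) - Q v)"
    by (rule Bochner_Integration.integrable_bound[OF bi]) (use Qm bound in \<open>auto elim!: eventually_mono\<close>)
  have Qi: "integrable (J 0 T) (\<lambda>t. Q (u t))"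
    using Bochner_Integration.integrable_add[OF Qi' const[of "Q v"]] by simp
  have mT: "measure (J 0 T) {0<..<T} = T" using T by (simp add: measure_restrict_space)
  have "1 / T * (LINT t|J 0 T. Q (u t)) - Q v = 1 / T * (LINT t|J 0 T. Q (u t) - Q v)"
    using Qi const T by (simp add: mT field_simps)
  also have "\<bar>\<dots>\<bar> = 1 / T * \<bar>LINT t|J 0 T. Q (u t) - Q v\<bar>"
    using T by (simp add: abs_mult)
  also have "\<dots> \<le> 1 / T * (LINT t|J 0 T. ?b t)"
  proof (rule mult_left_mono)
    have "\<bar>LINT t|J 0 T. Q (u t) - Q v\<bar> \<le> (LINT t|J 0 T. \<bar>Q (u t) - Q v\<bar>)"
      by (rule integral_abs_bound)
    also have "\<dots> \<le> (LINT t|J 0 T. ?b t)"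
      by (rule integral_mono_AE[OF _ bi bound]) (use Qi' in simp)
    finally show "\<bar>LINT t|J 0 T. Q (u t) - Q v\<bar> \<le> (LINT t|J 0 T. ?b t)" .
  qed (use T in simp)
  also have "(LINT t|J 0 T. ?b t) = C * ((cP\<^sup>2 + sqrt T * cP\<^sup>2) * (LINT t|J 0 T. y t) + T * (D\<^sup>2 / sqrt T))"
    using yi const mT by simp
  also have "1 / T * \<dots> \<le> 1 / T * (C * ((cP\<^sup>2 + sqrt T * cP\<^sup>2) * X + T * (D\<^sup>2 / sqrt T)))"
    using X T C unfolding y_def by (intro mult_left_mono add_mono order_refl) auto
  also have "\<dots> = C * (cP\<^sup>2 * X / T + (cP\<^sup>2 * X + D\<^sup>2) / sqrt T)"
  proof -
    have TT: "T = sqrt T * sqrt T" "sqrt T > 0" using T by simp_all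
    \<comment> \<open>The quadratic part of the mixed term carries the factor sqrt T from Young's
      inequality; after division by T it has the same rate 1/sqrt T as the constant part.\<close>
    have e: "sqrt T / T = 1 / sqrt T" using TT by (metis divide_divide_eq_left divide_self_if less_irrefl)
    have "1 / T * (C * ((cP\<^sup>2 + sqrt T * cP\<^sup>2) * X + T * (D\<^sup>2 / sqrt T))) =
        C * (cP\<^sup>2 * X / T + (sqrt T / T) * (cP\<^sup>2 * X) + D\<^sup>2 / sqrt T)"
      using T by (simp add: field_simps)
    then show ?thesis unfolding e by (simp add: add_divide_distrib)
  qed
  finally show ?thesis unfolding Q_def .
qed

end

context navier_stokes_coefficient
begin

text \<open>The integrated energy estimate solved for the dissipation: \<open>4 / \<mu>\<close>
  inverts the surviving quarter of the viscosity, the square bounds the initial difference of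
  \<open>u0\<close> and the stationary state. Neither the design nor the horizon occurs.\<close>

definition decay_bound :: "vfield \<Rightarrow> real \<Rightarrow> real" where
  "decay_bound u0 K =
     4 / \<mu> * ((Lp_norm \<Omega> 2 u0 + cP * (cP * Lp_norm \<Omega> 2 fs / \<mu>))\<^sup>2 / 2 + cP\<^sup>2 / \<mu> * K)"

lemma stationary_Lp2_bound:
  assumes "stationary_solution \<Omega> \<mu> \<alpha> fs \<phi> v"
  shows "Lp_norm \<Omega> 2 v \<le> cP * (cP * Lp_norm \<Omega> 2 fs / \<mu>)"
proof -
  have "V_norm \<Omega> v \<le> cP * Lp_norm \<Omega> 2 fs / \<mu>"
    using stationary_bound[OF assms] \<mu>_pos by (simp add: field_simps)
  then have "cP * V_norm \<Omega> v \<le> cP * (cP * Lp_norm \<Omega> 2 fs / \<mu>)" using cP_pos by (intro mult_left_mono) auto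
  moreover have "v \<in> V \<Omega>" using assms by (simp add: stationary_solution_def)
  ultimately show ?thesis using Lp2_norm_V_le by fastforce
qed

text \<open>The stationary state is constant in time, so the derivative of u is also that of z = u -
  v. Integrating \<open>evolution_pointwise\<close> and bounding the pairing below by
  \<open>energy_inequality\<close> leaves only the initial difference and the force.\<close>

lemma evolution_decay:
  assumes \<phi>: "\<phi> \<in> \<Phi>ad \<Omega>" and T: "T > 0"
    and u: "evolution_solution \<Omega> \<mu> \<alpha> u0 f T \<phi> u" and v: "stationary_solution \<Omega> \<mu> \<alpha> fs \<phi> v"
    and u0: "u0 \<in> H \<Omega>"
    and f: "\<And>t. t > 0 \<Longrightarrow> f t \<in> Lp \<Omega> 2" "f \<in> bochner_L2 T (Lp \<Omega> 2) (Lp_norm \<Omega> 2)"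
    and K: "(LINT t|J 0 T. exp (\<sigma> * t) * (Lp_norm \<Omega> 2 (\<lambda>x. f t x - fs x))\<^sup>2) \<le> K" and \<sigma>: "\<sigma> \<ge> 0"
  shows "u \<in> bochner_L2 T (V \<Omega>) (V_norm \<Omega>)"
    and "(LINT t|J 0 T. (V_norm \<Omega> (\<lambda>x. u t x - v x))\<^sup>2) \<le> decay_bound u0 K"
proof -
  interpret VS: seminormed_functions "V \<Omega>" "V_norm \<Omega>" by (rule seminormed_V)
  interpret L: seminormed_functions "Lp \<Omega> 2" "Lp_norm \<Omega> 2" by (rule seminormed_Lp2)
  have vV: "v \<in> V \<Omega>" using v by (simp add: stationary_solution_def)
  show uB: "u \<in> bochner_L2 T (V \<Omega>) (V_norm \<Omega>)" using u by (simp add: evolution_solution_def W2_def)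
  obtain g where g: "is_time_deriv \<Omega> T u g"
    and eq: "AE t in J 0 T. \<forall>\<psi>\<in>V \<Omega>. g t \<psi> + a_form \<Omega> \<mu> \<alpha> \<phi> (u t) \<psi> + b_form \<Omega> (u t) (u t) \<psi> = (LINT x|M. f t x \<bullet> \<psi> x)"
    using u by (auto simp: evolution_solution_def)
  have "has_initial_value \<Omega> T u u0" using u by (simp add: evolution_solution_def)
  then obtain w where w': "\<forall>t\<in>{0..T}. w t \<in> H \<Omega>"
    "\<forall>t\<in>{0..T}. ((\<lambda>s. Lp_norm \<Omega> 2 (\<lambda>x. w s x - w t x)) \<longlongrightarrow> 0) (at t within {0..T})"
    and w34: "AE t in J 0 T. AE x in M. w t x = u t x" "AE x in M. w 0 x = u0 x"
    unfolding has_initial_value_def by (elim exE conjE)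
  note w = bspec[OF w'(1)] bspec[OF w'(2)] w34
  have wL: "w t \<in> Lp \<Omega> 2" if "t \<in> {0..T}" for t using w(1)[OF that] by (simp add: H_def)
  have u0L: "u0 \<in> Lp \<Omega> 2" using u0 by (simp add: H_def)
  define z where "z = (\<lambda>t x. u t x - v x)"
  have zB: "z \<in> bochner_L2 T (V \<Omega>) (V_norm \<Omega>)" unfolding z_def by (rule VS.bochner_diff_const[OF uB vV])
  have uX: "AE t in J 0 T. u t \<in> V \<Omega>" and u2: "integrable (J 0 T) (\<lambda>t. (V_norm \<Omega> (u t))\<^sup>2)"
    using uB by (auto simp: bochner_L2_def)
  have z2: "integrable (J 0 T) (\<lambda>t. (V_norm \<Omega> (z t))\<^sup>2)" using zB by (simp add: bochner_L2_def)
  have gB: "g \<in> bochner_L2 T (V_dual \<Omega>) (V_dual_norm \<Omega>)" using g by (simp add: is_time_deriv_def)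
  have const: "integrable (J 0 T) (\<lambda>t. k)" for k :: real
    by (rule integrable_J_continuous_UNIV) (rule continuous_on_const)
  have weak: "(LINT t|J 0 T. deriv \<eta> t * (LINT x|M. z t x \<bullet> \<psi> x)) = - (LINT t|J 0 T. \<eta> t * g t \<psi>)"
    if \<eta>: "\<eta> \<in> test_functions {0<..<T}" and \<psi>: "\<psi> \<in> V \<Omega>" for \<eta> \<psi>
  proof -
    define y where "y t = (LINT x|M. u t x \<bullet> \<psi> x)" for t
    have ym: "y \<in> borel_measurable (J 0 T)"
      unfolding y_def
    proof (rule VS.bochner_measurable[where k = "\<lambda>t. ()" and F = "\<lambda>_ v. LINT x|M. v x \<bullet> \<psi> x", OF uB])
      fix f and s :: "nat \<Rightarrow> vfield"
      assume f: "f \<in> V \<Omega>" and s: "\<And>n. s n \<in> V \<Omega>" and lim: "(\<lambda>n. V_norm \<Omega> (\<lambda>x. s n x - f x)) \<longlonglongrightarrow> 0"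
      have "\<bar>(LINT x|M. s n x \<bullet> \<psi> x) - (LINT x|M. f x \<bullet> \<psi> x)\<bar> \<le> V_norm \<Omega> (\<lambda>x. s n x - f x) * (cP * Lp_norm \<Omega> 2 \<psi>)" for n
      proof -
        have "(LINT x|M. s n x \<bullet> \<psi> x) - (LINT x|M. f x \<bullet> \<psi> x) = (LINT x|M. (s n x - f x) \<bullet> \<psi> x)"
          using Lp2_integrable_inner[OF V_D(2)[OF s] V_D(2)[OF \<psi>]] Lp2_integrable_inner[OF V_D(2)[OF f] V_D(2)[OF \<psi>]]
          by (simp add: inner_diff_left)
        also have "\<bar>\<dots>\<bar> \<le> Lp_norm \<Omega> 2 (\<lambda>x. s n x - f x) * Lp_norm \<Omega> 2 \<psi>"
          by (rule Lp2_Cauchy_Schwarz[OF V_D(2)[OF V_diff[OF s f]] V_D(2)[OF \<psi>]])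
        also have "\<dots> \<le> (cP * V_norm \<Omega> (\<lambda>x. s n x - f x)) * Lp_norm \<Omega> 2 \<psi>"
          by (rule mult_right_mono[OF Lp2_norm_V_le[OF V_diff[OF s f]]]) simp
        finally show ?thesis by (simp add: mult_ac)
      qed
      then have "(\<lambda>n. (LINT x|M. s n x \<bullet> \<psi> x) - (LINT x|M. f x \<bullet> \<psi> x)) \<longlonglongrightarrow> 0"
        by (intro Lim_null_comparison[OF _ tendsto_mult_left_zero[OF lim, of "cP * Lp_norm \<Omega> 2 \<psi>"]]) auto
      then show "(\<lambda>n. LINT x|M. s n x \<bullet> \<psi> x) \<longlonglongrightarrow> (LINT x|M. f x \<bullet> \<psi> x)" by (rule LIM_zero_cancel)
    qed auto
    obtain B where B: "\<And>t. t \<in> {0..T} \<Longrightarrow> \<bar>deriv \<eta> t\<bar> \<le> B"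
    proof -
      have "compact (deriv \<eta> ` {0..T})"
        by (rule compact_continuous_image[OF continuous_on_subset[OF test_function_deriv(2)[OF \<eta>]]]) auto
      then show ?thesis using that compact_imp_bounded by (fastforce simp: bounded_iff)
    qed
    have dm: "integrable (J 0 T) (deriv \<eta>)" by (rule integrable_J_continuous_UNIV[OF test_function_deriv(2)[OF \<eta>]])
    have dy: "integrable (J 0 T) (\<lambda>t. deriv \<eta> t * y t)"
    proof (rule Bochner_Integration.integrable_bound)
      show "integrable (J 0 T) (\<lambda>t. B * ((cP\<^sup>2 * (V_norm \<Omega> (u t))\<^sup>2) + (Lp_norm \<Omega> 2 \<psi>)\<^sup>2))"
        using u2 const by simp
      show "(\<lambda>t. deriv \<eta> t * y t) \<in> borel_measurable (J 0 T)"
        using dm ym by auto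
      show "AE t in J 0 T. norm (deriv \<eta> t * y t) \<le> norm (B * ((cP\<^sup>2 * (V_norm \<Omega> (u t))\<^sup>2) + (Lp_norm \<Omega> 2 \<psi>)\<^sup>2))"
        using uX AE_space
      proof eventually_elim
        case (elim t)
        then have t: "t \<in> {0..T}" by auto
        have "\<bar>y t\<bar> \<le> Lp_norm \<Omega> 2 (u t) * Lp_norm \<Omega> 2 \<psi>"
          unfolding y_def by (rule Lp2_Cauchy_Schwarz[OF V_D(2)[OF elim(1)] V_D(2)[OF \<psi>]])
        also have "\<dots> \<le> (cP * V_norm \<Omega> (u t)) * Lp_norm \<Omega> 2 \<psi>"
          by (rule mult_right_mono[OF Lp2_norm_V_le[OF elim(1)]]) simp
        also have "\<dots> \<le> (cP * V_norm \<Omega> (u t))\<^sup>2 + (Lp_norm \<Omega> 2 \<psi>)\<^sup>2"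
        proof -
          have "0 \<le> cP * V_norm \<Omega> (u t) * Lp_norm \<Omega> 2 \<psi>" using cP_pos by simp
          then show ?thesis
            using sum_squares_bound[of "cP * V_norm \<Omega> (u t)" "Lp_norm \<Omega> 2 \<psi>"] by linarith
        qed
        finally have "\<bar>y t\<bar> \<le> cP\<^sup>2 * (V_norm \<Omega> (u t))\<^sup>2 + (Lp_norm \<Omega> 2 \<psi>)\<^sup>2" by (simp add: power_mult_distrib)
        then have "\<bar>deriv \<eta> t\<bar> * \<bar>y t\<bar> \<le> B * (cP\<^sup>2 * (V_norm \<Omega> (u t))\<^sup>2 + (Lp_norm \<Omega> 2 \<psi>)\<^sup>2)"
          using B[OF t] by (intro mult_mono) auto
        then show ?case unfolding real_norm_def abs_mult[of "deriv \<eta> t"] by linarith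
      qed
    qed
    \<comment> \<open>This removes the contribution of the time-independent field from the weak
      derivative.\<close>
    have d0: "(LINT t|J 0 T. deriv \<eta> t) = 0"
    proof -
      have "(deriv \<eta> has_integral \<eta> T - \<eta> 0) {0..T}"
        by (rule fundamental_theorem_of_calculus)
          (use T test_function_deriv(1)[OF \<eta>] in \<open>auto simp: has_real_derivative_iff_has_vector_derivative[symmetric]
            intro: has_field_derivative_at_within\<close>)
      then show ?thesis
        using integral_J[OF dm] test_function_outside[OF \<eta>, of 0] test_function_outside[OF \<eta>, of T]
        by (simp add: integral_unique)
    qed
    define k where "k = (LINT x|M. v x \<bullet> \<psi> x)"
    have sub: "integrable (J 0 T) (\<lambda>t. deriv \<eta> t * y t - deriv \<eta> t * k)" using dy dm by simp
    have e: "AE t in J 0 T. deriv \<eta> t * y t - deriv \<eta> t * k = deriv \<eta> t * (LINT x|M. z t x \<bullet> \<psi> x)"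
      using uX
    proof eventually_elim
      case (elim t)
      have "(LINT x|M. z t x \<bullet> \<psi> x) = y t - k"
        unfolding y_def k_def z_def inner_diff_left
        using Lp2_integrable_inner[OF V_D(2)[OF elim] V_D(2)[OF \<psi>]] Lp2_integrable_inner[OF V_D(2)[OF vV] V_D(2)[OF \<psi>]]
        by simp
      then show ?case by (simp add: right_diff_distrib)
    qed
    have "(LINT t|J 0 T. deriv \<eta> t * (LINT x|M. z t x \<bullet> \<psi> x)) = (LINT t|J 0 T. deriv \<eta> t * y t - deriv \<eta> t * k)"
      using borel_measurable_lebesgue_on_cong_AE[OF borel_measurable_integrable[OF sub] _ e] sub e
      by (intro integral_cong_AE[symmetric]) auto
    also have "\<dots> = (LINT t|J 0 T. deriv \<eta> t * y t)" using dy dm d0 by simp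
    also have "\<dots> = - (LINT t|J 0 T. \<eta> t * g t \<psi>)"
      using g \<eta> \<psi> by (simp add: is_time_deriv_def y_def)
    finally show ?thesis .
  qed
  \<comment> \<open>The continuous representative of z, obtained by shifting that of u; its value at
    0 is the initial difference almost everywhere.\<close>
  define W where "W = (\<lambda>t x. w t x - v x)"
  note energy = energy_inequality[OF T zB gB weak, of W]
  have WL: "W t \<in> Lp \<Omega> 2" if "t \<in> {0..T}" for t
    unfolding W_def by (rule Lp2_diff[OF wL[OF that] V_D(2)[OF vV]])
  have Wc: "((\<lambda>s. Lp_norm \<Omega> 2 (\<lambda>x. W s x - W t x)) \<longlongrightarrow> 0) (at t within {0..T})" if "t \<in> {0..T}" for t
    using w(2)[OF that] by (simp add: W_def)
  have Wz: "AE t in J 0 T. AE x in M. W t x = z t x"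
    using w(3)
  proof eventually_elim
    case (elim t)
    then show ?case by eventually_elim (simp add: W_def z_def)
  qed
  have gz: "integrable (J 0 T) (\<lambda>t. g t (z t))" using energy(1)[OF _ _ WL Wc Wz] by blast
  have ge: "- ((Lp_norm \<Omega> 2 (W 0))\<^sup>2 / 2) \<le> (LINT t|J 0 T. g t (z t))" using energy(2)[OF _ _ WL Wc Wz] by blast
  define F where "F t = (Lp_norm \<Omega> 2 (\<lambda>x. f t x - fs x))\<^sup>2" for t
  have Fi: "integrable (J 0 T) F"
    using L.bochner_diff_const[OF f(2) fs] by (simp add: bochner_L2_def F_def[abs_def])
  have Fe: "integrable (J 0 T) (\<lambda>t. exp (\<sigma> * t) * F t)"
  proof (rule Bochner_Integration.integrable_bound)
    show "integrable (J 0 T) (\<lambda>t. exp (\<sigma> * T) * F t)" using Fi by simp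
    have "integrable (J 0 T) (\<lambda>t. exp (\<sigma> * t))"
      by (rule integrable_J_continuous_UNIV) (intro continuous_intros)
    then show "(\<lambda>t. exp (\<sigma> * t) * F t) \<in> borel_measurable (J 0 T)" using Fi by auto
    show "AE t in J 0 T. norm (exp (\<sigma> * t) * F t) \<le> norm (exp (\<sigma> * T) * F t)"
      using \<sigma> by (intro AE_I2) (auto simp: F_def intro!: mult_right_mono mult_left_mono)
  qed
  \<comment> \<open>The weight is at least 1 on positive times because
    \<open>\<sigma> \<ge> 0\<close>, so \<open>K\<close> bounds the unweighted integral too.\<close>
  have "(LINT t|J 0 T. F t) \<le> (LINT t|J 0 T. exp (\<sigma> * t) * F t)"
  proof (rule integral_mono[OF Fi Fe])
    fix t assume "t \<in> space (J 0 T)"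
    then have "1 \<le> exp (\<sigma> * t)" using \<sigma> by simp
    from mult_right_mono[OF this, of "F t"] show "F t \<le> exp (\<sigma> * t) * F t" by (simp add: F_def)
  qed
  then have FK: "(LINT t|J 0 T. F t) \<le> K" using K by (simp add: F_def)
  have "AE t in J 0 T. g t (z t) + \<mu> / 4 * (V_norm \<Omega> (z t))\<^sup>2 \<le> cP\<^sup>2 / \<mu> * F t"
    using eq uX AE_space
  proof eventually_elim
    case (elim t)
    then have "f t \<in> Lp \<Omega> 2" using f(1) by simp
    then show ?case
      unfolding z_def F_def using elim by (intro evolution_pointwise[OF \<phi> v]) auto
  qed
  then have "(LINT t|J 0 T. g t (z t) + \<mu> / 4 * (V_norm \<Omega> (z t))\<^sup>2) \<le> (LINT t|J 0 T. cP\<^sup>2 / \<mu> * F t)"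
    using gz z2 Fi by (intro integral_mono_AE) auto
  then have "(LINT t|J 0 T. g t (z t)) + \<mu> / 4 * (LINT t|J 0 T. (V_norm \<Omega> (z t))\<^sup>2) \<le> cP\<^sup>2 / \<mu> * (LINT t|J 0 T. F t)"
    using gz z2 Fi by simp
  also have "\<dots> \<le> cP\<^sup>2 / \<mu> * K" using FK \<mu>_pos by (intro mult_left_mono) auto
  finally have 1: "\<mu> / 4 * (LINT t|J 0 T. (V_norm \<Omega> (z t))\<^sup>2) \<le> (Lp_norm \<Omega> 2 (W 0))\<^sup>2 / 2 + cP\<^sup>2 / \<mu> * K"
    using ge by linarith
  have "Lp_norm \<Omega> 2 (W 0) = Lp_norm \<Omega> 2 (\<lambda>x. u0 x - v x)"
  proof (rule Lp2_norm_cong_AE)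
    show "W 0 \<in> Lp \<Omega> 2" using WL[of 0] T by simp
    show "(\<lambda>x. u0 x - v x) \<in> borel_measurable M" by (rule Lp2_measurable[OF Lp2_diff[OF u0L V_D(2)[OF vV]]])
    show "AE x in M. W 0 x = u0 x - v x" using w(4) by eventually_elim (simp add: W_def)
  qed
  also have "\<dots> \<le> Lp_norm \<Omega> 2 u0 + cP * (cP * Lp_norm \<Omega> 2 fs / \<mu>)"
    using Lp2_triangle_diff[OF u0L V_D(2)[OF vV]] stationary_Lp2_bound[OF v] by linarith
  finally have "(Lp_norm \<Omega> 2 (W 0))\<^sup>2 \<le> (Lp_norm \<Omega> 2 u0 + cP * (cP * Lp_norm \<Omega> 2 fs / \<mu>))\<^sup>2"
    by (rule power_mono) simp
  with 1 have "\<mu> / 4 * (LINT t|J 0 T. (V_norm \<Omega> (z t))\<^sup>2) \<le>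
      (Lp_norm \<Omega> 2 u0 + cP * (cP * Lp_norm \<Omega> 2 fs / \<mu>))\<^sup>2 / 2 + cP\<^sup>2 / \<mu> * K" by linarith
  then show "(LINT t|J 0 T. (V_norm \<Omega> (\<lambda>x. u t x - v x))\<^sup>2) \<le> decay_bound u0 K"
    unfolding decay_bound_def z_def using \<mu>_pos by (simp add: pos_divide_le_eq field_simps)
qed

end

subsection \<open>Passage to the limit\<close>

context planar_domain
begin

text \<open>States and weights converge in different senses, so they are changed one at a time:
  first the state, uniformly in the bounded weights, then the weight with the state fixed, by
  dominated convergence.\<close>

lemma weighted_square_tendsto:
  fixes \<rho> :: "nat \<Rightarrow> design"
  assumes \<rho>n: "\<And>n. \<rho> n \<in> borel_measurable M" "\<And>n. AE x in M. \<bar>\<rho> n x\<bar> \<le> C" and C: "0 \<le> C"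
    and \<rho>: "\<rho>' \<in> borel_measurable M" and conv: "AE x in M. (\<lambda>n. \<rho> n x) \<longlonglongrightarrow> \<rho>' x"
    and vn: "\<And>n. v n \<in> Lp \<Omega> 2" and v: "v' \<in> Lp \<Omega> 2" and d: "d \<in> Lp \<Omega> 2"
    and lim: "(\<lambda>n. Lp_norm \<Omega> 2 (\<lambda>x. v n x - v' x)) \<longlonglongrightarrow> 0"
  shows "(\<lambda>n. LINT x|M. \<rho> n x * (norm (v n x - d x))\<^sup>2) \<longlonglongrightarrow> (LINT x|M. \<rho>' x * (norm (v' x - d x))\<^sup>2)"
proof -
  note vd = Lp2_diff[OF v d]
  have "(\<lambda>n. C * ((Lp_norm \<Omega> 2 (\<lambda>x. v n x - v' x))\<^sup>2 + 2 * Lp_norm \<Omega> 2 (\<lambda>x. v n x - v' x) * Lp_norm \<Omega> 2 (\<lambda>x. v' x - d x)))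
      \<longlonglongrightarrow> C * (0\<^sup>2 + 2 * 0 * Lp_norm \<Omega> 2 (\<lambda>x. v' x - d x))"
    by (intro tendsto_intros lim)
  then have bound_lim: "(\<lambda>n. C * ((Lp_norm \<Omega> 2 (\<lambda>x. v n x - v' x))\<^sup>2 + 2 * Lp_norm \<Omega> 2 (\<lambda>x. v n x - v' x) * Lp_norm \<Omega> 2 (\<lambda>x. v' x - d x)))
      \<longlonglongrightarrow> 0" by simp
  have 1: "(\<lambda>n. (LINT x|M. \<rho> n x * (norm (v n x - d x))\<^sup>2) - (LINT x|M. \<rho> n x * (norm (v' x - d x))\<^sup>2)) \<longlonglongrightarrow> 0"
    by (rule Lim_null_comparison[OF always_eventually bound_lim], rule allI, unfold real_norm_def,
        rule weighted_square_diff[OF \<rho>n C vn v d])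
  have 2: "(\<lambda>n. LINT x|M. \<rho> n x * (norm (v' x - d x))\<^sup>2) \<longlonglongrightarrow> (LINT x|M. \<rho>' x * (norm (v' x - d x))\<^sup>2)"
  proof (rule integral_dominated_convergence[where w = "\<lambda>x. C * (norm (v' x - d x))\<^sup>2"])
    show "integrable M (\<lambda>x. C * (norm (v' x - d x))\<^sup>2)" using vd by (simp add: Lp2_iff)
    have [measurable]: "(\<lambda>x. v' x - d x) \<in> borel_measurable M" by (rule Lp2_measurable[OF vd])
    note [measurable] = \<rho> \<rho>n(1)
    show "(\<lambda>x. \<rho>' x * (norm (v' x - d x))\<^sup>2) \<in> borel_measurable M" by measurable
    show "(\<lambda>x. \<rho> n x * (norm (v' x - d x))\<^sup>2) \<in> borel_measurable M" for n by measurable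
    show "AE x in M. (\<lambda>n. \<rho> n x * (norm (v' x - d x))\<^sup>2) \<longlonglongrightarrow> \<rho>' x * (norm (v' x - d x))\<^sup>2"
      using conv by eventually_elim (intro tendsto_intros)
    show "AE x in M. norm (\<rho> n x * (norm (v' x - d x))\<^sup>2) \<le> C * (norm (v' x - d x))\<^sup>2" for n
      using \<rho>n(2)[of n] by eventually_elim (simp add: abs_mult mult_right_mono)
  qed
  show ?thesis using tendsto_add[OF 1 2] by simp
qed

text \<open>\<open>weak_conv_H1\<close> is phrased through functionals; this is the one that yields
  weak lower semicontinuity of the gradient term.\<close>

lemma gradient_functional_in_dual:
  assumes \<phi>: "\<phi> \<in> H1 \<Omega>"
  shows "(\<lambda>f. LINT x|M. wgrad \<Omega> \<phi> x \<bullet> wgrad \<Omega> f x) \<in> dual_space (H1 \<Omega>) (H1_norm \<Omega>)"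
proof -
  note g = H1_D(2)[OF \<phi>]
  have "(LINT x|M. wgrad \<Omega> \<phi> x \<bullet> wgrad \<Omega> (\<lambda>x. a *\<^sub>R f x + b *\<^sub>R h x) x) =
      a * (LINT x|M. wgrad \<Omega> \<phi> x \<bullet> wgrad \<Omega> f x) + b * (LINT x|M. wgrad \<Omega> \<phi> x \<bullet> wgrad \<Omega> h x)"
    if f: "f \<in> H1 \<Omega>" and h: "h \<in> H1 \<Omega>" for f h a b
  proof -
    note l = H1_lincomb[OF f h, of a b]
    note i = Lp2_integrable_inner[OF g H1_D(2)[OF f]] Lp2_integrable_inner[OF g H1_D(2)[OF h]]
    have "(LINT x|M. wgrad \<Omega> \<phi> x \<bullet> wgrad \<Omega> (\<lambda>x. a * f x + b * h x) x) =
        (LINT x|M. a * (wgrad \<Omega> \<phi> x \<bullet> wgrad \<Omega> f x) + b * (wgrad \<Omega> \<phi> x \<bullet> wgrad \<Omega> h x))"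
    proof (rule integral_cong_AE)
      show "AE x in M. wgrad \<Omega> \<phi> x \<bullet> wgrad \<Omega> (\<lambda>x. a * f x + b * h x) x =
          a * (wgrad \<Omega> \<phi> x \<bullet> wgrad \<Omega> f x) + b * (wgrad \<Omega> \<phi> x \<bullet> wgrad \<Omega> h x)"
        using l(2) by eventually_elim (simp add: inner_add_right)
      show "(\<lambda>x. wgrad \<Omega> \<phi> x \<bullet> wgrad \<Omega> (\<lambda>x. a * f x + b * h x) x) \<in> borel_measurable M"
        using Lp2_integrable_inner[OF g H1_D(2)[OF l(1)]] by auto
    qed (use i in auto)
    then show ?thesis using i by simp
  qed
  moreover have "\<bar>LINT x|M. wgrad \<Omega> \<phi> x \<bullet> wgrad \<Omega> f x\<bar> \<le> Lp_norm \<Omega> 2 (wgrad \<Omega> \<phi>) * H1_norm \<Omega> f"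
    if f: "f \<in> H1 \<Omega>" for f
  proof -
    have "\<bar>LINT x|M. wgrad \<Omega> \<phi> x \<bullet> wgrad \<Omega> f x\<bar> \<le> Lp_norm \<Omega> 2 (wgrad \<Omega> \<phi>) * Lp_norm \<Omega> 2 (wgrad \<Omega> f)"
      by (rule Lp2_Cauchy_Schwarz[OF g H1_D(2)[OF f]])
    also have "\<dots> \<le> Lp_norm \<Omega> 2 (wgrad \<Omega> \<phi>) * H1_norm \<Omega> f"
      unfolding H1_norm_def by (intro mult_left_mono real_sqrt_sum_squares_ge2) simp
    finally show ?thesis .
  qed
  ultimately show ?thesis unfolding dual_space_def by blast
qed

text \<open>\<open>max 0\<close> is the truncation that \<open>ennreal\<close> performs on the
  prefactor in \<open>energy\<close>.\<close>

definition real_energy :: "real \<Rightarrow> design \<Rightarrow> real" where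
  "real_energy \<epsilon> \<phi> = max 0 (1 / (2 * c0)) *
     (\<epsilon> / 2 * (Lp_norm \<Omega> 2 (wgrad \<Omega> \<phi>))\<^sup>2 + 1 / \<epsilon> * (LINT x|M. (1 - (\<phi> x)\<^sup>2) / 2))"

lemma design_potential_integrable:
  assumes "\<phi> \<in> \<Phi>ad \<Omega>"
  shows "integrable M (\<lambda>x. (1 - (\<phi> x)\<^sup>2) / 2)"
  using H1_D(1)[OF \<Phi>ad_D(1)[OF assms]] by (simp add: Lp2_iff)

text \<open>On designs the potential takes its infinite value only on a null set, so the extended
  integral is that of a nonnegative integrable function.\<close>

lemma energy_eq_real_energy:
  assumes \<phi>: "\<phi> \<in> \<Phi>ad \<Omega>" and \<epsilon>: "\<epsilon> > 0"
  shows "energy \<Omega> \<epsilon> \<phi> = ennreal (real_energy \<epsilon> \<phi>)" and "0 \<le> real_energy \<epsilon> \<phi>"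
proof -
  let ?e = "\<lambda>x. \<epsilon> / 2 * (norm (wgrad \<Omega> \<phi> x))\<^sup>2 + 1 / \<epsilon> * ((1 - (\<phi> x)\<^sup>2) / 2)"
  note g = H1_D(2)[OF \<Phi>ad_D(1)[OF \<phi>]]
  have i1: "integrable M (\<lambda>x. \<epsilon> / 2 * (norm (wgrad \<Omega> \<phi> x))\<^sup>2)" using g by (simp add: Lp2_iff)
  have i2: "integrable M (\<lambda>x. 1 / \<epsilon> * ((1 - (\<phi> x)\<^sup>2) / 2))"
    by (rule integrable_mult_right[OF design_potential_integrable[OF \<phi>]])
  have nonneg: "AE x in M. 0 \<le> ?e x"
    using \<Phi>ad_D(3)[OF \<phi>]
  proof eventually_elim
    case (elim x)
    then have "(\<phi> x)\<^sup>2 \<le> 1" by (simp add: abs_square_le_1)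
    then show ?case using \<epsilon> by (intro add_nonneg_nonneg mult_nonneg_nonneg) auto
  qed
  have "(\<integral>\<^sup>+ x. ennreal (\<epsilon> / 2 * (norm (wgrad \<Omega> \<phi> x))\<^sup>2) + ennreal (1 / \<epsilon>) * \<Psi> (\<phi> x) \<partial>M) = (\<integral>\<^sup>+ x. ennreal (?e x) \<partial>M)"
  proof (rule nn_integral_cong_AE)
    show "AE x in M. ennreal (\<epsilon> / 2 * (norm (wgrad \<Omega> \<phi> x))\<^sup>2) + ennreal (1 / \<epsilon>) * \<Psi> (\<phi> x) = ennreal (?e x)"
      using \<Phi>ad_D(3)[OF \<phi>]
    proof eventually_elim
      case (elim x)
      then have "(\<phi> x)\<^sup>2 \<le> 1" by (simp add: abs_square_le_1)
      then have "ennreal (1 / \<epsilon>) * \<Psi> (\<phi> x) = ennreal (1 / \<epsilon> * ((1 - (\<phi> x)\<^sup>2) / 2))" "0 \<le> 1 / \<epsilon> * ((1 - (\<phi> x)\<^sup>2) / 2)"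
        using elim \<epsilon> by (simp_all only: \<Psi>_def if_True) (subst ennreal_mult, auto)
      then show ?case using \<epsilon> by (simp add: ennreal_plus)
    qed
  qed
  also have "\<dots> = ennreal (LINT x|M. ?e x)"
    by (rule nn_integral_eq_integral[OF Bochner_Integration.integrable_add[OF i1 i2] nonneg])
  also have "(LINT x|M. ?e x) = \<epsilon> / 2 * (Lp_norm \<Omega> 2 (wgrad \<Omega> \<phi>))\<^sup>2 + 1 / \<epsilon> * (LINT x|M. (1 - (\<phi> x)\<^sup>2) / 2)"
    by (simp only: Bochner_Integration.integral_add[OF i1 i2] integral_mult_right_zero Lp_norm_2_square)
  finally have nn: "(\<integral>\<^sup>+ x. ennreal (\<epsilon> / 2 * (norm (wgrad \<Omega> \<phi> x))\<^sup>2) + ennreal (1 / \<epsilon>) * \<Psi> (\<phi> x) \<partial>M) =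
    ennreal (\<epsilon> / 2 * (Lp_norm \<Omega> 2 (wgrad \<Omega> \<phi>))\<^sup>2 + 1 / \<epsilon> * (LINT x|M. (1 - (\<phi> x)\<^sup>2) / 2))" .
  have "0 \<le> (LINT x|M. ?e x)" by (rule integral_nonneg_AE[OF nonneg])
  also have "(LINT x|M. ?e x) = \<epsilon> / 2 * (Lp_norm \<Omega> 2 (wgrad \<Omega> \<phi>))\<^sup>2 + 1 / \<epsilon> * (LINT x|M. (1 - (\<phi> x)\<^sup>2) / 2)"
    by (simp only: Bochner_Integration.integral_add[OF i1 i2] integral_mult_right_zero Lp_norm_2_square)
  finally have pos: "0 \<le> \<epsilon> / 2 * (Lp_norm \<Omega> 2 (wgrad \<Omega> \<phi>))\<^sup>2 + 1 / \<epsilon> * (LINT x|M. (1 - (\<phi> x)\<^sup>2) / 2)" .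
  show "0 \<le> real_energy \<epsilon> \<phi>" unfolding real_energy_def by (rule mult_nonneg_nonneg[OF _ pos]) simp
  show "energy \<Omega> \<epsilon> \<phi> = ennreal (real_energy \<epsilon> \<phi>)"
    unfolding energy_def nn real_energy_def by (subst ennreal_mult[OF _ pos]) (auto simp: ennreal_max_0)
qed

text \<open>Weak lower semicontinuity of the energy, in the form of a convergent minorant.\<close>

lemma real_energy_minorant:
  assumes \<phi>n: "\<And>n. \<phi> n \<in> \<Phi>ad \<Omega>" and \<phi>: "\<phi>' \<in> \<Phi>ad \<Omega>" and \<epsilon>: "\<epsilon> > 0"
    and weak: "weak_conv_H1 \<Omega> \<phi> \<phi>'" and ae: "AE x in M. (\<lambda>n. \<phi> n x) \<longlonglongrightarrow> \<phi>' x"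
  obtains e where "\<And>n. e n \<le> real_energy \<epsilon> (\<phi> n)" "e \<longlonglongrightarrow> real_energy \<epsilon> \<phi>'"
proof -
  let ?k = "max 0 (1 / (2 * c0))"
  define L where "L f = (LINT x|M. wgrad \<Omega> \<phi>' x \<bullet> wgrad \<Omega> f x)" for f
  define P where "P f = (LINT x|M. (1 - (f x)\<^sup>2) / 2)" for f :: design
  \<comment> \<open>The squared gradient norm is replaced by its tangent at the limit, |b|^2 >= 2
    (a, b) - |a|^2 with a the gradient of the limit. The tangent is affine in b and so converges
    under weak convergence, while the potential converges by dominated convergence.\<close>
  define e where "e n = ?k * (\<epsilon> / 2 * (2 * L (\<phi> n) - (Lp_norm \<Omega> 2 (wgrad \<Omega> \<phi>'))\<^sup>2) + 1 / \<epsilon> * P (\<phi> n))" for n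
  show ?thesis
  proof (rule that)
    fix n
    note g = H1_D(2)[OF \<Phi>ad_D(1)[OF \<phi>]] H1_D(2)[OF \<Phi>ad_D(1)[OF \<phi>n[of n]]]
    have "2 * L (\<phi> n) - (Lp_norm \<Omega> 2 (wgrad \<Omega> \<phi>'))\<^sup>2 \<le> (Lp_norm \<Omega> 2 (wgrad \<Omega> (\<phi> n)))\<^sup>2"
      using Lp2_norm_diff_square[OF g] zero_le_power2[of "Lp_norm \<Omega> 2 (\<lambda>x. wgrad \<Omega> \<phi>' x - wgrad \<Omega> (\<phi> n) x)"]
      unfolding L_def by linarith
    then show "e n \<le> real_energy \<epsilon> (\<phi> n)"
      unfolding e_def real_energy_def P_def using \<epsilon> by (intro mult_left_mono add_right_mono) auto
  next
    have "(\<lambda>n. L (\<phi> n)) \<longlonglongrightarrow> L \<phi>'"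
      using bspec[OF weak[unfolded weak_conv_H1_def] gradient_functional_in_dual[OF \<Phi>ad_D(1)[OF \<phi>]]]
      unfolding L_def .
    moreover have "(\<lambda>n. P (\<phi> n)) \<longlonglongrightarrow> P \<phi>'"
      unfolding P_def
    proof (rule integral_dominated_convergence[where w = "\<lambda>x. 1"])
      show "(\<lambda>x. (1 - (\<phi>' x)\<^sup>2) / 2) \<in> borel_measurable M" "(\<lambda>x. (1 - (\<phi> n x)\<^sup>2) / 2) \<in> borel_measurable M" for n
        using design_potential_integrable[OF \<phi>] design_potential_integrable[OF \<phi>n] by auto
      show "AE x in M. (\<lambda>n. (1 - (\<phi> n x)\<^sup>2) / 2) \<longlonglongrightarrow> (1 - (\<phi>' x)\<^sup>2) / 2"
        using ae by eventually_elim (intro tendsto_intros, auto)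
      show "AE x in M. norm ((1 - (\<phi> n x)\<^sup>2) / 2) \<le> 1" for n
        using \<Phi>ad_D(3)[OF \<phi>n[of n]]
      proof eventually_elim
        case (elim x)
        have half: "norm ((1 - y) / 2) \<le> 1" if "0 \<le> y" "y \<le> 1" for y :: real
          using that by (simp add: abs_le_iff)
        show ?case by (rule half) (use elim in \<open>simp_all add: abs_square_le_1\<close>)
      qed
    qed simp
    ultimately have "e \<longlonglongrightarrow> ?k * (\<epsilon> / 2 * (2 * L \<phi>' - (Lp_norm \<Omega> 2 (wgrad \<Omega> \<phi>'))\<^sup>2) + 1 / \<epsilon> * P \<phi>')"
      unfolding e_def by (intro tendsto_intros)
    also have "L \<phi>' = (Lp_norm \<Omega> 2 (wgrad \<Omega> \<phi>'))\<^sup>2" unfolding L_def by (rule Lp2_inner_self)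
    finally show "e \<longlonglongrightarrow> real_energy \<epsilon> \<phi>'" by (simp add: real_energy_def P_def)
  qed
qed

text \<open>The target is given on \<open>\<omega>\<close> only. Its extension gives a field on all
  of \<open>\<Omega>\<close>; where it is artificial, the tracking weight vanishes.\<close>

lemma Lp2_extend_zero:
  fixes f :: vfield
  assumes \<omega>: "\<omega> \<subseteq> \<Omega>" "\<omega> \<in> sets lebesgue" and f: "f \<in> Lp \<omega> 2"
  shows "(\<lambda>x. if x \<in> \<omega> then f x else 0) \<in> Lp \<Omega> 2"
proof -
  have m: "(\<lambda>x. if x \<in> \<omega> then f x else 0) \<in> borel_measurable M"
    using f \<omega>(2) by (intro measurable_restrict_space1) (simp add: borel_measurable_if Lp2_iff)
  have "integrable lebesgue (\<lambda>x. if x \<in> \<omega> then (norm (f x))\<^sup>2 else 0)"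
    using f \<omega>(2) by (simp add: Lebesgue_Measure.integrable_restrict_UNIV Lp2_iff)
  then have "integrable lebesgue (\<lambda>x. if x \<in> \<Omega> then (if x \<in> \<omega> then (norm (f x))\<^sup>2 else 0) else 0)"
    by (rule back_subst[of "integrable lebesgue"]) (use \<omega>(1) in \<open>auto simp: fun_eq_iff\<close>)
  then have "integrable M (\<lambda>x. if x \<in> \<omega> then (norm (f x))\<^sup>2 else 0)"
    by (simp only: Lebesgue_Measure.integrable_restrict_UNIV[OF domain_measurable])
  moreover have "(\<lambda>x. if x \<in> \<omega> then (norm (f x))\<^sup>2 else 0) = (\<lambda>x. (norm (if x \<in> \<omega> then f x else 0))\<^sup>2)"
    by auto
  ultimately show ?thesis using m by (simp add: Lp2_iff)
qed

end

theorem theorem6p5: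
  fixes \<Omega> \<omega> :: "(real^2) set"
    and \<mu> \<epsilon> \<gamma> cP cL cA p K \<sigma> :: real
    and \<alpha> \<beta> :: "real \<Rightarrow> real"
    and A B :: "design \<Rightarrow> design"
    and u0 ud fs :: vfield
    and f :: "real \<Rightarrow> vfield"
    and S_T :: "real \<Rightarrow> design \<Rightarrow> real \<Rightarrow> vfield"
    and S_s :: "design \<Rightarrow> vfield"
    and T :: "nat \<Rightarrow> real"
    and \<phi> :: "nat \<Rightarrow> design"
    and \<phi>inf :: design
    and r :: "nat \<Rightarrow> nat"
  assumes domain: "bounded_lipschitz_domain \<Omega>"
    and omega: "\<omega> \<subseteq> \<Omega>" "\<omega> \<in> sets lebesgue"
    and params: "\<epsilon> > 0" "\<gamma> > 0" "\<mu> > 0"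
    \<comment> \<open>Poincare and Ladyzhenskaya constants\<close>
    and cP: "cP > 0" "\<forall>v\<in>H10_vec \<Omega>. Lp_norm \<Omega> 2 v \<le> cP * Lp_norm \<Omega> 2 (wjac \<Omega> v)"
    and cL: "cL > 0"
      "\<forall>v\<in>H10_vec \<Omega>. v \<in> Lp \<Omega> 4 \<and>
         Lp_norm \<Omega> 4 v \<le> sqrt cL * sqrt (Lp_norm \<Omega> 2 v) * sqrt (Lp_norm \<Omega> 2 (wjac \<Omega> v))"
    \<comment> \<open>coefficients\<close>
    and nonneg: "\<forall>s. \<alpha> s \<ge> 0" "\<forall>s. \<beta> s \<ge> 0"
    and lipschitz: "\<exists>L. L-lipschitz_on UNIV \<alpha>" "\<exists>L. L-lipschitz_on UNIV \<beta>"
    and at_1: "\<alpha> 1 = 0" "\<beta> 1 = 0"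
    and at_minus_1: "\<alpha> (- 1) > 0" "\<beta> (- 1) > 0"
    and p: "p \<ge> 4"
    and frechet: "superposition_frechet \<Omega> p \<alpha> A" "superposition_frechet \<Omega> p \<beta> B"
    and cA: "\<forall>\<phi>\<in>\<Phi>ad \<Omega>. max (Lp_norm \<Omega> p (A \<phi>)) (Lp_norm \<Omega> p (B \<phi>)) \<le> cA"
    \<comment> \<open>data\<close>
    and u0: "u0 \<in> H \<Omega>"
    and ud: "ud \<in> Lp \<omega> 2"
    and fs: "fs \<in> Lp \<Omega> 2"
    and f: "\<forall>t>0. f t \<in> Lp \<Omega> 2" "\<forall>T>0. f \<in> bochner_L2 T (Lp \<Omega> 2) (Lp_norm \<Omega> 2)"
    and small: "2 * cP\<^sup>2 * cL * Lp_norm \<Omega> 2 fs < \<mu>\<^sup>2"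
    and sigma: "\<sigma> = (\<mu>^4 - 2 * cL\<^sup>2 * cP^4 * (Lp_norm \<Omega> 2 fs)\<^sup>2) / (cP\<^sup>2 * \<mu>^3)"
    and K: "K > 0"
      "\<forall>T>0. (LINT t|lebesgue_on {0<..<T}.
                exp (\<sigma> * t) * (Lp_norm \<Omega> 2 (\<lambda>x. f t x - fs x))\<^sup>2) \<le> K"
    \<comment> \<open>solution operators\<close>
    and S_T: "\<forall>T>0. \<forall>\<phi>\<in>\<Phi>ad \<Omega>. unique_evolution_state \<Omega> \<mu> \<alpha> u0 f T \<phi> (S_T T \<phi>)"
    and S_s: "\<forall>\<phi>\<in>\<Phi>ad \<Omega>. unique_stationary_state \<Omega> \<mu> \<alpha> fs \<phi> (S_s \<phi>)"
    \<comment> \<open>minimizers for the horizons \<open>T n\<close>, convergent along the subsequence \<open>r\<close>\<close>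
    and T: "\<forall>n. T n > 0" "filterlim T at_top sequentially"
    and minimizers: "\<forall>n. is_arg_min (J_T \<Omega> \<omega> \<epsilon> \<gamma> \<beta> ud S_T (T n)) (\<lambda>\<psi>. \<psi> \<in> \<Phi>ad \<Omega>) (\<phi> n)"
    and limit: "\<phi>inf \<in> \<Phi>ad \<Omega>"
    and subseq: "strict_mono r"
    and conv_H1: "weak_conv_H1 \<Omega> (\<lambda>n. \<phi> (r n)) \<phi>inf"
    and conv_Lp: "\<forall>q\<ge>2. (\<lambda>n. Lp_norm \<Omega> q (\<lambda>x. \<phi> (r n) x - \<phi>inf x)) \<longlonglongrightarrow> 0"
    and conv_ae: "AE x in lebesgue_on \<Omega>. (\<lambda>n. \<phi> (r n) x) \<longlonglongrightarrow> \<phi>inf x"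
    and conv_Linf: "weak_star_conv_Linf \<Omega> (\<lambda>n. \<phi> (r n)) \<phi>inf"
  shows "is_arg_min (J_s \<Omega> \<omega> \<epsilon> \<gamma> \<beta> ud S_s) (\<lambda>\<psi>. \<psi> \<in> \<Phi>ad \<Omega>) \<phi>inf"
proof -

  \<comment> \<open>Instantiation and real-valued form of the objectives\<close>
  have \<Omega>: "open \<Omega>" "bounded \<Omega>" using domain by (auto simp: bounded_lipschitz_domain_def)
  obtain La where La: "La-lipschitz_on UNIV \<alpha>" using lipschitz(1) by blast
  obtain Lb where Lb: "Lb-lipschitz_on UNIV \<beta>" using lipschitz(2) by blast
  interpret navier_stokes_coefficient \<Omega> \<mu> cP cL fs \<alpha> La
    using \<Omega> params cP cL fs small nonneg La at_1
    by unfold_locales (auto simp: V_norm_def)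
  \<comment> \<open>Squaring the smallness assumption gives 4 cL^2 cP^4 |fs|^2 <= mu^4, while the
    numerator of sigma asks only for the factor 2.\<close>
  have \<sigma>: "\<sigma> \<ge> 0"
  proof -
    have "(2 * cP\<^sup>2 * cL * Lp_norm \<Omega> 2 fs)\<^sup>2 \<le> (\<mu>\<^sup>2)\<^sup>2"
      using small cL_pos by (intro power_mono) auto
    then have "4 * (cL\<^sup>2 * cP^4 * (Lp_norm \<Omega> 2 fs)\<^sup>2) \<le> \<mu>^4"
      by (simp add: power_mult_distrib mult_ac flip: power_mult)
    moreover have "0 \<le> cL\<^sup>2 * cP^4 * (Lp_norm \<Omega> 2 fs)\<^sup>2" by simp
    ultimately have "0 \<le> \<mu>^4 - 2 * cL\<^sup>2 * cP^4 * (Lp_norm \<Omega> 2 fs)\<^sup>2" by linarith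
    then show ?thesis unfolding sigma using \<mu>_pos cP_pos by simp
  qed
  define d where "d = (\<lambda>x. if x \<in> \<omega> then ud x else 0)"
  have d: "d \<in> Lp \<Omega> 2" unfolding d_def by (rule Lp2_extend_zero[OF omega ud])
  have zero: "(\<lambda>x. 0 :: real^2) \<in> Lp \<Omega> 2" by (simp add: Lp2_iff)
  define \<rho> where "\<rho> \<psi> x = (\<psi> x + 1) / 2 * indicator \<omega> x" for \<psi> :: design and x
  \<comment> \<open>Both integrals of the objectives have this form: weight
    \<open>\<rho> \<psi>\<close> with target \<open>d\<close> for tracking, and the values of
    \<open>\<beta>\<close> along the design with target 0 for the penalty. Each estimate is proved
    once and used twice.\<close>
  define Q where "Q w y v = (LINT x|M. w x * (norm (v x - y x))\<^sup>2)" for w :: design and y v :: vfield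
  have ind: "indicat_real \<omega> \<in> borel_measurable M"
    by (intro measurable_restrict_space1 borel_measurable_indicator omega)
  have \<rho>: "\<rho> \<psi> \<in> borel_measurable M" "AE x in M. \<bar>\<rho> \<psi> x\<bar> \<le> 1" if \<psi>: "\<psi> \<in> \<Phi>ad \<Omega>" for \<psi>
  proof -
    show "\<rho> \<psi> \<in> borel_measurable M"
      unfolding \<rho>_def using ind \<Phi>ad_D(2)[OF \<psi>] by measurable
    show "AE x in M. \<bar>\<rho> \<psi> x\<bar> \<le> 1"
      using \<Phi>ad_D(3)[OF \<psi>] by eventually_elim (auto simp: \<rho>_def indicator_def)
  qed
  note \<beta> = lipschitz_composition_bound[OF Lb at_1(2)]
  have Lb0: "0 \<le> 2 * Lb" using lipschitz_on_nonneg[OF Lb] by simp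
  have S: "stationary_solution \<Omega> \<mu> \<alpha> fs \<psi> (S_s \<psi>)" if "\<psi> \<in> \<Phi>ad \<Omega>" for \<psi>
    using S_s that by (auto simp: unique_stationary_state_def)
  have SV: "S_s \<psi> \<in> V \<Omega>" if "\<psi> \<in> \<Phi>ad \<Omega>" for \<psi> using S[OF that] by (simp add: stationary_solution_def)
  define Fs where "Fs \<psi> = Q (\<rho> \<psi>) d (S_s \<psi>) + Q (\<lambda>x. \<beta> (\<psi> x)) (\<lambda>x. 0) (S_s \<psi>)" for \<psi>
  define FT where "FT h \<psi> = 1 / h * ((LINT t|J 0 h. Q (\<rho> \<psi>) d (S_T h \<psi> t))
      + (LINT t|J 0 h. Q (\<lambda>x. \<beta> (\<psi> x)) (\<lambda>x. 0) (S_T h \<psi> t)))" for h \<psi>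
  have tracking: "(\<psi> x + 1) / 2 * (norm (v x - ud x))\<^sup>2 * indicator \<omega> x = \<rho> \<psi> x * (norm (v x - d x))\<^sup>2" for \<psi> v x
    by (simp add: \<rho>_def d_def indicator_def)
  have energy: "ereal \<gamma> * enn2ereal (energy \<Omega> \<epsilon> \<psi>) = ereal (\<gamma> * real_energy \<epsilon> \<psi>)" if "\<psi> \<in> \<Phi>ad \<Omega>" for \<psi>
    using energy_eq_real_energy[OF that params(1)] by (simp add: enn2ereal_ennreal)
  have Js: "J_s \<Omega> \<omega> \<epsilon> \<gamma> \<beta> ud S_s \<psi> = ereal (Fs \<psi> + \<gamma> * real_energy \<epsilon> \<psi>)" if "\<psi> \<in> \<Phi>ad \<Omega>" for \<psi>
    unfolding J_s_def energy[OF that] tracking by (simp add: Fs_def Q_def)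
  have JT: "J_T \<Omega> \<omega> \<epsilon> \<gamma> \<beta> ud S_T h \<psi> = ereal (FT h \<psi> + \<gamma> * real_energy \<epsilon> \<psi>)" if "\<psi> \<in> \<Phi>ad \<Omega>" for h \<psi>
    unfolding J_T_def energy[OF that] tracking by (simp add: FT_def Q_def)

  \<comment> \<open>Uniform gap between the time-dependent and the stationary objective\<close>
  define X where "X = decay_bound u0 K"
  define D where "D = cP * (cP * Lp_norm \<Omega> 2 fs / \<mu>) + Lp_norm \<Omega> 2 d"
  \<comment> \<open>The factor adds the bounds of the two weights, 1 for tracking and
    \<open>2 * Lb\<close> for the penalty; \<open>D\<close> bounds the distance of the stationary
    state from either target.\<close>
  define \<delta> where "\<delta> h = (1 + 2 * Lb) * (cP\<^sup>2 * X / h + (cP\<^sup>2 * X + D\<^sup>2) / sqrt h)" for h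
  have gap: "\<bar>FT h \<psi> - Fs \<psi>\<bar> \<le> \<delta> h" if \<psi>: "\<psi> \<in> \<Phi>ad \<Omega>" and h: "h > 0" for \<psi> h
  proof -
    have ev: "evolution_solution \<Omega> \<mu> \<alpha> u0 f h \<psi> (S_T h \<psi>)"
      using S_T \<psi> h by (auto simp: unique_evolution_state_def)
    have f1: "f t \<in> Lp \<Omega> 2" if "t > 0" for t using f(1) that by blast
    have f2: "f \<in> bochner_L2 h (Lp \<Omega> 2) (Lp_norm \<Omega> 2)" using f(2) h by blast
    have Kh: "(LINT t|J 0 h. exp (\<sigma> * t) * (Lp_norm \<Omega> 2 (\<lambda>x. f t x - fs x))\<^sup>2) \<le> K" using K(2) h by blast
    note decay = evolution_decay[OF \<psi> h ev S[OF \<psi>] u0 f1 f2 Kh \<sigma>]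
    note v = SV[OF \<psi>]
    have X: "(LINT t|J 0 h. (V_norm \<Omega> (\<lambda>x. S_T h \<psi> t x - S_s \<psi> x))\<^sup>2) \<le> X" unfolding X_def by (rule decay(2))
    have D1: "Lp_norm \<Omega> 2 (\<lambda>x. S_s \<psi> x - d x) \<le> D"
      using Lp2_triangle_diff[OF V_D(2)[OF v] d] stationary_Lp2_bound[OF S[OF \<psi>]] unfolding D_def by linarith
    have D2: "Lp_norm \<Omega> 2 (\<lambda>x. S_s \<psi> x - 0) \<le> D"
      using stationary_Lp2_bound[OF S[OF \<psi>]] Lp_norm_nonneg[of \<Omega> 2 d] unfolding D_def diff_zero by linarith
    have 1: "\<bar>1 / h * (LINT t|J 0 h. Q (\<rho> \<psi>) d (S_T h \<psi> t)) - Q (\<rho> \<psi>) d (S_s \<psi>)\<bar>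
        \<le> 1 * (cP\<^sup>2 * X / h + (cP\<^sup>2 * X + D\<^sup>2) / sqrt h)"
      unfolding Q_def by (rule time_average_weighted_square[OF \<rho>[OF \<psi>] zero_le_one d decay(1) v h X D1])
    have 2: "\<bar>1 / h * (LINT t|J 0 h. Q (\<lambda>x. \<beta> (\<psi> x)) (\<lambda>x. 0) (S_T h \<psi> t)) - Q (\<lambda>x. \<beta> (\<psi> x)) (\<lambda>x. 0) (S_s \<psi>)\<bar>
        \<le> (2 * Lb) * (cP\<^sup>2 * X / h + (cP\<^sup>2 * X + D\<^sup>2) / sqrt h)"
      unfolding Q_def by (rule time_average_weighted_square[OF \<beta>[OF \<psi>] Lb0 zero decay(1) v h X D2])
    show ?thesis
      using 1 2 unfolding FT_def Fs_def \<delta>_def distrib_left[of "1 / h"] distrib_right[of 1 "2 * Lb"] by linarith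
  qed
  have \<delta>_lim: "(\<lambda>n. \<delta> (T (r n))) \<longlonglongrightarrow> 0"
  proof -
    have Tr: "filterlim (\<lambda>n. T (r n)) at_top sequentially"
      by (rule filterlim_compose[OF T(2) filterlim_subseq[OF subseq]])
    have "(\<lambda>n. \<delta> (T (r n))) \<longlonglongrightarrow> (1 + 2 * Lb) * (0 + 0)"
      unfolding \<delta>_def
      by (intro tendsto_intros tendsto_divide_0[OF tendsto_const] filterlim_at_top_imp_at_infinity Tr
          filterlim_compose[OF sqrt_at_top Tr])
    then show ?thesis by simp
  qed

  \<comment> \<open>Convergence of the stationary objective along the minimizers\<close>
  define \<phi>' where "\<phi>' n = \<phi> (r n)" for n
  have \<phi>': "\<phi>' n \<in> \<Phi>ad \<Omega>" for n using minimizers by (auto simp: is_arg_min_def \<phi>'_def)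
  define p where "p n = Lp_norm \<Omega> 2 (\<lambda>x. S_s (\<phi>' n) x - S_s \<phi>inf x)" for n
  have "p \<longlonglongrightarrow> 0"
  proof -
    define C where "C = cP * (2 / \<mu> * (La * sqrt (cL * cP) * Lp_norm \<Omega> 4 (S_s \<phi>inf)))"
    have le: "p n \<le> C * Lp_norm \<Omega> 2 (\<lambda>x. \<phi>' n x - \<phi>inf x)" for n
    proof -
      have "V_norm \<Omega> (\<lambda>x. S_s (\<phi>' n) x - S_s \<phi>inf x) \<le>
          2 / \<mu> * (La * sqrt (cL * cP) * Lp_norm \<Omega> 4 (S_s \<phi>inf) * Lp_norm \<Omega> 2 (\<lambda>x. \<phi>' n x - \<phi>inf x))"
        using stationary_stability[OF limit \<phi>' S[OF limit] S[OF \<phi>'], of n] \<mu>_pos by (simp add: field_simps)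
      from mult_left_mono[OF this less_imp_le[OF cP_pos]]
      have "cP * V_norm \<Omega> (\<lambda>x. S_s (\<phi>' n) x - S_s \<phi>inf x) \<le> C * Lp_norm \<Omega> 2 (\<lambda>x. \<phi>' n x - \<phi>inf x)"
        unfolding C_def by (simp only: mult.assoc)
      then show ?thesis
        unfolding p_def using Lp2_norm_V_le[OF V_diff[OF SV[OF \<phi>'] SV[OF limit]], of n] by linarith
    qed
    have lim: "(\<lambda>n. Lp_norm \<Omega> 2 (\<lambda>x. \<phi>' n x - \<phi>inf x)) \<longlonglongrightarrow> 0"
      using conv_Lp unfolding \<phi>'_def by simp
    show ?thesis
    proof (rule tendsto_sandwich[OF _ _ tendsto_const tendsto_mult_right_zero[OF lim, of C]])
      show "\<forall>\<^sub>F n in sequentially. 0 \<le> p n" by (simp add: p_def)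
      show "\<forall>\<^sub>F n in sequentially. p n \<le> C * Lp_norm \<Omega> 2 (\<lambda>x. \<phi>' n x - \<phi>inf x)"
        using le by (intro always_eventually allI)
    qed
  qed
  then have state_lim: "(\<lambda>n. Lp_norm \<Omega> 2 (\<lambda>x. S_s (\<phi>' n) x - S_s \<phi>inf x)) \<longlonglongrightarrow> 0"
    by (simp add: p_def[abs_def])
  have ae: "AE x in M. (\<lambda>n. \<phi>' n x) \<longlonglongrightarrow> \<phi>inf x" using conv_ae by (simp add: \<phi>'_def)
  have Fs_lim: "(\<lambda>n. Fs (\<phi>' n)) \<longlonglongrightarrow> Fs \<phi>inf"
    unfolding Fs_def Q_def
  proof (rule tendsto_add)
    have "AE x in M. (\<lambda>n. \<rho> (\<phi>' n) x) \<longlonglongrightarrow> \<rho> \<phi>inf x"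
      using ae unfolding \<rho>_def by eventually_elim (intro tendsto_intros, auto)
    from weighted_square_tendsto[OF \<rho>[OF \<phi>'] zero_le_one \<rho>(1)[OF limit] this V_D(2)[OF SV[OF \<phi>']] V_D(2)[OF SV[OF limit]] d state_lim]
    show "(\<lambda>n. LINT x|M. \<rho> (\<phi>' n) x * (norm (S_s (\<phi>' n) x - d x))\<^sup>2) \<longlonglongrightarrow>
        (LINT x|M. \<rho> \<phi>inf x * (norm (S_s \<phi>inf x - d x))\<^sup>2)" .
    have "isCont \<beta> y" for y
      using lipschitz_on_continuous_on[OF Lb] by (simp add: continuous_on_eq_continuous_at)
    then have "AE x in M. (\<lambda>n. \<beta> (\<phi>' n x)) \<longlonglongrightarrow> \<beta> (\<phi>inf x)"
      using ae by (auto elim!: eventually_mono intro: isCont_tendsto_compose)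
    from weighted_square_tendsto[OF \<beta>[OF \<phi>'] Lb0 \<beta>(1)[OF limit] this V_D(2)[OF SV[OF \<phi>']] V_D(2)[OF SV[OF limit]] zero state_lim]
    show "(\<lambda>n. LINT x|M. \<beta> (\<phi>' n x) * (norm (S_s (\<phi>' n) x - 0))\<^sup>2) \<longlonglongrightarrow>
        (LINT x|M. \<beta> (\<phi>inf x) * (norm (S_s \<phi>inf x - 0))\<^sup>2)" .
  qed
  obtain e where e: "\<And>n. e n \<le> real_energy \<epsilon> (\<phi>' n)" "e \<longlonglongrightarrow> real_energy \<epsilon> \<phi>inf"
    using real_energy_minorant[OF \<phi>' limit params(1) conv_H1[folded \<phi>'_def] ae] by blast

  \<comment> \<open>The gap is paid twice, at the minimizer and at the competitor, hence
    \<open>2 * \<delta>\<close>. The energy of the minimizer is first lowered to the convergent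
    minorant \<open>e n\<close>, so that both sides have limits.\<close>
  have "Fs \<phi>inf + \<gamma> * real_energy \<epsilon> \<phi>inf \<le> Fs \<psi> + \<gamma> * real_energy \<epsilon> \<psi>" if \<psi>: "\<psi> \<in> \<Phi>ad \<Omega>" for \<psi>
  proof (rule LIMSEQ_le)
    show "(\<lambda>n. Fs (\<phi>' n) + \<gamma> * e n) \<longlonglongrightarrow> Fs \<phi>inf + \<gamma> * real_energy \<epsilon> \<phi>inf"
      by (intro tendsto_intros Fs_lim e(2))
    have "(\<lambda>n. Fs \<psi> + \<gamma> * real_energy \<epsilon> \<psi> + 2 * \<delta> (T (r n))) \<longlonglongrightarrow> Fs \<psi> + \<gamma> * real_energy \<epsilon> \<psi> + 2 * 0"
      by (intro tendsto_intros \<delta>_lim)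
    then show "(\<lambda>n. Fs \<psi> + \<gamma> * real_energy \<epsilon> \<psi> + 2 * \<delta> (T (r n))) \<longlonglongrightarrow> Fs \<psi> + \<gamma> * real_energy \<epsilon> \<psi>"
      by simp
    have "Fs (\<phi>' n) + \<gamma> * e n \<le> Fs \<psi> + \<gamma> * real_energy \<epsilon> \<psi> + 2 * \<delta> (T (r n))" for n
    proof -
      have Tn: "T (r n) > 0" using T(1) by blast
      have "\<not> J_T \<Omega> \<omega> \<epsilon> \<gamma> \<beta> ud S_T (T (r n)) \<psi> < J_T \<Omega> \<omega> \<epsilon> \<gamma> \<beta> ud S_T (T (r n)) (\<phi>' n)"
        using minimizers \<psi> by (auto simp: is_arg_min_def \<phi>'_def)
      then have "FT (T (r n)) (\<phi>' n) + \<gamma> * real_energy \<epsilon> (\<phi>' n) \<le> FT (T (r n)) \<psi> + \<gamma> * real_energy \<epsilon> \<psi>"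
        unfolding JT[OF \<psi>] JT[OF \<phi>'] by simp
      moreover have "\<gamma> * e n \<le> \<gamma> * real_energy \<epsilon> (\<phi>' n)"
        using e(1)[of n] params(2) by simp
      ultimately show ?thesis using gap[OF \<phi>'[of n] Tn] gap[OF \<psi> Tn] by linarith
    qed
    then show "\<exists>N. \<forall>n\<ge>N. Fs (\<phi>' n) + \<gamma> * e n \<le> Fs \<psi> + \<gamma> * real_energy \<epsilon> \<psi> + 2 * \<delta> (T (r n))" by blast
  qed
  then show ?thesis
    using limit unfolding is_arg_min_def by (auto simp: Js not_less)
qed

end
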